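(* Let $N\ge2$, $s\in(0,1)$, and let $\Omega\subset\mathbb{R}^N$ be a bounded domain of class $C^2$ which is Steiner symmetric with respect to the hyperplane $T=\{x=(x_1,x')\in\mathbb{R}^N:x_1=0\}$. Let $\rho_0\in L^\infty(\Omega)$ be such that $|\{\rho_0>0\}|>0$. Then every minimizer $\check{\rho}_1$ of the problem $$\lambda_1(\check{\rho}_1)=\min_{\rho\in\mathcal{G}(\rho_0)}\lambda_1(\rho),\qquad\check{\rho}_1\in\mathcal{G}(\rho_0),$$ is Steiner symmetric relative to $T$, i.e. $\check{\rho}_1^\sharp=\check{\rho}_1$ a.e. in $\Omega$.
   Context: $H_0^s(\Omega)=\{u\in H^s(\mathbb{R}^N): u=0 \text{ a.e. in } \mathbb{R}^N\setminus\Omega\}$ is a Hilbert space with inner product $\langle u,v\rangle_{H_0^s(\Omega)}=\int_{\mathbb{R}^{2N}}\frac{(u(x)-u(y))(v(x)-v(y))}{|x-y|^{N+2s}}\,dx\,dy$ and associated norm. For $\rho\in L^\infty(\Omega)$, an eigenvalue of the problem $(-\Delta)^su=\lambda\rho u$ in $\Omega$, $u=0$ in $\mathbb{R}^N\setminus\Omega$, is a $\lambda\in\mathbb{R}$ for which there is $u\in H_0^s(\Omega)\setminus\{0\}$ with $\langle u,\varphi\rangle_{H_0^s(\Omega)}=\lambda\int_\Omega\rho u\varphi\,dx$ for all $\varphi\in H_0^s(\Omega)$. If $|\{\rho>0\}|>0$ (where $\{\rho>0\}=\{x\in\Omega:\rho(x)>0\}$ and $|\cdot|$ is Lebesgue measure),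 $\lambda_1(\rho)>0$ denotes the smallest positive eigenvalue; $1/\lambda_1(\rho)=\max_{f\in H_0^s(\Omega),\,f\neq0}\frac{\int_\Omega\rho f^2\,dx}{\|f\|^2_{H_0^s(\Omega)}}$. Two measurable functions $f,g:\Omega\to\mathbb{R}$ are rearrangements of one another ($f\sim g$) if $|\{x\in\Omega:f(x)>t\}|=|\{x\in\Omega:g(x)>t\}|$ for all $t\in\mathbb{R}$; $\mathcal{G}(\rho_0)=\{g:\Omega\to\mathbb{R}\text{ measurable}: g\sim\rho_0\}$. Steiner symmetrization: for $x'\in\mathbb{R}^{N-1}$ let $l(x')=\{(x_1,x'):x_1\in\mathbb{R}\}$. For a measurable set $E\subset\mathbb{R}^N$, its Steiner symmetrization with respect to $T$ is $E^\sharp=\{(x_1,x')\in\mathbb{R}^N:2|x_1|<|E\cap l(x')|_1,\ x'\in\mathbb{R}^{N-1}\}$, where $|\cdot|_1$ is one-dimensional Lebesgue measure; $E$ is Steiner symmetric if $E^\sharp=E$. For a measurable function $u:E\to\mathbb{R}$ bounded from below on a set $E$ of finite measure, $u^\sharp:E^\sharp\to\mathbb{R}$ is $u^\sharp(x)=\sup\{c\in\mathbb{R}:x\in\{u>c\}^\sharp\}$; $u$ is Steiner symmetric if $u^\sharp=u$. Elements of $L^\infty(\Omega)$ are identified when equal a.e. *)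

theory Defs
  imports "HOL-Analysis.Analysis"
begin

text \<open>
  The space \<open>\<real>\<^sup>N\<close> with \<open>N \<ge> 2\<close> is modelled by the type \<open>real \<times> 'a\<close> with
  \<open>'a :: euclidean_space\<close>, a point being \<open>x = (x1, x')\<close>.  The product carries the Euclidean
  norm and \<open>N = DIM(real \<times> 'a) = 1 + DIM('a)\<close>, where \<open>DIM('a) \<ge> 1\<close> is arbitrary.
  Functions on a set \<open>\<Omega>\<close> are total functions of which only the values on \<open>\<Omega>\<close> are used;
  ``measurable'' means Lebesgue measurable.
\<close>

definition C2_function :: "('a::euclidean_space \<Rightarrow> real) \<Rightarrow> bool" where
  "C2_function f \<longleftrightarrow>
     (\<exists>(D :: 'a \<Rightarrow> 'a \<Rightarrow>\<^sub>L real) (D2 :: 'a \<Rightarrow> 'a \<Rightarrow>\<^sub>L ('a \<Rightarrow>\<^sub>L real)).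
        (\<forall>x. (f has_derivative blinfun_apply (D x)) (at x)) \<and>
        (\<forall>x. (D has_derivative blinfun_apply (D2 x)) (at x)) \<and>
        continuous_on UNIV D2)"

text \<open>
  The boundary is locally, after an orthogonal change of coordinates, the graph of a \<open>C\<^sup>2\<close>
  function, with the set lying on one side of it.
\<close>
definition class_C2 :: "(real \<times> 'a::euclidean_space) set \<Rightarrow> bool" where
  "class_C2 \<Omega> \<longleftrightarrow>
     (\<forall>z \<in> frontier \<Omega>. \<exists>r>0. \<exists>(T :: real \<times> 'a \<Rightarrow> real \<times> 'a) \<gamma>.
        orthogonal_transformation T \<and> C2_function \<gamma> \<and>
        \<Omega> \<inter> ball z r = {x \<in> ball z r. fst (T x) > \<gamma> (snd (T x))})"

definition bounded_C2_domain :: "(real \<times> 'a::euclidean_space) set \<Rightarrow> bool" where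
  "bounded_C2_domain \<Omega> \<longleftrightarrow>
     open \<Omega> \<and> connected \<Omega> \<and> \<Omega> \<noteq> {} \<and> bounded \<Omega> \<and> class_C2 \<Omega>"

definition Linfty :: "(real \<times> 'a::euclidean_space) set \<Rightarrow> (real \<times> 'a \<Rightarrow> real) set" where
  "Linfty \<Omega> = {f \<in> borel_measurable (lebesgue_on \<Omega>).
                 \<exists>M. AE x in lebesgue_on \<Omega>. \<bar>f x\<bar> \<le> M}"

text \<open>
  On the diagonal (a null set) the kernel quotients below are \<open>0 / 0 = 0\<close>.
\<close>
definition Hs :: "real \<Rightarrow> (real \<times> 'a::euclidean_space \<Rightarrow> real) set" where
  "Hs s = {u \<in> borel_measurable lebesgue.
             integrable lebesgue (\<lambda>x. (u x)\<^sup>2) \<and>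
             integrable lebesgue
               (\<lambda>(x, y). (u x - u y)\<^sup>2 / norm (x - y) powr (real DIM(real \<times> 'a) + 2 * s))}"

definition Hs0 :: "real \<Rightarrow> (real \<times> 'a::euclidean_space) set \<Rightarrow> (real \<times> 'a \<Rightarrow> real) set" where
  "Hs0 s \<Omega> = {u \<in> Hs s. AE x in lebesgue. x \<notin> \<Omega> \<longrightarrow> u x = 0}"

definition Hs0_inner ::
    "real \<Rightarrow> (real \<times> 'a::euclidean_space \<Rightarrow> real) \<Rightarrow> (real \<times> 'a \<Rightarrow> real) \<Rightarrow> real" where
  "Hs0_inner s u v =
     (LINT (x, y)|lebesgue.
        (u x - u y) * (v x - v y) / norm (x - y) powr (real DIM(real \<times> 'a) + 2 * s))"

text \<open>
  Elements of \<open>Hs0 s \<Omega>\<close> are representatives, so ``nonzero'' means not almost everywhere zero.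
\<close>
definition eigenvalue ::
    "real \<Rightarrow> (real \<times> 'a::euclidean_space) set \<Rightarrow> (real \<times> 'a \<Rightarrow> real) \<Rightarrow> real \<Rightarrow> bool" where
  "eigenvalue s \<Omega> \<rho> \<mu> \<longleftrightarrow>
     (\<exists>u \<in> Hs0 s \<Omega>. \<not> (AE x in lebesgue. u x = 0) \<and>
        (\<forall>\<phi> \<in> Hs0 s \<Omega>.
           Hs0_inner s u \<phi> = \<mu> * (LINT x|lebesgue_on \<Omega>. \<rho> x * u x * \<phi> x)))"

definition lambda1 ::
    "real \<Rightarrow> (real \<times> 'a::euclidean_space) set \<Rightarrow> (real \<times> 'a \<Rightarrow> real) \<Rightarrow> real" where
  "lambda1 s \<Omega> \<rho> = (LEAST \<mu>. 0 < \<mu> \<and> eigenvalue s \<Omega> \<rho> \<mu>)"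

definition rearrangement ::
    "(real \<times> 'a::euclidean_space) set \<Rightarrow> (real \<times> 'a \<Rightarrow> real) \<Rightarrow> (real \<times> 'a \<Rightarrow> real) \<Rightarrow> bool" where
  "rearrangement \<Omega> f g \<longleftrightarrow>
     (\<forall>t::real. emeasure lebesgue {x \<in> \<Omega>. f x > t} = emeasure lebesgue {x \<in> \<Omega>. g x > t})"

definition rearrangement_class ::
    "(real \<times> 'a::euclidean_space) set \<Rightarrow> (real \<times> 'a \<Rightarrow> real) \<Rightarrow> (real \<times> 'a \<Rightarrow> real) set" where
  "rearrangement_class \<Omega> \<rho>\<^sub>0 =
     {g \<in> borel_measurable (lebesgue_on \<Omega>). rearrangement \<Omega> g \<rho>\<^sub>0}"

text \<open>
  For a Lebesgue measurable set, only almost every slice need be measurable; the remaining slices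
  get measure \<open>0\<close> here, which changes the symmetrization by a null set only.
\<close>
definition steiner_set ::
    "(real \<times> 'a::euclidean_space) set \<Rightarrow> (real \<times> 'a) set" where
  "steiner_set E = {(x1, x'). ennreal (2 * \<bar>x1\<bar>) < emeasure lebesgue {t::real. (t, x') \<in> E}}"

text \<open>
  The supremum is taken in \<open>real\<close>.  For a measurable, essentially bounded \<open>u\<close> on a bounded \<open>E\<close>, the
  set of levels is nonempty and bounded above for almost every \<open>x\<close> in \<open>steiner_set E\<close>; on the
  exceptional null set the value is irrelevant.
\<close>
definition steiner_fun ::
    "(real \<times> 'a::euclidean_space) set \<Rightarrow> (real \<times> 'a \<Rightarrow> real) \<Rightarrow> real \<times> 'a \<Rightarrow> real" where
  "steiner_fun E u x = Sup {c::real. x \<in> steiner_set {y \<in> E. u y > c}}"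

end

theory Submission
  imports Defs "HOL-Library.Diagonal_Subsequence"
begin

text \<open>
The reciprocal of \<open>\<lambda>\<^sub>1(\<rho>)\<close> is the largest value of the quotient \<open>\<integral> \<rho> f\<^sup>2 / \<parallel>f\<parallel>\<^sup>2\<close>, so a minimizer \<open>\<rho>\<close> of \<open>\<lambda>\<^sub>1\<close> is a weight
in its rearrangement class for which this largest value is as large as possible.  The proof compares \<open>\<rho>\<close> with its
polarizations (two-point rearrangements) instead of with \<open>\<rho>\<^sup>\<sharp>\<close>; this replaces the Riesz rearrangement inequality and
the discussion of its equality case by an inequality between four numbers.

Fix \<open>a \<noteq> 0\<close>, let \<open>\<sigma>\<close> be the reflection in \<open>{x\<^sub>1 = a}\<close> and \<open>H\<close> the side of this hyperplane that contains the origin.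
The polarization \<open>u\<^sub>H\<close> takes the larger of the values \<open>u(x), u(\<sigma> x)\<close> at the point that lies in \<open>H\<close> and the smaller one at the
other point.  Since \<open>\<Omega>\<close> is Steiner symmetric, \<open>\<sigma>\<close> maps the part of \<open>\<Omega>\<close> outside \<open>H\<close> into \<open>\<Omega>\<close>, so that polarization
preserves \<open>H\<^sup>s\<^sub>0(\<Omega>)\<close> for nonnegative functions, and, done on \<open>\<Omega> \<inter> \<sigma> \<Omega>\<close> only, also the rearrangement class.  Two points on the same side
of the hyperplane are closer to each other than each is to the mirror image of the other, hence \<open>\<parallel>u\<^sub>H\<parallel> \<le> \<parallel>u\<parallel>\<close>
(\<open>energy_polarize_le\<close>), while \<open>\<integral> \<rho> u\<^sup>2 \<le> \<integral> \<rho>\<^sub>H u\<^sub>H\<^sup>2\<close> (\<open>weight_form_fold_le\<close>).  If \<open>\<rho>\<close> is a minimizer and \<open>u \<ge> 0\<close> is optimal for it,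
both inequalities are therefore equalities.

Equality of the energies forces \<open>u \<ge> u \<circ> \<sigma>\<close> almost everywhere in \<open>H\<close>, or \<open>u \<le> u \<circ> \<sigma>\<close> almost everywhere in \<open>H\<close>
(\<open>energy_polarize_eq\<close>).  The second alternative is impossible, because \<open>u > 0\<close> almost everywhere in \<open>\<Omega>\<close>
(\<open>maximizer_positive\<close>, a strong maximum principle) and \<open>\<Omega>\<close> is not symmetric about \<open>{x\<^sub>1 = a}\<close>
(\<open>not_mirror_symmetric\<close>).  So \<open>u = u\<^sub>H\<close> is optimal for \<open>\<rho>\<close> and for \<open>\<rho>\<^sub>H\<close> with the same value; the difference of the two
Euler-Lagrange equations is \<open>(\<rho>\<^sub>H - \<rho>) u = 0\<close>, and positivity of \<open>u\<close> gives \<open>\<rho>\<^sub>H = \<rho>\<close> (\<open>polarization_optimal\<close>).  Letting \<open>a\<close> vary,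
on almost every line parallel to the \<open>x\<^sub>1\<close>-axis the weight is, up to a null set, a nonincreasing function of \<open>\<bar>x\<^sub>1\<bar>\<close>, and this is
what \<open>\<rho>\<^sup>\<sharp> = \<rho>\<close> means (\<open>steiner_fun_of_mirror_ordered\<close>).

That \<open>\<lambda>\<^sub>1\<close> is the reciprocal of an attained maximum rests on the compact embedding of \<open>H\<^sup>s\<^sub>0(\<Omega>)\<close> into
\<open>L\<^sup>2\<close> (\<open>Rellich_compactness\<close>), obtained from the elementary fractional Poincare inequality on small cubes.
\<close>

section \<open>The energy space\<close>

text \<open>
On the diagonal the value is \<open>1 / 0 = 0\<close>.
\<close>
definition kernel :: "real \<Rightarrow> 'b::euclidean_space \<Rightarrow> 'b \<Rightarrow> real" where
  "kernel s x y = 1 / norm (x - y) powr (real DIM('b) + 2 * s)"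

text \<open>
With the kernel as a density, the inner product of \<open>H\<^sup>s\<^sub>0\<close> is the \<open>L\<^sup>2\<close> inner product of the difference
functions \<open>u(x) - u(y)\<close>.
\<close>
definition gagliardo :: "real \<Rightarrow> ('b::euclidean_space \<times> 'b) measure" where
  "gagliardo s = density lborel
     (\<lambda>z. ennreal (kernel s (fst z) (snd z)))"

definition energy :: "real \<Rightarrow> ('b::euclidean_space \<Rightarrow> real) \<Rightarrow> ('b \<Rightarrow> real) \<Rightarrow> real" where
  "energy s u v = (\<integral>z. (u (fst z) - u (snd z)) * (v (fst z) - v (snd z)) \<partial>gagliardo s)"

text \<open>
The functions of \<open>H\<^sup>s\<^sub>0(\<Omega>)\<close> that are Borel measurable and vanish at every point outside \<open>\<Omega>\<close>.  Each class of \<open>H\<^sup>s\<^sub>0(\<Omega>)\<close>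
contains such a function; with Borel functions, Fubini's theorem and reflections of slices cause no measurability questions.
\<close>
definition W0 :: "real \<Rightarrow> 'b::euclidean_space set \<Rightarrow> ('b \<Rightarrow> real) set" where
  "W0 s \<Omega> = {u \<in> borel_measurable borel. (\<forall>x. x \<notin> \<Omega> \<longrightarrow> u x = 0)
      \<and> integrable lborel (\<lambda>x. (u x)\<^sup>2)
      \<and> integrable (gagliardo s) (\<lambda>z. (u (fst z) - u (snd z))\<^sup>2)}"

lemma sets_gagliardo [measurable_cong, simp]: "sets (gagliardo s) = sets borel"
  by (simp add: gagliardo_def)

text \<open>
The projections are usually measurable for \<open>borel \<Otimes>\<^sub>M borel\<close>; on pairs of points the Lebesgue measure has the sigma-algebra
\<open>borel\<close>, and with this form of the rules the measurability prover need not recognize it as a product.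
\<close>
lemma measurable_fst_borel [measurable]: "fst \<in> borel_measurable (borel :: ('a::topological_space \<times> 'b::topological_space) measure)"
  by (intro borel_measurable_continuous_onI continuous_intros)

lemma measurable_snd_borel [measurable]: "snd \<in> borel_measurable (borel :: ('a::topological_space \<times> 'b::topological_space) measure)"
  by (intro borel_measurable_continuous_onI continuous_intros)

lemma W0D:
  assumes "u \<in> W0 s \<Omega>"
  shows "u \<in> borel_measurable borel" "\<And>x. x \<notin> \<Omega> \<Longrightarrow> u x = 0"
    "integrable lborel (\<lambda>x. (u x)\<^sup>2)"
    "integrable (gagliardo s) (\<lambda>z. (u (fst z) - u (snd z))\<^sup>2)"
  using assms by (auto simp: W0_def)

lemma integrable_mult_of_squares:
  fixes f g :: "'c \<Rightarrow> real"
  assumes [measurable]: "f \<in> borel_measurable M" "g \<in> borel_measurable M"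
    and "integrable M (\<lambda>x. (f x)\<^sup>2)" "integrable M (\<lambda>x. (g x)\<^sup>2)"
  shows "integrable M (\<lambda>x. f x * g x)"
proof (rule Bochner_Integration.integrable_bound)
  show "integrable M (\<lambda>x. (f x)\<^sup>2 + (g x)\<^sup>2)"
    using assms by simp
  have "\<bar>a * b\<bar> \<le> \<bar>a\<^sup>2 + b\<^sup>2\<bar>" for a b :: real
  proof -
    have "2 * \<bar>a * b\<bar> \<le> a\<^sup>2 + b\<^sup>2"
      using sum_squares_bound[of "\<bar>a\<bar>" "\<bar>b\<bar>"] by (simp add: abs_mult)
    then show ?thesis by linarith
  qed
  then show "AE x in M. norm (f x * g x) \<le> norm ((f x)\<^sup>2 + (g x)\<^sup>2)"
    by simp
qed measurable

text \<open>
The source of all closure properties of the energy space: sums, multiples, absolute values, and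
products of bounded functions are pointwise controlled, together with their increments, by their ingredients.
\<close>
lemma W0_dominated:
  assumes u: "u \<in> W0 s \<Omega>" and w: "w \<in> W0 s \<Omega>"
    and [measurable]: "v \<in> borel_measurable borel"
    and b0: "\<And>x. \<bar>v x\<bar> \<le> C * (\<bar>u x\<bar> + \<bar>w x\<bar>)"
    and b1: "\<And>x y. \<bar>v x - v y\<bar> \<le> C * (\<bar>u x - u y\<bar> + \<bar>w x - w y\<bar>)"
  shows "v \<in> W0 s \<Omega>"
proof -
  note [measurable] = W0D(1)[OF u] W0D(1)[OF w]
  have sq: "c\<^sup>2 \<le> 2 * C\<^sup>2 * (a\<^sup>2 + b\<^sup>2)" if "\<bar>c\<bar> \<le> C * (\<bar>a\<bar> + \<bar>b\<bar>)" for a b c :: real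
  proof -
    have "c\<^sup>2 \<le> (C * (\<bar>a\<bar> + \<bar>b\<bar>))\<^sup>2"
      by (rule abs_le_square_iff[THEN iffD1]) (use that in linarith)
    also have "\<dots> \<le> C\<^sup>2 * (2 * (a\<^sup>2 + b\<^sup>2))"
    proof -
      have "(\<bar>a\<bar> + \<bar>b\<bar>)\<^sup>2 \<le> 2 * (a\<^sup>2 + b\<^sup>2)"
        using sum_squares_bound[of "\<bar>a\<bar>" "\<bar>b\<bar>"] by (simp add: power2_sum)
      then show ?thesis by (simp add: power_mult_distrib mult_left_mono)
    qed
    finally show ?thesis by (simp add: algebra_simps)
  qed
  show ?thesis unfolding W0_def
  proof (intro CollectI conjI allI impI)
    fix x assume "x \<notin> \<Omega>"
    then show "v x = 0" using b0[of x] W0D(2)[OF u] W0D(2)[OF w] by simp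
  next
    show "integrable lborel (\<lambda>x. (v x)\<^sup>2)"
    proof (rule Bochner_Integration.integrable_bound)
      show "integrable lborel (\<lambda>x. 2 * C\<^sup>2 * ((u x)\<^sup>2 + (w x)\<^sup>2))"
        using W0D[OF u] W0D[OF w] by simp
      show "AE x in lborel. norm ((v x)\<^sup>2) \<le> norm (2 * C\<^sup>2 * ((u x)\<^sup>2 + (w x)\<^sup>2))"
        using sq[OF b0] by (auto intro: order_trans)
    qed measurable
    show "integrable (gagliardo s) (\<lambda>z. (v (fst z) - v (snd z))\<^sup>2)"
    proof (rule Bochner_Integration.integrable_bound)
      show "integrable (gagliardo s) (\<lambda>z. 2 * C\<^sup>2 * ((u (fst z) - u (snd z))\<^sup>2 + (w (fst z) - w (snd z))\<^sup>2))"
        using W0D[OF u] W0D[OF w] by simp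
      show "AE z in gagliardo s. norm ((v (fst z) - v (snd z))\<^sup>2)
          \<le> norm (2 * C\<^sup>2 * ((u (fst z) - u (snd z))\<^sup>2 + (w (fst z) - w (snd z))\<^sup>2))"
        using sq[OF b1] by (auto intro: order_trans)
    qed measurable
  qed measurable
qed

lemma W0_add_scaled:
  assumes u: "u \<in> W0 s \<Omega>" and w: "w \<in> W0 s \<Omega>"
  shows "(\<lambda>x. u x + t * w x) \<in> W0 s \<Omega>"
proof (rule W0_dominated[OF u w, where C = "1 + \<bar>t\<bar>"])
  note [measurable] = W0D(1)[OF u] W0D(1)[OF w]
  show "(\<lambda>x. u x + t * w x) \<in> borel_measurable borel" by measurable
  have *: "\<bar>a + t * b\<bar> \<le> (1 + \<bar>t\<bar>) * (\<bar>a\<bar> + \<bar>b\<bar>)" for a b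
  proof -
    have "\<bar>a + t * b\<bar> \<le> \<bar>a\<bar> + \<bar>t\<bar> * \<bar>b\<bar>" by (metis abs_mult abs_triangle_ineq)
    also have "\<dots> \<le> (1 + \<bar>t\<bar>) * (\<bar>a\<bar> + \<bar>b\<bar>)" by (simp add: algebra_simps)
    finally show ?thesis .
  qed
  show "\<bar>u x + t * w x\<bar> \<le> (1 + \<bar>t\<bar>) * (\<bar>u x\<bar> + \<bar>w x\<bar>)" for x by (rule *)
  show "\<bar>u x + t * w x - (u y + t * w y)\<bar> \<le> (1 + \<bar>t\<bar>) * (\<bar>u x - u y\<bar> + \<bar>w x - w y\<bar>)" for x y
    using *[of "u x - u y" "w x - w y"] by (simp add: algebra_simps)
qed

lemma W0_scale:
  assumes u: "u \<in> W0 s \<Omega>"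
  shows "(\<lambda>x. t * u x) \<in> W0 s \<Omega>"
  using W0_add_scaled[OF u u, of "t - 1"] by (simp add: algebra_simps)

lemma W0_diff:
  assumes "u \<in> W0 s \<Omega>" "w \<in> W0 s \<Omega>"
  shows "(\<lambda>x. u x - w x) \<in> W0 s \<Omega>"
  using W0_add_scaled[OF assms, of "- 1"] by simp

lemma W0_abs:
  assumes u: "u \<in> W0 s \<Omega>"
  shows "(\<lambda>x. \<bar>u x\<bar>) \<in> W0 s \<Omega>"
proof (rule W0_dominated[OF u u, where C = 1])
  note [measurable] = W0D(1)[OF u]
  show "(\<lambda>x. \<bar>u x\<bar>) \<in> borel_measurable borel" by measurable
  show "\<bar>\<bar>u x\<bar> - \<bar>u y\<bar>\<bar> \<le> 1 * (\<bar>u x - u y\<bar> + \<bar>u x - u y\<bar>)" for x y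
    using abs_triangle_ineq3[of "u x" "u y"] abs_ge_zero[of "u x - u y"] unfolding mult_1 by linarith
qed auto

lemma energy_integrable:
  assumes u: "u \<in> W0 s \<Omega>" and w: "w \<in> W0 s \<Omega>"
  shows "integrable (gagliardo s) (\<lambda>z. (u (fst z) - u (snd z)) * (w (fst z) - w (snd z)))"
proof -
  note [measurable] = W0D(1)[OF u] W0D(1)[OF w]
  show ?thesis using W0D(4)[OF u] W0D(4)[OF w] by (intro integrable_mult_of_squares) measurable
qed

lemma energy_self: "energy s u u = (\<integral>z. (u (fst z) - u (snd z))\<^sup>2 \<partial>gagliardo s)"
  by (simp add: energy_def power2_eq_square)

lemma energy_nonneg: "0 \<le> energy s u u"
  by (simp add: energy_self)

lemma energy_add_scaled:
  assumes u: "u \<in> W0 s \<Omega>" and w: "w \<in> W0 s \<Omega>"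
  shows "energy s (\<lambda>x. u x + t * w x) (\<lambda>x. u x + t * w x)
    = energy s u u + 2 * t * energy s u w + t\<^sup>2 * energy s w w"
proof -
  have "energy s (\<lambda>x. u x + t * w x) (\<lambda>x. u x + t * w x)
    = (\<integral>z. (u (fst z) - u (snd z)) * (u (fst z) - u (snd z))
       + (2 * t * ((u (fst z) - u (snd z)) * (w (fst z) - w (snd z)))
       + t\<^sup>2 * ((w (fst z) - w (snd z)) * (w (fst z) - w (snd z)))) \<partial>gagliardo s)"
    unfolding energy_def by (intro Bochner_Integration.integral_cong) (auto simp: algebra_simps power2_eq_square)
  also have "\<dots> = energy s u u + (2 * t * energy s u w + t\<^sup>2 * energy s w w)"
    unfolding energy_def using energy_integrable[OF u u] energy_integrable[OF u w] energy_integrable[OF w w]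
    by (simp add: Bochner_Integration.integral_add)
  finally show ?thesis by simp
qed

lemma energy_scale: "energy s (\<lambda>x. t * u x) (\<lambda>x. t * u x) = t\<^sup>2 * energy s u u"
proof -
  have "energy s (\<lambda>x. t * u x) (\<lambda>x. t * u x) = (\<integral>z. t\<^sup>2 * (u (fst z) - u (snd z))\<^sup>2 \<partial>gagliardo s)"
    unfolding energy_self by (intro Bochner_Integration.integral_cong) (auto simp: algebra_simps power2_eq_square)
  then show ?thesis by (simp add: energy_self)
qed

text \<open>
The parallelogram identity without the energy of the sum.
\<close>
lemma energy_diff_le:
  assumes u: "u \<in> W0 s \<Omega>" and w: "w \<in> W0 s \<Omega>"
  shows "energy s (\<lambda>x. u x - w x) (\<lambda>x. u x - w x) \<le> 2 * energy s u u + 2 * energy s w w"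
  using energy_add_scaled[OF assms, of "-1"] energy_add_scaled[OF assms, of 1]
    energy_nonneg[of s "\<lambda>x. u x + 1 * w x"] by simp

lemma ennreal_energy:
  assumes u: "u \<in> W0 s \<Omega>"
  shows "ennreal (energy s u u) = (\<integral>\<^sup>+z. ennreal ((u (fst z) - u (snd z))\<^sup>2) \<partial>gagliardo s)"
  unfolding energy_self using W0D(4)[OF u] by (subst nn_integral_eq_integral) auto

lemma ennreal_L2:
  assumes u: "u \<in> W0 s \<Omega>"
  shows "ennreal (\<integral>x. (u x)\<^sup>2 \<partial>lborel) = (\<integral>\<^sup>+x. ennreal ((u x)\<^sup>2) \<partial>lborel)"
  using W0D(3)[OF u] by (subst nn_integral_eq_integral) auto

lemma nn_integral_gagliardo:
  fixes f :: "'b::euclidean_space \<times> 'b \<Rightarrow> ennreal"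
  assumes [measurable]: "f \<in> borel_measurable borel"
  shows "(\<integral>\<^sup>+z. f z \<partial>gagliardo s) =
    (\<integral>\<^sup>+x. \<integral>\<^sup>+y. ennreal (1 / norm (x - y) powr (real DIM('b) + 2 * s)) * f (x, y) \<partial>lborel \<partial>lborel)"
proof -
  have "(\<integral>\<^sup>+z. f z \<partial>gagliardo s) = (\<integral>\<^sup>+z. ennreal (1 / norm (fst z - snd z) powr (real DIM('b) + 2 * s)) * f z
      \<partial>(lborel \<Otimes>\<^sub>M lborel))"
    unfolding gagliardo_def kernel_def lborel_prod by (subst nn_integral_density) measurable
  also have "\<dots> = (\<integral>\<^sup>+x. \<integral>\<^sup>+y. ennreal (1 / norm (x - y) powr (real DIM('b) + 2 * s)) * f (x, y) \<partial>lborel \<partial>lborel)"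
    by (subst lborel.nn_integral_fst[symmetric])
       (auto simp: lborel_prod)
  finally show ?thesis .
qed

section \<open>Lipschitz functions have finite energy\<close>

lemma ex_dyadic_scale:
  fixes r :: real assumes "1 < r"
  shows "\<exists>k::nat. 2 ^ k < r \<and> r \<le> 2 ^ Suc k"
proof -
  obtain n :: nat where n: "r \<le> 2 ^ n"
    using real_arch_pow[of 2 r] by (auto intro: less_imp_le)
  define m where "m = (LEAST n::nat. r \<le> 2 ^ n)"
  have m: "r \<le> 2 ^ m" unfolding m_def using n by (rule LeastI)
  then have "m \<noteq> 0" using assms by (cases m) auto
  then obtain k where k: "m = Suc k" by (cases m) auto
  have "\<not> r \<le> 2 ^ k" using not_less_Least[of k "\<lambda>n. r \<le> 2 ^ n"] k m_def by simp
  then show ?thesis using m k by (intro exI[of _ k]) simp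
qed

text \<open>
The integral is split into the dyadic annuli around the origin.  The annulus of radius \<open>2\<^sup>-\<^sup>k\<close> contributes a multiple of
\<open>(1/4)\<^bsup>k(1-s)\<^esup>\<close>, by the factor \<open>\<bar>z\<bar>\<^sup>2\<close>, and the annulus of radius \<open>2\<^sup>k\<close> a multiple of \<open>(1/4)\<^bsup>ks\<^esup>\<close>; both series are geometric.
\<close>
lemma truncated_kernel_finite:
  assumes s: "0 < s" "s < 1"
  shows "(\<integral>\<^sup>+z. ennreal (min 1 ((norm z)\<^sup>2) / norm z powr (real DIM('b) + 2 * s)) \<partial>(lborel :: 'b::euclidean_space measure)) < \<infinity>"
proof -
  define p where "p = real DIM('b) + 2 * s"
  have p: "0 < p" unfolding p_def using s by simp
  define V where "V = unit_ball_vol (real DIM('b))"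
  have V: "0 \<le> V" unfolding V_def by simp
  \<comment> \<open>An upper bound for the truncated kernel on the annulus of radii \<open>1/2^(k+1), 1/2^k\<close>, and below for radii \<open>2^k, 2^(k+1)\<close>.\<close>
  define a where "a k = (1/4) ^ k * (2 ^ Suc k) powr p" for k :: nat
  define b where "b k = 1 / (2 ^ k) powr p" for k :: nat
  let ?A = "\<lambda>k. cball (0::'b) (1 / 2 ^ k)" and ?B = "\<lambda>k. cball (0::'b) (2 * 2 ^ k)"
  define g where "g k z = ennreal (a k) * indicator (?A k) z + ennreal (b k) * indicator (?B k) z" for k z
  have [measurable]: "?A k \<in> sets borel" "?B k \<in> sets borel" for k by auto
  have [measurable]: "g k \<in> borel_measurable borel" for k
    unfolding g_def by measurable
  have pt: "ennreal (min 1 ((norm z)\<^sup>2) / norm z powr p) \<le> (\<Sum>k. g k z)" for z :: 'b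
  proof -
    have "\<exists>k. ennreal (min 1 ((norm z)\<^sup>2) / norm z powr p) \<le> g k z"
    proof (cases "z = 0")
      case True then show ?thesis by simp
    next
      case False
      then have nz: "0 < norm z" by simp
      show ?thesis
      proof (cases "norm z \<le> 1")
        case True
        have "\<exists>k::nat. norm z \<le> 1 / 2 ^ k \<and> 1 / 2 ^ Suc k \<le> norm z"
        proof (cases "norm z = 1")
          case True then show ?thesis by (intro exI[of _ 0]) auto
        next
          case False
          then have "1 < 1 / norm z" using True nz by simp
          from ex_dyadic_scale[OF this] obtain k :: nat where k: "2 ^ k < 1 / norm z" "1 / norm z \<le> 2 ^ Suc k" by auto
          then show ?thesis using nz by (intro exI[of _ k]) (auto simp: field_simps)
        qed
        then obtain k :: nat where k: "norm z \<le> 1 / 2 ^ k" "1 / 2 ^ Suc k \<le> norm z" by auto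
        have "min 1 ((norm z)\<^sup>2) / norm z powr p \<le> a k"
        proof -
          have "min 1 ((norm z)\<^sup>2) \<le> (norm z)\<^sup>2" by simp
          also have "\<dots> \<le> (1 / 2 ^ k)\<^sup>2" using k by (intro power_mono) auto
          also have "\<dots> = (1/4) ^ k" by (simp add: power_divide power2_eq_square power_mult_distrib[symmetric])
          finally have 1: "min 1 ((norm z)\<^sup>2) \<le> (1/4) ^ k" .
          have "1 / norm z powr p = (1 / norm z) powr p" using nz by (simp add: powr_divide)
          also have "\<dots> \<le> (2 ^ Suc k) powr p"
            using k nz p by (intro powr_mono2) (auto simp: field_simps)
          finally have 2: "1 / norm z powr p \<le> (2 ^ Suc k) powr p" .
          have "min 1 ((norm z)\<^sup>2) * (1 / norm z powr p) \<le> a k"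
            unfolding a_def by (rule mult_mono[OF 1 2]) auto
          then show ?thesis by simp
        qed
        then have "ennreal (min 1 ((norm z)\<^sup>2) / norm z powr p) \<le> ennreal (a k) * indicator (?A k) z"
          using k by (simp add: ennreal_leI)
        also have "\<dots> \<le> g k z" unfolding g_def by simp
        finally show ?thesis by blast
      next
        case False
        then have "1 < norm z" by simp
        from ex_dyadic_scale[OF this] obtain k :: nat where k: "2 ^ k < norm z" "norm z \<le> 2 ^ Suc k" by auto
        have "min 1 ((norm z)\<^sup>2) / norm z powr p \<le> 1 / (2 ^ k) powr p"
          using k nz p by (intro frac_le powr_mono2) auto
        then have "ennreal (min 1 ((norm z)\<^sup>2) / norm z powr p) \<le> ennreal (b k) * indicator (?B k) z"
          using k by (simp add: b_def ennreal_leI)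
        also have "\<dots> \<le> g k z" unfolding g_def by simp
        finally show ?thesis by blast
      qed
    qed
    then obtain k where k: "ennreal (min 1 ((norm z)\<^sup>2) / norm z powr p) \<le> g k z" ..
    also have "g k z \<le> (\<Sum>k. g k z)"
      using sum_le_suminf[of "\<lambda>k. g k z" "{k}"] by simp
    finally show ?thesis .
  qed
  have quarter: "(1/4::real) = 2 powr (- 2)" by (simp add: powr_minus)
  have up: "(2::real) * 2 ^ k = 2 powr (real k + 1)" for k by (simp add: powr_add powr_realpow)
  have down: "(1::real) / 2 ^ k = 2 powr (- real k)" for k
    by (simp add: powr_minus powr_realpow divide_inverse)
  have ig: "(\<integral>\<^sup>+z. g k z \<partial>lborel) =
      ennreal (V * 2 powr p * ((1/4) powr (1 - s)) ^ k + V * 2 ^ DIM('b) * ((1/4) powr s) ^ k)" for k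
  proof -
    have "(\<integral>\<^sup>+z. g k z \<partial>lborel) = ennreal (a k) * emeasure lborel (?A k) + ennreal (b k) * emeasure lborel (?B k)"
      unfolding g_def by (subst nn_integral_add) (auto simp: nn_integral_cmult_indicator)
    also have "\<dots> = ennreal (a k * (V * (1 / 2 ^ k) ^ DIM('b)) + b k * (V * (2 * 2 ^ k) ^ DIM('b)))"
    proof -
      have "emeasure lborel (?A k) = ennreal (V * (1 / 2 ^ k) ^ DIM('b))"
        "emeasure lborel (?B k) = ennreal (V * (2 * 2 ^ k) ^ DIM('b))"
        unfolding V_def by (rule emeasure_cball, simp)+
      moreover have "0 \<le> a k" "0 \<le> b k" by (auto simp: a_def b_def)
      moreover have "0 \<le> V * (1 / 2 ^ k) ^ DIM('b)" "0 \<le> V * (2 * 2 ^ k) ^ DIM('b)" using V by auto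
      moreover have "ennreal x * ennreal y + ennreal z * ennreal w = ennreal (x * y + z * w)"
        if "0 \<le> x" "0 \<le> y" "0 \<le> z" "0 \<le> w" for x y z w
        using that by (simp add: ennreal_mult ennreal_plus)
      ultimately show ?thesis by (simp only:)
    qed
    also have "a k * (V * (1 / 2 ^ k) ^ DIM('b)) = V * 2 powr p * ((1/4) powr (1 - s)) ^ k"
    proof -
      have e1: "(1/4::real) ^ k = 2 powr (- 2 * real k)"
        unfolding quarter by (simp add: powr_powr powr_realpow[symmetric])
      have e2: "(2 * 2 ^ k) powr p = 2 powr ((real k + 1) * p)"
        unfolding up by (simp add: powr_powr)
      have e3: "(1 / 2 ^ k) ^ DIM('b) = (2::real) powr (- real k * real DIM('b))"
        unfolding down by (simp add: powr_powr powr_realpow[symmetric])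
      have e4: "((1/4::real) powr (1 - s)) ^ k = 2 powr (- 2 * (1 - s) * real k)"
        unfolding quarter by (simp add: powr_powr powr_realpow[symmetric])
      have "2 powr (- 2 * real k) * 2 powr ((real k + 1) * p) * 2 powr (- real k * real DIM('b))
         = 2 powr p * 2 powr (- 2 * (1 - s) * real k)"
        unfolding powr_add[symmetric] by (rule arg_cong[where f = "\<lambda>e. 2 powr e"]) (simp add: p_def algebra_simps)
      from arg_cong[OF this, of "(*) V"] show ?thesis unfolding a_def power_Suc e1 e2 e3 e4 by (simp only: mult_ac)
    qed
    also have "b k * (V * (2 * 2 ^ k) ^ DIM('b)) = V * 2 ^ DIM('b) * ((1/4) powr s) ^ k"
    proof -
      have e1: "b k = 2 powr (- real k * p)"
        unfolding b_def powr_realpow[symmetric, OF zero_less_numeral] powr_powr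
        by (simp add: powr_minus divide_inverse)
      have e2: "(2 * 2 ^ k) ^ DIM('b) = (2::real) ^ DIM('b) * 2 powr (real k * DIM('b))"
        by (simp add: power_mult_distrib powr_powr[symmetric] powr_realpow)
      have e4: "((1/4::real) powr s) ^ k = 2 powr (- 2 * s * real k)"
        unfolding quarter by (simp add: powr_powr powr_realpow[symmetric])
      have "2 powr (- real k * p) * 2 powr (real k * DIM('b)) = 2 powr (- 2 * s * real k)"
        unfolding powr_add[symmetric] by (rule arg_cong[where f = "\<lambda>e. 2 powr e"]) (simp add: p_def algebra_simps)
      from arg_cong[OF this, of "\<lambda>r. V * 2 ^ DIM('b) * r"] show ?thesis unfolding e1 e2 e4 by (simp only: mult_ac)
    qed
    finally show ?thesis .
  qed
  have "(\<integral>\<^sup>+z. ennreal (min 1 ((norm z)\<^sup>2) / norm z powr p) \<partial>(lborel :: 'b measure))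
      \<le> (\<integral>\<^sup>+z. (\<Sum>k. g k z) \<partial>lborel)"
    by (intro nn_integral_mono pt)
  also have "\<dots> = (\<Sum>k. \<integral>\<^sup>+z. g k z \<partial>lborel)"
    by (rule nn_integral_suminf) measurable
  also have "\<dots> = (\<Sum>k. ennreal (V * 2 powr p * ((1/4) powr (1 - s)) ^ k + V * 2 ^ DIM('b) * ((1/4) powr s) ^ k))"
    by (simp only: ig)
  also have "\<dots> < \<infinity>"
  proof -
    have q: "(1/4::real) powr t < 1" if "0 < t" for t
      using powr_less_mono2[of t "1/4" 1] that by simp
    have "summable (\<lambda>k. V * 2 powr p * ((1/4) powr (1 - s)) ^ k + V * 2 ^ DIM('b) * ((1/4) powr s) ^ k)"
      using q[of s] q[of "1 - s"] s by (intro summable_add summable_mult summable_geometric) auto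
    then show ?thesis
      by (subst suminf_ennreal2) (auto simp: V)
  qed
  finally show ?thesis unfolding p_def .
qed

lemma nn_integral_lborel_translate:
  fixes f :: "'b::euclidean_space \<Rightarrow> ennreal"
  assumes [measurable]: "f \<in> borel_measurable borel"
  shows "(\<integral>\<^sup>+y. f (y - x) \<partial>lborel) = (\<integral>\<^sup>+y. f y \<partial>lborel)"
  by (subst lborel_distr_plus[of x, symmetric]) (simp add: nn_integral_distr)

text \<open>
The squared increment is at most a constant times \<open>min 1 \<bar>x - y\<bar>\<^sup>2\<close> and vanishes unless one of the two points lies in
\<open>\<Omega>\<close>; integrating over the other point first leaves the truncated kernel.
\<close>
lemma W0_Lipschitz:
  fixes f :: "'b::euclidean_space \<Rightarrow> real"
  assumes s: "0 < s" "s < 1" and \<Omega>: "open \<Omega>" "bounded \<Omega>"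
    and f: "f \<in> borel_measurable borel" "\<And>x. x \<notin> \<Omega> \<Longrightarrow> f x = 0"
    and B: "\<And>x. \<bar>f x\<bar> \<le> B" and L: "\<And>x y. \<bar>f x - f y\<bar> \<le> L * norm (x - y)"
  shows "f \<in> W0 s \<Omega>"
proof -
  note [measurable] = f(1)
  have [measurable]: "\<Omega> \<in> sets borel" using \<Omega> by auto
  have fin: "emeasure lborel \<Omega> < \<infinity>"
    using emeasure_bounded_finite[OF \<Omega>(2)] by simp
  define p where "p = real DIM('b) + 2 * s"
  define C where "C = max (4 * B\<^sup>2) (L\<^sup>2)"
  have C: "0 \<le> C" unfolding C_def by (simp add: le_max_iff_disj)
  define k where "k x = ennreal (min 1 ((norm x)\<^sup>2) / norm x powr p)" for x :: 'b
  have [measurable]: "k \<in> borel_measurable borel" unfolding k_def by measurable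
  define K where "K = (\<integral>\<^sup>+x. k x \<partial>lborel)"
  have K: "K < \<infinity>" unfolding K_def k_def p_def by (rule truncated_kernel_finite[OF s])
  have sq: "(f x - f y)\<^sup>2 \<le> C * min 1 ((norm (x - y))\<^sup>2)" for x y
  proof -
    have "\<bar>f x - f y\<bar> \<le> 2 * B" using B[of x] B[of y] by linarith
    then have "(f x - f y)\<^sup>2 \<le> (2 * B)\<^sup>2"
      by (intro abs_le_square_iff[THEN iffD1]) linarith
    moreover have "(f x - f y)\<^sup>2 \<le> (L * norm (x - y))\<^sup>2"
      using L[of x y] by (intro abs_le_square_iff[THEN iffD1]) linarith
    moreover have "C * (norm (x - y))\<^sup>2 \<ge> (L * norm (x - y))\<^sup>2"
      by (simp add: C_def power_mult_distrib mult_right_mono)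
    moreover have "C \<ge> (2 * B)\<^sup>2" by (simp add: C_def power_mult_distrib)
    ultimately show ?thesis by (simp add: min_def)
  qed
  have pt: "ennreal (1 / norm (x - y) powr p) * ennreal ((f x - f y)\<^sup>2)
     \<le> ennreal C * (k (x - y) * indicator \<Omega> x) + ennreal C * (k (x - y) * indicator \<Omega> y)" for x y
  proof (cases "x \<in> \<Omega> \<or> y \<in> \<Omega>")
    case True
    have "ennreal (1 / norm (x - y) powr p) * ennreal ((f x - f y)\<^sup>2)
       = ennreal ((f x - f y)\<^sup>2 / norm (x - y) powr p)"
      by (simp add: ennreal_mult[symmetric])
    also have "\<dots> \<le> ennreal (C * min 1 ((norm (x - y))\<^sup>2) / norm (x - y) powr p)"
      by (intro ennreal_leI divide_right_mono sq) auto
    also have "\<dots> = ennreal C * k (x - y)"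
      unfolding k_def using C by (simp add: ennreal_mult[symmetric])
    also have "\<dots> \<le> ennreal C * (k (x - y) * indicator \<Omega> x) + ennreal C * (k (x - y) * indicator \<Omega> y)"
      using True by (auto simp: indicator_def)
    finally show ?thesis .
  next
    case False
    then show ?thesis using f(2)[of x] f(2)[of y] by simp
  qed
  have "(\<integral>\<^sup>+z. ennreal ((f (fst z) - f (snd z))\<^sup>2) \<partial>gagliardo s)
     = (\<integral>\<^sup>+x. \<integral>\<^sup>+y. ennreal (1 / norm (x - y) powr p) * ennreal ((f x - f y)\<^sup>2) \<partial>lborel \<partial>lborel)"
    unfolding p_def by (subst nn_integral_gagliardo) auto
  also have "\<dots> \<le> (\<integral>\<^sup>+x. \<integral>\<^sup>+y. ennreal C * (k (x - y) * indicator \<Omega> x) + ennreal C * (k (x - y) * indicator \<Omega> y) \<partial>lborel \<partial>lborel)"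
    by (intro nn_integral_mono pt)
  also have "\<dots> = (\<integral>\<^sup>+x. \<integral>\<^sup>+y. ennreal C * (k (x - y) * indicator \<Omega> x) \<partial>lborel \<partial>lborel)
      + (\<integral>\<^sup>+x. \<integral>\<^sup>+y. ennreal C * (k (x - y) * indicator \<Omega> y) \<partial>lborel \<partial>lborel)"
    by (simp add: nn_integral_add)
  also have "(\<integral>\<^sup>+x. \<integral>\<^sup>+y. ennreal C * (k (x - y) * indicator \<Omega> y) \<partial>lborel \<partial>lborel)
     = (\<integral>\<^sup>+y. \<integral>\<^sup>+x. ennreal C * (k (x - y) * indicator \<Omega> y) \<partial>lborel \<partial>lborel)"
    by (rule lborel_pair.Fubini'[symmetric]) measurable
  also have "\<dots> = ennreal C * (K * emeasure lborel \<Omega>)"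
    by (simp add: nn_integral_cmult nn_integral_multc nn_integral_lborel_translate K_def)
  also have "(\<integral>\<^sup>+x. \<integral>\<^sup>+y. ennreal C * (k (x - y) * indicator \<Omega> x) \<partial>lborel \<partial>lborel) = ennreal C * (K * emeasure lborel \<Omega>)"
  proof -
    have "k (x - y) = k (y - x)" for x y by (simp add: k_def norm_minus_commute)
    then have "(\<integral>\<^sup>+x. \<integral>\<^sup>+y. ennreal C * (k (x - y) * indicator \<Omega> x) \<partial>lborel \<partial>lborel)
      = (\<integral>\<^sup>+x. \<integral>\<^sup>+y. ennreal C * (k (y - x) * indicator \<Omega> x) \<partial>lborel \<partial>lborel)" by simp
    also have "\<dots> = ennreal C * (K * emeasure lborel \<Omega>)"
      by (simp add: nn_integral_cmult nn_integral_multc nn_integral_lborel_translate K_def)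
    finally show ?thesis .
  qed
  also have "ennreal C * (K * emeasure lborel \<Omega>) + ennreal C * (K * emeasure lborel \<Omega>) < \<infinity>"
    using K fin by (simp add: ennreal_mult_less_top)
  finally have E: "(\<integral>\<^sup>+z. ennreal ((f (fst z) - f (snd z))\<^sup>2) \<partial>gagliardo s) < \<infinity>" .
  show ?thesis unfolding W0_def
  proof (intro CollectI conjI allI impI f)
    show "integrable lborel (\<lambda>x. (f x)\<^sup>2)"
    proof (rule Bochner_Integration.integrable_bound)
      show "integrable lborel (\<lambda>x. B\<^sup>2 * indicator \<Omega> x :: real)"
        using fin by simp
      have "(f x)\<^sup>2 \<le> B\<^sup>2" for x
        using B[of x] by (intro abs_le_square_iff[THEN iffD1]) linarith
      then show "AE x in lborel. norm ((f x)\<^sup>2) \<le> norm (B\<^sup>2 * indicator \<Omega> x :: real)"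
        using f(2) by (auto simp: indicator_def)
    qed measurable
    show "integrable (gagliardo s) (\<lambda>z. (f (fst z) - f (snd z))\<^sup>2)"
      by (rule integrableI_nonneg) (use E in auto)
  qed
qed

section \<open>The Poincare inequality\<close>

text \<open>
A function of the space vanishes on a ball \<open>S\<close> that lies outside \<open>\<Omega>\<close> at bounded distance, so the pairs
\<open>(x, y) \<in> \<Omega> \<times> S\<close> alone contribute a multiple of \<open>\<integral> u\<^sup>2\<close> to the energy.
\<close>
lemma Poincare:
  fixes \<Omega> :: "'b::euclidean_space set"
  assumes s: "0 < s" and \<Omega>: "bounded \<Omega>"
  shows "\<exists>C\<ge>0. \<forall>u\<in>W0 s \<Omega>. (\<integral>x. (u x)\<^sup>2 \<partial>lborel) \<le> C * energy s u u"
proof -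
  obtain R where R: "R > 0" "\<And>x. x \<in> \<Omega> \<Longrightarrow> norm x < R"
    using \<Omega> unfolding bounded_pos_less by auto
  obtain e :: 'b where e: "e \<in> Basis" using nonempty_Basis by blast
  define S where "S = ball ((R + 1) *\<^sub>R e) 1"
  have S: "R < norm y \<and> norm y < R + 2" if "y \<in> S" for y
  proof -
    have "norm (y - (R + 1) *\<^sub>R e) < 1" using that by (simp add: S_def dist_norm norm_minus_commute)
    moreover have "norm ((R + 1) *\<^sub>R e) = R + 1" using e R by simp
    ultimately show ?thesis
      using norm_triangle_ineq2[of "(R + 1) *\<^sub>R e" y] norm_triangle_ineq2[of y "(R + 1) *\<^sub>R e"]
      by (simp add: norm_minus_commute)
  qed
  define p where "p = real DIM('b) + 2 * s"
  have p: "0 < p" unfolding p_def using s by simp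
  define m where "m = measure lborel S"
  have m: "0 < m" "emeasure lborel S = ennreal m"
    unfolding m_def S_def using content_ball_gt_0_iff[of "(R + 1) *\<^sub>R e" 1]
      emeasure_bounded_finite[of "ball ((R + 1) *\<^sub>R e) 1"]
    by (auto simp: emeasure_eq_ennreal_measure less_top)
  have [measurable]: "S \<in> sets borel" unfolding S_def by auto
  define c where "c = 1 / (2 * R + 2) powr p"
  have c: "0 < c" unfolding c_def using R by simp
  show ?thesis
  proof (intro exI[of _ "1 / (c * m)"] conjI ballI)
    show "0 \<le> 1 / (c * m)" using c m by simp
    fix u assume u: "u \<in> W0 s \<Omega>"
    note [measurable] = W0D(1)[OF u]
    have pt: "ennreal c * (ennreal ((u x)\<^sup>2) * indicator S y) \<le> ennreal (1 / norm (x - y) powr p) * ennreal ((u x - u y)\<^sup>2)" for x y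
    proof (cases "x \<in> \<Omega> \<and> y \<in> S")
      case True
      then have "y \<notin> \<Omega>" using S[of y] R(2)[of y] by auto
      then have uy: "u y = 0" using W0D(2)[OF u] by simp
      have "norm (x - y) \<le> 2 * R + 2"
        using norm_triangle_ineq4[of x y] S[of y] R(2)[of x] True by linarith
      moreover have "x \<noteq> y" using True \<open>y \<notin> \<Omega>\<close> by auto
      ultimately have "c \<le> 1 / norm (x - y) powr p"
        unfolding c_def using p by (intro frac_le powr_mono2) auto
      then show ?thesis using True uy by (simp add: mult_right_mono ennreal_leI)
    next
      case False
      then show ?thesis using W0D(2)[OF u, of x] by (auto simp: indicator_def)
    qed
    have "ennreal (c * m) * ennreal (\<integral>x. (u x)\<^sup>2 \<partial>lborel) = (\<integral>\<^sup>+x. \<integral>\<^sup>+y. ennreal c * (ennreal ((u x)\<^sup>2) * indicator S y) \<partial>lborel \<partial>lborel)"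
      using c m by (simp add: nn_integral_cmult nn_integral_multc nn_integral_cmult_indicator ennreal_L2[OF u] ennreal_mult mult_ac)
    also have "\<dots> \<le> (\<integral>\<^sup>+x. \<integral>\<^sup>+y. ennreal (1 / norm (x - y) powr p) * ennreal ((u x - u y)\<^sup>2) \<partial>lborel \<partial>lborel)"
      by (intro nn_integral_mono pt)
    also have "\<dots> = ennreal (energy s u u)"
      unfolding ennreal_energy[OF u] p_def by (subst nn_integral_gagliardo) auto
    finally have "ennreal (c * m * (\<integral>x. (u x)\<^sup>2 \<partial>lborel)) \<le> ennreal (energy s u u)"
      using c m by (simp add: ennreal_mult)
    then have "c * m * (\<integral>x. (u x)\<^sup>2 \<partial>lborel) \<le> energy s u u"
      by (simp add: ennreal_le_iff energy_nonneg)
    then show "(\<integral>x. (u x)\<^sup>2 \<partial>lborel) \<le> 1 / (c * m) * energy s u u"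
      using c m by (simp add: field_simps)
  qed
qed

section \<open>Compactness of the embedding into square-integrable functions\<close>

text \<open>
The integer vector that labels the grid cube of side \<open>1/m\<close> containing \<open>x\<close>; the cubes are the fibres of this map.
\<close>
definition cell :: "nat \<Rightarrow> 'b::euclidean_space \<Rightarrow> 'b" where
  "cell m x = (\<Sum>b\<in>Basis. real_of_int \<lfloor>real m * (x \<bullet> b)\<rfloor> *\<^sub>R b)"

lemma cell_inner: "b \<in> Basis \<Longrightarrow> cell m x \<bullet> b = real_of_int \<lfloor>real m * (x \<bullet> b)\<rfloor>"
  by (simp add: cell_def inner_sum_left_Basis)

lemma cell_eq_iff: "cell m x = cell m y \<longleftrightarrow> (\<forall>b\<in>Basis. \<lfloor>real m * (x \<bullet> b)\<rfloor> = \<lfloor>real m * (y \<bullet> b)\<rfloor>)"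
  by (subst euclidean_eq_iff) (auto simp: cell_inner)

lemma measurable_cell [measurable]: "cell m \<in> borel_measurable borel"
  unfolding cell_def by measurable

lemma finite_cells:
  assumes "bounded \<Omega>"
  shows "finite (cell m ` \<Omega>)"
proof -
  obtain R where R: "R > 0" "\<And>x. x \<in> \<Omega> \<Longrightarrow> norm x < R"
    using assms unfolding bounded_pos_less by auto
  let ?F = "\<lambda>g :: 'a \<Rightarrow> int. \<Sum>b\<in>Basis. real_of_int (g b) *\<^sub>R b"
  have "cell m ` \<Omega> \<subseteq> ?F ` (Basis \<rightarrow>\<^sub>E {- \<lceil>real m * R\<rceil> - 1 .. \<lceil>real m * R\<rceil>})"
  proof (intro image_subsetI)
    fix x assume x: "x \<in> \<Omega>"
    define g where "g = restrict (\<lambda>b. \<lfloor>real m * (x \<bullet> b)\<rfloor>) Basis"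
    have "g \<in> Basis \<rightarrow>\<^sub>E {- \<lceil>real m * R\<rceil> - 1 .. \<lceil>real m * R\<rceil>}"
    proof (unfold g_def, intro restrict_PiE_iff[THEN iffD2] ballI)
      fix b :: 'a assume b: "b \<in> Basis"
      have "\<bar>x \<bullet> b\<bar> \<le> R" using Basis_le_norm[OF b, of x] R(2)[OF x] by linarith
      then have "\<bar>real m * (x \<bullet> b)\<bar> \<le> real m * R" by (simp add: abs_mult mult_left_mono)
      then show "\<lfloor>real m * (x \<bullet> b)\<rfloor> \<in> {- \<lceil>real m * R\<rceil> - 1 .. \<lceil>real m * R\<rceil>}"
        by (simp add: abs_le_iff) linarith
    qed
    moreover have "cell m x = ?F g" unfolding cell_def g_def by (intro sum.cong) auto
    ultimately show "cell m x \<in> ?F ` (Basis \<rightarrow>\<^sub>E {- \<lceil>real m * R\<rceil> - 1 .. \<lceil>real m * R\<rceil>})" by blast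
  qed
  then show ?thesis by (rule finite_subset) (intro finite_imageI finite_PiE, auto)
qed

lemma cell_diameter:
  fixes x y :: "'b::euclidean_space"
  assumes "cell m x = cell m y" "0 < m"
  shows "norm (x - y) \<le> real DIM('b) / real m"
proof -
  have "\<bar>(x - y) \<bullet> b\<bar> \<le> 1 / real m" if b: "b \<in> Basis" for b
  proof -
    have "\<lfloor>real m * (x \<bullet> b)\<rfloor> = \<lfloor>real m * (y \<bullet> b)\<rfloor>" using assms(1) b by (simp add: cell_eq_iff)
    then have "\<bar>real m * (x \<bullet> b) - real m * (y \<bullet> b)\<bar> \<le> 1" by linarith
    then have "real m * \<bar>(x - y) \<bullet> b\<bar> \<le> 1"
      by (simp add: abs_mult[symmetric] inner_diff_left right_diff_distrib[symmetric] flip: abs_mult)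
    then show ?thesis using assms(2) by (simp add: field_simps)
  qed
  then have "(\<Sum>b\<in>Basis. \<bar>(x - y) \<bullet> b\<bar>) \<le> (\<Sum>b\<in>(Basis :: 'b set). 1 / real m)"
    by (intro sum_mono) auto
  then show ?thesis using norm_le_l1[of "x - y"] by simp
qed

lemma emeasure_cell:
  fixes x :: "'b::euclidean_space"
  assumes m: "0 < m"
  shows "emeasure lborel {y. cell m y = cell m x} = ennreal ((1 / real m) ^ DIM('b))"
proof -
  define l where "l = (1 / real m) *\<^sub>R cell m x"
  define h where "h = l + (\<Sum>b\<in>Basis. (1 / real m) *\<^sub>R b)"
  have lb: "l \<bullet> b = real_of_int \<lfloor>real m * (x \<bullet> b)\<rfloor> / real m" if "b \<in> Basis" for b
    using that by (simp add: l_def cell_inner)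
  have hb: "h \<bullet> b = (real_of_int \<lfloor>real m * (x \<bullet> b)\<rfloor> + 1) / real m" if "b \<in> Basis" for b
    using that by (simp add: h_def inner_add_left lb inner_sum_left_Basis add_divide_distrib)
  have [measurable]: "{y. cell m y = cell m x} \<in> sets borel" by measurable
  have 1: "box l h \<subseteq> {y. cell m y = cell m x}"
  proof
    fix y assume y: "y \<in> box l h"
    have "\<lfloor>real m * (y \<bullet> b)\<rfloor> = \<lfloor>real m * (x \<bullet> b)\<rfloor>" if b: "b \<in> Basis" for b
    proof -
      have "real_of_int \<lfloor>real m * (x \<bullet> b)\<rfloor> < real m * (y \<bullet> b)" "real m * (y \<bullet> b) < real_of_int \<lfloor>real m * (x \<bullet> b)\<rfloor> + 1"
        using y b m by (auto simp: mem_box lb hb field_simps)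
      then show ?thesis by linarith
    qed
    then show "y \<in> {y. cell m y = cell m x}" by (simp add: cell_eq_iff)
  qed
  have 2: "{y. cell m y = cell m x} \<subseteq> cbox l h"
  proof
    fix y assume "y \<in> {y. cell m y = cell m x}"
    then have y: "\<lfloor>real m * (y \<bullet> b)\<rfloor> = \<lfloor>real m * (x \<bullet> b)\<rfloor>" if "b \<in> Basis" for b
      using that by (simp add: cell_eq_iff)
    have "l \<bullet> b \<le> y \<bullet> b \<and> y \<bullet> b \<le> h \<bullet> b" if b: "b \<in> Basis" for b
    proof -
      have "real_of_int \<lfloor>real m * (x \<bullet> b)\<rfloor> \<le> real m * (y \<bullet> b)" "real m * (y \<bullet> b) \<le> real_of_int \<lfloor>real m * (x \<bullet> b)\<rfloor> + 1"
        using y[OF b] by linarith+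
      then show ?thesis using m b by (auto simp: lb hb field_simps)
    qed
    then show "y \<in> cbox l h" by (simp add: mem_box)
  qed
  have le: "\<And>b. b \<in> Basis \<Longrightarrow> l \<bullet> b \<le> h \<bullet> b" by (simp add: lb hb divide_right_mono)
  have d: "(\<Prod>b\<in>Basis. (h - l) \<bullet> b) = (1 / real m) ^ DIM('b)"
    by (simp add: h_def inner_sum_left_Basis)
  have "emeasure lborel (box l h) = ennreal ((1 / real m) ^ DIM('b))"
    using le by (simp add: emeasure_lborel_box d)
  moreover have "emeasure lborel (cbox l h) = ennreal ((1 / real m) ^ DIM('b))"
    using le by (simp add: emeasure_lborel_cbox d)
  moreover have "emeasure lborel (box l h) \<le> emeasure lborel {y. cell m y = cell m x}"
    by (rule emeasure_mono[OF 1]) simp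
  moreover have "emeasure lborel {y. cell m y = cell m x} \<le> emeasure lborel (cbox l h)"
    by (rule emeasure_mono[OF 2]) simp
  ultimately show ?thesis by (metis antisym)
qed

definition cell_integral :: "nat \<Rightarrow> 'b::euclidean_space \<Rightarrow> ('b \<Rightarrow> real) \<Rightarrow> real" where
  "cell_integral m z u = (\<integral>y. indicator {y. cell m y = z} y * u y \<partial>lborel)"

lemma W0_integrable:
  assumes "open \<Omega>" "bounded \<Omega>" and u: "u \<in> W0 s \<Omega>"
  shows "integrable lborel u"
proof -
  note [measurable] = W0D(1)[OF u]
  have [measurable]: "\<Omega> \<in> sets borel" using assms by auto
  have "emeasure lborel \<Omega> < \<infinity>" using emeasure_bounded_finite[OF assms(2)] by simp
  then have "integrable lborel (\<lambda>x. (indicator \<Omega> x :: real)\<^sup>2)"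
    by (simp add: power2_eq_square indicator_inter_arith[symmetric])
  then have "integrable lborel (\<lambda>x. u x * indicator \<Omega> x)"
    by (intro integrable_mult_of_squares W0D(3)[OF u]) measurable
  moreover have "(\<lambda>x. u x * indicator \<Omega> x) = u"
    using W0D(2)[OF u] by (auto simp: indicator_def fun_eq_iff)
  ultimately show ?thesis by simp
qed

lemma cell_integral_diff:
  assumes "integrable lborel u" "integrable lborel w"
  shows "cell_integral m z (\<lambda>x. u x - w x) = cell_integral m z u - cell_integral m z w"
proof -
  have [measurable]: "{y. cell m y = z} \<in> sets borel" by measurable
  have "integrable lborel (\<lambda>y. indicator {y. cell m y = z} y * u y)"
    "integrable lborel (\<lambda>y. indicator {y. cell m y = z} y * w y)"
    using integrable_real_mult_indicator[of "{y. cell m y = z}" lborel u]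
      integrable_real_mult_indicator[of "{y. cell m y = z}" lborel w] assms by (simp_all add: mult.commute)
  then show ?thesis by (simp add: cell_integral_def right_diff_distrib)
qed

text \<open>
The expansion of the square.  It bounds \<open>\<integral>\<^sub>Q u\<^sup>2\<close> by the mean value of \<open>u\<close> on \<open>Q\<close> and by the increments of \<open>u\<close> within \<open>Q\<close>.
\<close>
lemma variance_double_integral:
  fixes u :: "'b::euclidean_space \<Rightarrow> real"
  assumes [measurable]: "Q \<in> sets borel" and q: "emeasure lborel Q = ennreal q" "0 \<le> q"
    and u: "integrable lborel u" and u2: "integrable lborel (\<lambda>x. (u x)\<^sup>2)"
  shows "(\<integral>\<^sup>+x. \<integral>\<^sup>+y. ennreal (indicator Q x * indicator Q y * (u x - u y)\<^sup>2) \<partial>lborel \<partial>lborel)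
    = ennreal (2 * q * (\<integral>y. indicator Q y * (u y)\<^sup>2 \<partial>lborel) - 2 * (\<integral>y. indicator Q y * u y \<partial>lborel)\<^sup>2)"
proof -
  have [measurable]: "u \<in> borel_measurable borel" using u by auto
  define A where "A = (\<integral>y. indicator Q y * u y \<partial>lborel)"
  define S where "S = (\<integral>y. indicator Q y * (u y)\<^sup>2 \<partial>lborel)"
  have i0: "integrable lborel (indicator Q :: _ \<Rightarrow> real)" using q by simp
  have i1: "integrable lborel (\<lambda>y. indicator Q y * u y)"
    using integrable_real_mult_indicator[of Q lborel u] u by (simp add: mult.commute)
  have i2: "integrable lborel (\<lambda>y. indicator Q y * (u y)\<^sup>2)"
    using integrable_real_mult_indicator[of Q lborel "\<lambda>x. (u x)\<^sup>2"] u2 by (simp add: mult.commute)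
  have m: "(\<integral>y. indicator Q y \<partial>lborel) = q"
    using q by (simp add: measure_def)
  have inner: "(\<integral>\<^sup>+y. ennreal (indicator Q x * indicator Q y * (u x - u y)\<^sup>2) \<partial>lborel)
      = ennreal (indicator Q x * (u x)\<^sup>2 * q - 2 * A * (indicator Q x * u x) + S * indicator Q x)" for x
  proof -
    have eq: "indicator Q x * indicator Q y * (u x - u y)\<^sup>2 =
        indicator Q x * (u x)\<^sup>2 * indicator Q y - 2 * (indicator Q x * u x) * (indicator Q y * u y)
         + indicator Q x * (indicator Q y * (u y)\<^sup>2)" for y
      by (simp add: power2_eq_square algebra_simps)
    have "integrable lborel (\<lambda>y. indicator Q x * (u x)\<^sup>2 * indicator Q y - 2 * (indicator Q x * u x) * (indicator Q y * u y)
         + indicator Q x * (indicator Q y * (u y)\<^sup>2))"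
      by (intro Bochner_Integration.integrable_add Bochner_Integration.integrable_diff
         integrable_mult_right i0 i1 i2)
    then have I: "integrable lborel (\<lambda>y. indicator Q x * indicator Q y * (u x - u y)\<^sup>2)" by (simp only: eq)
    then have "(\<integral>\<^sup>+y. ennreal (indicator Q x * indicator Q y * (u x - u y)\<^sup>2) \<partial>lborel)
       = ennreal (\<integral>y. indicator Q x * indicator Q y * (u x - u y)\<^sup>2 \<partial>lborel)"
      by (intro nn_integral_eq_integral) auto
    also have "(\<integral>y. indicator Q x * indicator Q y * (u x - u y)\<^sup>2 \<partial>lborel)
      = indicator Q x * (u x)\<^sup>2 * q - 2 * (indicator Q x * u x) * A + indicator Q x * S"
      unfolding eq A_def S_def m[symmetric]
      by (subst Bochner_Integration.integral_add Bochner_Integration.integral_diff;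
          (intro Bochner_Integration.integrable_add Bochner_Integration.integrable_diff
         integrable_mult_right i0 i1 i2)?)+ (simp add: i0 i1 i2)
    finally show ?thesis by (simp add: mult_ac)
  qed
  have pos: "0 \<le> indicator Q x * (u x)\<^sup>2 * q - 2 * A * (indicator Q x * u x) + S * indicator Q x" (is "0 \<le> ?G x") for x
  proof (rule ccontr)
    assume neg: "\<not> 0 \<le> ?G x"
    have xQ: "x \<in> Q" by (rule ccontr) (use neg in simp)
    have "0 \<le> (\<integral>y. indicator Q y * (u x - u y)\<^sup>2 \<partial>lborel)" by simp
    also have "(\<integral>y. indicator Q y * (u x - u y)\<^sup>2 \<partial>lborel) = (\<integral>y. (u x)\<^sup>2 * indicator Q y - 2 * u x * (indicator Q y * u y)
         + (indicator Q y * (u y)\<^sup>2) \<partial>lborel)"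
      by (intro Bochner_Integration.integral_cong) (auto simp: power2_eq_square algebra_simps)
    also have "\<dots> = (u x)\<^sup>2 * q - 2 * u x * A + S"
      unfolding A_def S_def m[symmetric]
      by (subst Bochner_Integration.integral_add Bochner_Integration.integral_diff;
          (intro Bochner_Integration.integrable_add Bochner_Integration.integrable_diff
         integrable_mult_right i0 i1 i2)?)+ (simp add: i0 i1 i2)
    finally show False using neg xQ by (simp add: mult_ac)
  qed
  have IG: "integrable lborel ?G"
    using i0 i1 i2 by (intro Bochner_Integration.integrable_add Bochner_Integration.integrable_diff
         integrable_mult_right integrable_mult_left)
  have "(\<integral>\<^sup>+x. \<integral>\<^sup>+y. ennreal (indicator Q x * indicator Q y * (u x - u y)\<^sup>2) \<partial>lborel \<partial>lborel)
     = (\<integral>\<^sup>+x. ennreal (?G x) \<partial>lborel)" by (simp only: inner)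
  also have "\<dots> = ennreal (\<integral>x. ?G x \<partial>lborel)"
    using IG pos by (intro nn_integral_eq_integral) auto
  also have "(\<integral>x. ?G x \<partial>lborel) = S * q - 2 * A * A + S * q"
    unfolding A_def S_def m[symmetric]
      by (subst Bochner_Integration.integral_add Bochner_Integration.integral_diff;
          (intro Bochner_Integration.integrable_add Bochner_Integration.integrable_diff
         integrable_mult_right integrable_mult_left i0 i1 i2)?)+ (simp add: i0 i1 i2)
  finally show ?thesis by (simp add: A_def S_def power2_eq_square mult_ac)
qed

lemma ennreal_add_le: "ennreal (a + b) \<le> ennreal a + ennreal b"
proof (cases "0 \<le> a \<and> 0 \<le> b")
  case True then show ?thesis by simp
next
  case False
  then show ?thesis
  proof (cases "0 \<le> a")
    case True
    then have "ennreal (a + b) \<le> ennreal a" using False by (intro ennreal_leI) auto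
    then show ?thesis by (rule order_trans) simp
  next
    case False
    then have "ennreal (a + b) \<le> ennreal b" by (intro ennreal_leI) auto
    then show ?thesis by (rule order_trans) simp
  qed
qed

text \<open>
On a cube of side \<open>1/m\<close> the kernel is at least a constant times \<open>m\<^bsup>N + 2s\<^esup>\<close>, so the double integral of the squared
increments over the cube, divided by its volume \<open>m\<^bsup>-N\<^esup>\<close>, is at most \<open>m\<^bsup>-2s\<^esup>\<close> times the energy up to a constant.  For large \<open>m\<close> the
\<open>L\<^sup>2\<close> norm is thus controlled by finitely many integrals, which is the reason for compactness.
\<close>
lemma L2_le_energy_plus_cells:
  fixes u :: "'b::euclidean_space \<Rightarrow> real"
  assumes s: "0 < s" and \<Omega>: "open \<Omega>" "bounded \<Omega>" and m: "0 < m" and u: "u \<in> W0 s \<Omega>"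
  shows "(\<integral>x. (u x)\<^sup>2 \<partial>lborel) \<le>
     (real DIM('b)) powr (real DIM('b) + 2 * s) * (real m) powr (- 2 * s) * energy s u u
     + real m ^ DIM('b) * (\<Sum>z\<in>cell m ` \<Omega>. (cell_integral m z u)\<^sup>2)"
proof -
  note [measurable] = W0D(1)[OF u]
  define Z where "Z = cell m ` \<Omega>"
  have fZ: "finite Z" unfolding Z_def by (rule finite_cells[OF \<Omega>(2)])
  define Q where "Q z = {y :: 'b. cell m y = z}" for z
  have [measurable]: "Q z \<in> sets borel" for z unfolding Q_def by measurable
  define N where "N = real DIM('b)"
  define p where "p = N + 2 * s"
  have p: "0 < p" unfolding p_def N_def using s by (simp add: add_nonneg_pos)
  define q where "q = (1 / real m) ^ DIM('b)"
  have q: "0 < q" unfolding q_def using m by simp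
  define S where "S z = (\<integral>y. indicator (Q z) y * (u y)\<^sup>2 \<partial>lborel)" for z
  have mQ: "emeasure lborel (Q z) = ennreal q" if "z \<in> Z" for z
    using that emeasure_cell[OF m] unfolding Z_def q_def Q_def by auto
  have iS: "integrable lborel (\<lambda>y. indicator (Q z) y * (u y)\<^sup>2)" for z
    using integrable_real_mult_indicator[of "Q z" lborel "\<lambda>x. (u x)\<^sup>2"] W0D(3)[OF u] by (simp add: mult.commute)
  have var: "(\<integral>\<^sup>+x. \<integral>\<^sup>+y. ennreal (indicator (Q z) x * indicator (Q z) y * (u x - u y)\<^sup>2) \<partial>lborel \<partial>lborel)
    = ennreal (2 * q * S z - 2 * (cell_integral m z u)\<^sup>2)" if "z \<in> Z" for z
    unfolding S_def cell_integral_def Q_def[symmetric]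
    by (rule variance_double_integral) (use mQ[OF that] q W0D(3)[OF u] W0_integrable[OF \<Omega> u] in auto)
  \<comment> \<open>The diameter of a grid cube is at most \<open>N / m\<close>, which bounds the kernel from below by \<open>1 / d\<close>.\<close>
  define d where "d = (N / real m) powr p"
  have pt: "(\<Sum>z\<in>Z. ennreal (indicator (Q z) x * indicator (Q z) y * (u x - u y)\<^sup>2))
     \<le> ennreal d * (ennreal (1 / norm (x - y) powr p) * ennreal ((u x - u y)\<^sup>2))" for x y
  proof (cases "cell m x = cell m y \<and> x \<noteq> y")
    case True
    have z: "ennreal (indicator (Q z) x * indicator (Q z) y * (u x - u y)\<^sup>2)
        = (if z = cell m x then ennreal ((u x - u y)\<^sup>2) else 0)" for z
      using True by (auto simp: Q_def indicator_def)
    have "(\<Sum>z\<in>Z. ennreal (indicator (Q z) x * indicator (Q z) y * (u x - u y)\<^sup>2))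
       \<le> ennreal ((u x - u y)\<^sup>2)"
      unfolding z by (simp add: fZ)
    also have "(u x - u y)\<^sup>2 \<le> d * (1 / norm (x - y) powr p * (u x - u y)\<^sup>2)"
    proof -
      have "norm (x - y) powr p \<le> d"
        unfolding d_def N_def using cell_diameter[OF conjunct1[OF True] m] p by (intro powr_mono2) auto
      then have "1 \<le> d * (1 / norm (x - y) powr p)"
        using True by (simp add: field_simps)
      from mult_right_mono[OF this, of "(u x - u y)\<^sup>2"] show ?thesis by (simp add: mult.assoc)
    qed
    then have "ennreal ((u x - u y)\<^sup>2) \<le> ennreal d * (ennreal (1 / norm (x - y) powr p) * ennreal ((u x - u y)\<^sup>2))"
      by (subst ennreal_mult[symmetric], simp, simp, subst ennreal_mult[symmetric]) (auto simp: d_def intro: ennreal_leI)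
    finally show ?thesis .
  next
    case False
    then have "indicator (Q z) x * indicator (Q z) y * (u x - u y)\<^sup>2 = 0" for z
      by (auto simp: Q_def indicator_def)
    then show ?thesis by (simp only:) simp
  qed
  have "ennreal (\<Sum>z\<in>Z. 2 * q * S z - 2 * (cell_integral m z u)\<^sup>2)
      \<le> (\<Sum>z\<in>Z. ennreal (2 * q * S z - 2 * (cell_integral m z u)\<^sup>2))"
    using fZ by (induction Z rule: finite_induct) (auto intro: order_trans[OF ennreal_add_le] add_left_mono)
  also have "\<dots> = (\<Sum>z\<in>Z. (\<integral>\<^sup>+x. \<integral>\<^sup>+y. ennreal (indicator (Q z) x * indicator (Q z) y * (u x - u y)\<^sup>2) \<partial>lborel \<partial>lborel))"
    using var by (intro sum.cong) auto
  also have "\<dots> = (\<integral>\<^sup>+x. \<integral>\<^sup>+y. (\<Sum>z\<in>Z. ennreal (indicator (Q z) x * indicator (Q z) y * (u x - u y)\<^sup>2)) \<partial>lborel \<partial>lborel)"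
    by (simp add: nn_integral_sum del: sum_ennreal)
  also have "\<dots> \<le> (\<integral>\<^sup>+x. \<integral>\<^sup>+y. ennreal d * (ennreal (1 / norm (x - y) powr p) * ennreal ((u x - u y)\<^sup>2)) \<partial>lborel \<partial>lborel)"
    by (intro nn_integral_mono pt)
  also have "\<dots> = ennreal d * (\<integral>\<^sup>+x. \<integral>\<^sup>+y. (ennreal (1 / norm (x - y) powr p) * ennreal ((u x - u y)\<^sup>2)) \<partial>lborel \<partial>lborel)"
    by (simp add: nn_integral_cmult)
  also have "(\<integral>\<^sup>+x. \<integral>\<^sup>+y. (ennreal (1 / norm (x - y) powr p) * ennreal ((u x - u y)\<^sup>2)) \<partial>lborel \<partial>lborel) = ennreal (energy s u u)"
    unfolding ennreal_energy[OF u] p_def N_def by (subst nn_integral_gagliardo) auto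
  also have "ennreal d * ennreal (energy s u u) = ennreal (d * energy s u u)"
    by (simp add: ennreal_mult d_def energy_nonneg)
  finally have "(\<Sum>z\<in>Z. 2 * q * S z - 2 * (cell_integral m z u)\<^sup>2) \<le> d * energy s u u"
    by (simp add: ennreal_le_iff energy_nonneg d_def)
  then have main: "2 * q * (\<Sum>z\<in>Z. S z) \<le> d * energy s u u + 2 * (\<Sum>z\<in>Z. (cell_integral m z u)\<^sup>2)"
    by (simp add: sum_subtractf sum_distrib_left)
  have "(\<Sum>z\<in>Z. S z) = (\<integral>x. (\<Sum>z\<in>Z. indicator (Q z) x * (u x)\<^sup>2) \<partial>lborel)"
    unfolding S_def using iS by (simp add: Bochner_Integration.integral_sum)
  also have "\<dots> = (\<integral>x. (u x)\<^sup>2 \<partial>lborel)"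
  proof (rule Bochner_Integration.integral_cong[OF refl])
    fix x show "(\<Sum>z\<in>Z. indicator (Q z) x * (u x)\<^sup>2) = (u x)\<^sup>2"
    proof (cases "x \<in> \<Omega>")
      case True
      then have "cell m x \<in> Z" by (simp add: Z_def)
      moreover have "indicator (Q z) x * (u x)\<^sup>2 = (if cell m x = z then (u x)\<^sup>2 else 0)" for z
        by (auto simp: Q_def indicator_def)
      ultimately show ?thesis using fZ by simp
    next
      case False
      then show ?thesis using W0D(2)[OF u] by simp
    qed
  qed
  finally have "2 * q * (\<integral>x. (u x)\<^sup>2 \<partial>lborel) \<le> d * energy s u u + 2 * (\<Sum>z\<in>Z. (cell_integral m z u)\<^sup>2)"
    using main by simp
  then have "(\<integral>x. (u x)\<^sup>2 \<partial>lborel) \<le> d / (2 * q) * energy s u u + 1 / q * (\<Sum>z\<in>Z. (cell_integral m z u)\<^sup>2)"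
    using q by (simp add: field_simps)
  also have "1 / q = real m ^ DIM('b)" unfolding q_def by (simp add: power_one_over)
  also have "d / (2 * q) * energy s u u \<le> N powr p * real m powr (- 2 * s) * energy s u u"
  proof (rule mult_right_mono[OF _ energy_nonneg])
    have "d / q = N powr p * (real m powr (- p) * real m ^ DIM('b))"
      unfolding d_def q_def using m by (simp add: powr_divide N_def power_one_over powr_minus field_simps)
    also have "real m powr (- p) * real m ^ DIM('b) = real m powr (- 2 * s)"
      using m by (simp add: p_def N_def powr_realpow[symmetric] powr_add[symmetric])
    finally have "d / q = N powr p * real m powr (- 2 * s)" .
    moreover have "d / (2 * q) \<le> d / q" using q by (simp add: d_def field_simps)
    ultimately show "d / (2 * q) \<le> N powr p * real m powr (- 2 * s)" by simp
  qed
  finally show ?thesis by (simp add: Z_def p_def N_def)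
qed

lemma finite_convergent_subseq:
  fixes a :: "'z \<Rightarrow> nat \<Rightarrow> real"
  assumes "finite Z" "\<And>z n. z \<in> Z \<Longrightarrow> \<bar>a z n\<bar> \<le> C"
  shows "\<exists>r. strict_mono r \<and> (\<forall>z\<in>Z. convergent (\<lambda>n. a z (r n)))"
  using assms
proof (induction Z)
  case empty
  then show ?case by (intro exI[of _ id]) (auto simp: strict_mono_def)
next
  case (insert w Z)
  then obtain r :: "nat \<Rightarrow> nat" where r: "strict_mono r" "\<forall>z\<in>Z. convergent (\<lambda>n. a z (r n))" by auto
  have "bounded (range (\<lambda>n. a w (r n)))"
    using insert.prems[of w] by (auto simp: bounded_iff)
  from bounded_imp_convergent_subsequence[OF this] obtain l q where
    q: "strict_mono q" "((\<lambda>n. a w (r n)) \<circ> q) \<longlonglongrightarrow> l" by auto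
  have "convergent (\<lambda>n. a z (r (q n)))" if "z \<in> insert w Z" for z
  proof (cases "z = w")
    case True then show ?thesis using q by (auto simp: convergent_def o_def)
  next
    case False
    then have "convergent (\<lambda>n. a z (r n))" using r that by auto
    from convergent_subseq_convergent[OF this q(1)] show ?thesis by (simp add: o_def)
  qed
  then show ?case using strict_mono_o[OF r(1) q(1)] by (intro exI[of _ "r \<circ> q"]) (auto simp: o_def)
qed

lemma AE_fst_snd:
  fixes P :: "'b::euclidean_space \<Rightarrow> bool"
  assumes "AE x in lborel. P x"
  shows "AE z in lborel. P (fst z) \<and> P (snd z)"
proof -
  from AE_E[OF assms] obtain N where N: "{x \<in> space lborel. \<not> P x} \<subseteq> N" "emeasure lborel N = 0" "N \<in> sets lborel" .
  then have "N \<times> UNIV \<in> null_sets (lborel \<Otimes>\<^sub>M lborel)" "UNIV \<times> N \<in> null_sets (lborel \<Otimes>\<^sub>M lborel)"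
    by (auto simp: null_sets_def lborel.emeasure_pair_measure_Times)
  then have "N \<times> UNIV \<union> UNIV \<times> N \<in> null_sets lborel"
    unfolding lborel_prod by (intro null_sets.Un)
  moreover have "{z. \<not> (P (fst z) \<and> P (snd z))} \<subseteq> N \<times> UNIV \<union> UNIV \<times> N"
    using N(1) by auto
  ultimately show ?thesis by (intro AE_I') auto
qed

lemma AE_gagliardo:
  assumes "AE x in lborel. P x"
  shows "AE z in gagliardo s. P (fst z) \<and> P (snd z)"
  using AE_fst_snd[OF assms] unfolding gagliardo_def kernel_def by (subst AE_density) auto

text \<open>
Along a diagonal subsequence the integrals over all cubes of all grids converge.  By \<open>L2_le_energy_plus_cells\<close> this
subsequence is Cauchy in \<open>L\<^sup>2\<close>.  A further subsequence converges almost everywhere, and Fatou's lemma carries over the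
\<open>L\<^sup>2\<close> convergence and the energy bound to the limit.
\<close>
theorem Rellich_compactness:
  fixes \<Omega> :: "'b::euclidean_space set" and f :: "nat \<Rightarrow> 'b \<Rightarrow> real"
  assumes s: "0 < s" and \<Omega>: "open \<Omega>" "bounded \<Omega>"
    and f: "\<And>n. f n \<in> W0 s \<Omega>" and E: "\<And>n. energy s (f n) (f n) \<le> 1"
  shows "\<exists>r g. strict_mono r \<and> g \<in> W0 s \<Omega> \<and> energy s g g \<le> 1 \<and>
    (\<lambda>i. \<integral>x. (f (r i) x - g x)\<^sup>2 \<partial>lborel) \<longlonglongrightarrow> 0"
proof -
  note [measurable] = W0D(1)[OF f]
  have [measurable]: "\<Omega> \<in> sets borel" using \<Omega> by auto
  obtain C where C: "0 \<le> C" "\<And>u. u \<in> W0 s \<Omega> \<Longrightarrow> (\<integral>x. (u x)\<^sup>2 \<partial>lborel) \<le> C * energy s u u"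
    using Poincare[OF s \<Omega>(2)] by auto
  have fin: "emeasure lborel \<Omega> < \<infinity>" using emeasure_bounded_finite[OF \<Omega>(2)] by simp
  define w where "w = measure lborel \<Omega>"
  have w: "0 \<le> w" by (simp add: w_def)
  have fint: "integrable lborel (f n)" for n by (rule W0_integrable[OF \<Omega> f])
  have young: "\<bar>u x\<bar> \<le> t * indicator \<Omega> x + (u x)\<^sup>2 / t" if "u \<in> W0 s \<Omega>" "0 < t" for u x t
  proof (cases "x \<in> \<Omega>")
    case True
    have "0 \<le> t * \<bar>u x\<bar>" using that(2) by simp
    moreover have "2 * (t * \<bar>u x\<bar>) \<le> t * t + (u x)\<^sup>2"
      using sum_squares_bound[of t "\<bar>u x\<bar>"] by (simp add: power2_eq_square)
    ultimately have "t * \<bar>u x\<bar> \<le> t * t + (u x)\<^sup>2" by linarith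
    then show ?thesis using True that(2) by (simp add: field_simps)
  next
    case False then show ?thesis using W0D(2)[OF that(1)] by simp
  qed
  have L1: "(\<integral>x. \<bar>u x\<bar> \<partial>lborel) \<le> t * w + (\<integral>x. (u x)\<^sup>2 \<partial>lborel) / t" if u: "u \<in> W0 s \<Omega>" and t: "0 < t" for u t
  proof -
    have "(\<integral>x. \<bar>u x\<bar> \<partial>lborel) \<le> (\<integral>x. t * indicator \<Omega> x + (u x)\<^sup>2 / t \<partial>lborel)"
      using W0_integrable[OF \<Omega> u] W0D(3)[OF u] fin
      by (intro integral_mono young u t Bochner_Integration.integrable_add integrable_mult_right integrable_real_indicator integrable_divide integrable_abs) auto
    also have "\<dots> = t * w + (\<integral>x. (u x)\<^sup>2 \<partial>lborel) / t"
      using W0D(3)[OF u] fin by (subst Bochner_Integration.integral_add) (auto simp: w_def)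
    finally show ?thesis .
  qed
  have cb: "\<bar>cell_integral m z (f n)\<bar> \<le> w + C" for m z n
  proof -
    have [measurable]: "{y :: 'b. cell m y = z} \<in> sets borel" by measurable
    have "\<bar>cell_integral m z (f n)\<bar> \<le> (\<integral>x. \<bar>indicator {y. cell m y = z} x * f n x\<bar> \<partial>lborel)"
      unfolding cell_integral_def by (rule integral_abs_bound)
    also have "\<dots> \<le> (\<integral>x. \<bar>f n x\<bar> \<partial>lborel)"
      using integrable_real_mult_indicator[of "{y. cell m y = z}" lborel "f n"] fint[of n]
      by (intro integral_mono) (auto simp: mult.commute indicator_def)
    also have "\<dots> \<le> 1 * w + (\<integral>x. (f n x)\<^sup>2 \<partial>lborel) / 1" by (rule L1[OF f]) simp
    also have "(\<integral>x. (f n x)\<^sup>2 \<partial>lborel) \<le> C"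
      using C(2)[OF f, of n] mult_left_mono[OF E[of n] C(1)] by simp
    finally show ?thesis by simp
  qed
  interpret subseqs "\<lambda>m r. \<forall>z\<in>cell m ` \<Omega>. convergent (\<lambda>i. cell_integral m z (f (r i)))"
  proof
    fix m and r :: "nat \<Rightarrow> nat"
    show "\<exists>q. strict_mono q \<and> (\<forall>z\<in>cell m ` \<Omega>. convergent (\<lambda>i. cell_integral m z (f ((r \<circ> q) i))))"
      using finite_convergent_subseq[OF finite_cells[OF \<Omega>(2)], of m "\<lambda>z n. cell_integral m z (f (r n))" "w + C"] cb
      by simp
  qed
  define h where "h i = f (diagseq i)" for i
  have h: "h i \<in> W0 s \<Omega>" and hE: "energy s (h i) (h i) \<le> 1" for i by (simp_all add: h_def f E)
  note [measurable] = W0D(1)[OF h]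
  have hconv: "convergent (\<lambda>i. cell_integral m z (h i))" if "z \<in> cell m ` \<Omega>" for m z
  proof -
    have "\<forall>z\<in>cell m ` \<Omega>. convergent (\<lambda>i. cell_integral m z (f ((diagseq \<circ> (+) (Suc m)) i)))"
    proof (rule diagseq_holds)
      fix r s :: "nat \<Rightarrow> nat" and n :: nat
      assume "strict_mono r" "\<forall>z\<in>cell n ` \<Omega>. convergent (\<lambda>i. cell_integral n z (f (s i)))"
      then show "\<forall>z\<in>cell n ` \<Omega>. convergent (\<lambda>i. cell_integral n z (f ((s \<circ> r) i)))"
        using convergent_subseq_convergent[where f = r] by (fastforce simp: o_def)
    qed
    from bspec[OF this that] have "convergent (\<lambda>i. cell_integral m z (h (i + Suc m)))"
      by (simp add: h_def add.commute)
    then show ?thesis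
      using convergent_ignore_initial_segment[of "\<lambda>i. cell_integral m z (h i)" "Suc m"] by blast
  qed
  define D where "D i j = (\<integral>x. (h i x - h j x)\<^sup>2 \<partial>lborel)" for i j
  have cauchy: "\<exists>M. \<forall>i\<ge>M. \<forall>j\<ge>M. D i j < e" if e: "0 < e" for e
  proof -
    define K where "K = real DIM('b) powr (real DIM('b) + 2 * s)"
    have "((\<lambda>m. K * real m powr (- 2 * s) * 4) \<longlongrightarrow> K * 0 * 4) sequentially"
      using s by (intro tendsto_intros tendsto_neg_powr filterlim_real_sequentially) auto
    then have "\<forall>\<^sub>F m in sequentially. K * real m powr (- 2 * s) * 4 < e / 2"
      by (rule order_tendstoD) (use e in simp)
    moreover have "\<forall>\<^sub>F m in sequentially. 0 < m" by (rule eventually_gt_at_top)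
    ultimately have "\<forall>\<^sub>F m in sequentially. K * real m powr (- 2 * s) * 4 < e / 2 \<and> 0 < m"
      by eventually_elim auto
    then obtain m :: nat where m: "K * real m powr (- 2 * s) * 4 < e / 2" "0 < m"
      by (auto dest: eventually_happens)
    have "((\<lambda>p. real m ^ DIM('b) * (\<Sum>z\<in>cell m ` \<Omega>. (cell_integral m z (h (fst p)) - cell_integral m z (h (snd p)))\<^sup>2))
       \<longlongrightarrow> real m ^ DIM('b) * (\<Sum>z\<in>cell m ` \<Omega>. (lim (\<lambda>i. cell_integral m z (h i)) - lim (\<lambda>i. cell_integral m z (h i)))\<^sup>2))
       (sequentially \<times>\<^sub>F sequentially)"
    proof (intro tendsto_intros)
      fix z assume "z \<in> cell m ` \<Omega>"
      from hconv[OF this] have l: "(\<lambda>i. cell_integral m z (h i)) \<longlonglongrightarrow> lim (\<lambda>i. cell_integral m z (h i))"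
        by (simp add: convergent_LIMSEQ_iff)
      show "((\<lambda>p. cell_integral m z (h (fst p))) \<longlongrightarrow> lim (\<lambda>i. cell_integral m z (h i))) (sequentially \<times>\<^sub>F sequentially)"
        by (rule filterlim_compose[OF l filterlim_fst])
      show "((\<lambda>p. cell_integral m z (h (snd p))) \<longlongrightarrow> lim (\<lambda>i. cell_integral m z (h i))) (sequentially \<times>\<^sub>F sequentially)"
        by (rule filterlim_compose[OF l filterlim_snd])
    qed
    then have "\<forall>\<^sub>F p in sequentially \<times>\<^sub>F sequentially. real m ^ DIM('b) * (\<Sum>z\<in>cell m ` \<Omega>. (cell_integral m z (h (fst p)) - cell_integral m z (h (snd p)))\<^sup>2) < e / 2"
      by (rule order_tendstoD) (use e in simp)
    then obtain M where M: "\<And>i j. i \<ge> M \<Longrightarrow> j \<ge> M \<Longrightarrow>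
        real m ^ DIM('b) * (\<Sum>z\<in>cell m ` \<Omega>. (cell_integral m z (h i) - cell_integral m z (h j))\<^sup>2) < e / 2"
      unfolding eventually_prod_sequentially by auto
    have "D i j < e" if "i \<ge> M" "j \<ge> M" for i j
    proof -
      have d: "(\<lambda>x. h i x - h j x) \<in> W0 s \<Omega>" by (rule W0_diff[OF h h])
      have F: "energy s (\<lambda>x. h i x - h j x) (\<lambda>x. h i x - h j x) \<le> 4"
        using energy_diff_le[OF h h, of i j] hE[of i] hE[of j] by linarith
      have "D i j \<le> K * real m powr (- 2 * s) * energy s (\<lambda>x. h i x - h j x) (\<lambda>x. h i x - h j x)
        + real m ^ DIM('b) * (\<Sum>z\<in>cell m ` \<Omega>. (cell_integral m z (\<lambda>x. h i x - h j x))\<^sup>2)"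
        unfolding D_def K_def by (rule L2_le_energy_plus_cells[OF s \<Omega> m(2) d])
      also have "K * real m powr (- 2 * s) * energy s (\<lambda>x. h i x - h j x) (\<lambda>x. h i x - h j x) \<le> K * real m powr (- 2 * s) * 4"
        by (intro mult_left_mono F) (simp add: K_def)
      also have "(\<Sum>z\<in>cell m ` \<Omega>. (cell_integral m z (\<lambda>x. h i x - h j x))\<^sup>2) = (\<Sum>z\<in>cell m ` \<Omega>. (cell_integral m z (h i) - cell_integral m z (h j))\<^sup>2)"
        by (simp add: cell_integral_diff W0_integrable[OF \<Omega> h])
      finally show ?thesis using M[OF that] m(1) by linarith
    qed
    then show ?thesis by blast
  qed
  have "\<exists>M. \<forall>i\<ge>M. \<forall>j\<ge>M. (\<integral>x. norm (h i x - h j x) \<partial>lborel) < e" if e: "0 < e" for e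
  proof -
    \<comment> \<open>The choice makes both terms of the interpolation \<open>L1\<close> at most \<open>e/2\<close>.\<close>
    define t where "t = e / (2 * (w + 1))"
    have t: "0 < t" "t * w < e / 2" using e w by (auto simp: t_def field_simps)
    obtain M where M: "\<And>i j. i \<ge> M \<Longrightarrow> j \<ge> M \<Longrightarrow> D i j < t * (e / 2)"
      using cauchy[of "t * (e / 2)"] t e by auto
    have "(\<integral>x. norm (h i x - h j x) \<partial>lborel) < e" if "i \<ge> M" "j \<ge> M" for i j
    proof -
      have "(\<integral>x. norm (h i x - h j x) \<partial>lborel) \<le> t * w + D i j / t"
        using L1[OF W0_diff[OF h h] t(1), of i j] by (simp add: D_def)
      moreover have "D i j / t < e / 2" using M[OF that] t by (simp add: field_simps)
      ultimately show ?thesis using t(2) by linarith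
    qed
    then show ?thesis by blast
  qed
  with W0_integrable[OF \<Omega> h] obtain q where q: "strict_mono q" "AE x in lborel. Cauchy (\<lambda>i. h (q i) x)"
    by (rule cauchy_L1_AE_cauchy_subseq) auto
  define g where "g x = lim (\<lambda>i. h (q i) x)" for x
  have [measurable]: "g \<in> borel_measurable borel"
    unfolding g_def by (rule borel_measurable_lim_metric) measurable
  have lim: "AE x in lborel. (\<lambda>i. h (q i) x) \<longlonglongrightarrow> g x"
    using q(2) by eventually_elim (simp add: g_def convergent_LIMSEQ_iff[symmetric] Cauchy_convergent_iff)
  have g0: "g x = 0" if "x \<notin> \<Omega>" for x using W0D(2)[OF h that] by (simp add: g_def)
  have L2lim: "(\<integral>\<^sup>+x. ennreal ((h i x - g x)\<^sup>2) \<partial>lborel) \<le> ennreal e"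
    if M: "\<And>i j. i \<ge> M \<Longrightarrow> j \<ge> M \<Longrightarrow> D i j < e" and "i \<ge> M" for M i e
  proof -
    have "(\<integral>\<^sup>+x. ennreal ((h i x - g x)\<^sup>2) \<partial>lborel) = (\<integral>\<^sup>+x. liminf (\<lambda>j. ennreal ((h i x - h (q j) x)\<^sup>2)) \<partial>lborel)"
    proof (rule nn_integral_cong_AE, use lim in eventually_elim)
      fix x assume "(\<lambda>i. h (q i) x) \<longlonglongrightarrow> g x"
      then have "(\<lambda>j. ennreal ((h i x - h (q j) x)\<^sup>2)) \<longlonglongrightarrow> ennreal ((h i x - g x)\<^sup>2)"
        by (intro tendsto_ennrealI tendsto_intros)
      then show "ennreal ((h i x - g x)\<^sup>2) = liminf (\<lambda>j. ennreal ((h i x - h (q j) x)\<^sup>2))"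
        by (intro lim_imp_Liminf[symmetric]) auto
    qed
    also have "\<dots> \<le> liminf (\<lambda>j. \<integral>\<^sup>+x. ennreal ((h i x - h (q j) x)\<^sup>2) \<partial>lborel)"
      by (rule nn_integral_liminf) measurable
    also have "\<dots> \<le> ennreal e"
    proof (rule Liminf_le, simp)
      show "\<forall>\<^sub>F j in sequentially. (\<integral>\<^sup>+x. ennreal ((h i x - h (q j) x)\<^sup>2) \<partial>lborel) \<le> ennreal e"
        using eventually_ge_at_top[of M]
      proof eventually_elim
        fix j assume "M \<le> j"
        then have "M \<le> q j" using seq_suble[OF q(1), of j] by linarith
        then show "(\<integral>\<^sup>+x. ennreal ((h i x - h (q j) x)\<^sup>2) \<partial>lborel) \<le> ennreal e"
          using M[OF \<open>i \<ge> M\<close>, of "q j"] unfolding D_def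
          by (subst ennreal_L2[OF W0_diff[OF h h], symmetric]) (auto intro: ennreal_leI)
      qed
    qed
    finally show ?thesis .
  qed
  have gint: "integrable lborel (\<lambda>x. (h i x - g x)\<^sup>2)" and gle: "(\<integral>x. (h i x - g x)\<^sup>2 \<partial>lborel) \<le> e"
    if "\<And>i j. i \<ge> M \<Longrightarrow> j \<ge> M \<Longrightarrow> D i j < e" and "i \<ge> M" "0 < e" for M i e
  proof -
    show I: "integrable lborel (\<lambda>x. (h i x - g x)\<^sup>2)"
      using L2lim[OF that(1,2)] by (intro integrableI_nonneg) (auto intro: le_less_trans)
    have "ennreal (\<integral>x. (h i x - g x)\<^sup>2 \<partial>lborel) \<le> ennreal e"
      using L2lim[OF that(1,2)] by (subst nn_integral_eq_integral[symmetric]) (auto simp: I)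
    then show "(\<integral>x. (h i x - g x)\<^sup>2 \<partial>lborel) \<le> e" using that(3) by simp
  qed
  have conv: "(\<lambda>i. \<integral>x. (h i x - g x)\<^sup>2 \<partial>lborel) \<longlonglongrightarrow> 0"
  proof (rule LIMSEQ_I)
    fix e :: real assume e: "0 < e"
    obtain M where M: "\<And>i j. i \<ge> M \<Longrightarrow> j \<ge> M \<Longrightarrow> D i j < e / 2"
      using cauchy[of "e / 2"] e by auto
    have "norm ((\<integral>x. (h i x - g x)\<^sup>2 \<partial>lborel) - 0) < e" if "i \<ge> M" for i
      using gle[OF M that] e by simp
    then show "\<exists>M. \<forall>i\<ge>M. norm ((\<integral>x. (h i x - g x)\<^sup>2 \<partial>lborel) - 0) < e" by blast
  qed
  obtain M1 where M1: "\<And>i j. i \<ge> M1 \<Longrightarrow> j \<ge> M1 \<Longrightarrow> D i j < 1" using cauchy[of 1] by auto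
  have gi: "integrable lborel (\<lambda>x. (g x)\<^sup>2)"
  proof (rule Bochner_Integration.integrable_bound)
    show "integrable lborel (\<lambda>x. 2 * (h M1 x)\<^sup>2 + 2 * (h M1 x - g x)\<^sup>2)"
      using gint[OF M1, of M1] W0D(3)[OF h] by simp
    have "(g x)\<^sup>2 \<le> 2 * (h M1 x)\<^sup>2 + 2 * (h M1 x - g x)\<^sup>2" for x
      using zero_le_power2[of "2 * h M1 x - g x"] by (simp add: power2_eq_square algebra_simps)
    then show "AE x in lborel. norm ((g x)\<^sup>2) \<le> norm (2 * (h M1 x)\<^sup>2 + 2 * (h M1 x - g x)\<^sup>2)" by simp
  qed measurable
  have "(\<integral>\<^sup>+z. ennreal ((g (fst z) - g (snd z))\<^sup>2) \<partial>gagliardo s)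
     = (\<integral>\<^sup>+z. liminf (\<lambda>j. ennreal ((h (q j) (fst z) - h (q j) (snd z))\<^sup>2)) \<partial>gagliardo s)"
  proof (rule nn_integral_cong_AE, use AE_gagliardo[OF lim] in eventually_elim)
    fix z :: "'b \<times> 'b" assume "(\<lambda>i. h (q i) (fst z)) \<longlonglongrightarrow> g (fst z) \<and> (\<lambda>i. h (q i) (snd z)) \<longlonglongrightarrow> g (snd z)"
    then have "(\<lambda>j. ennreal ((h (q j) (fst z) - h (q j) (snd z))\<^sup>2)) \<longlonglongrightarrow> ennreal ((g (fst z) - g (snd z))\<^sup>2)"
      by (intro tendsto_ennrealI tendsto_intros) auto
    then show "ennreal ((g (fst z) - g (snd z))\<^sup>2) = liminf (\<lambda>j. ennreal ((h (q j) (fst z) - h (q j) (snd z))\<^sup>2))"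
      by (intro lim_imp_Liminf[symmetric]) auto
  qed
  also have "\<dots> \<le> liminf (\<lambda>j. \<integral>\<^sup>+z. ennreal ((h (q j) (fst z) - h (q j) (snd z))\<^sup>2) \<partial>gagliardo s)"
    by (rule nn_integral_liminf) measurable
  also have "\<dots> \<le> 1"
  proof (rule Liminf_le, simp, rule always_eventually, rule allI)
    fix j
    have "ennreal (energy s (h (q j)) (h (q j))) \<le> ennreal 1" using hE by (intro ennreal_leI)
    then show "(\<integral>\<^sup>+z. ennreal ((h (q j) (fst z) - h (q j) (snd z))\<^sup>2) \<partial>gagliardo s) \<le> 1"
      by (simp add: ennreal_energy[OF h])
  qed
  finally have gE: "(\<integral>\<^sup>+z. ennreal ((g (fst z) - g (snd z))\<^sup>2) \<partial>gagliardo s) \<le> 1" .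
  have gW: "g \<in> W0 s \<Omega>" unfolding W0_def
    using gE by (intro CollectI conjI allI impI g0 gi integrableI_nonneg) (auto intro: le_less_trans)
  have "ennreal (energy s g g) \<le> ennreal 1" using gE by (simp add: ennreal_energy[OF gW])
  then have "energy s g g \<le> 1" by simp
  then show ?thesis using subseq_diagseq gW conv unfolding h_def by blast
qed

text \<open>
From \<open>a\<^sup>2 - b\<^sup>2 = (a - b)\<^sup>2 + 2 b (a - b)\<close> and Young's inequality with a small parameter \<open>t\<close>.
\<close>
lemma tendsto_weighted_L2:
  fixes \<rho> g :: "'c \<Rightarrow> real" and f :: "nat \<Rightarrow> 'c \<Rightarrow> real"
  assumes [measurable]: "\<rho> \<in> borel_measurable M" "\<And>i. f i \<in> borel_measurable M" "g \<in> borel_measurable M"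
    and B: "\<And>x. \<bar>\<rho> x\<bar> \<le> B"
    and f: "\<And>i. integrable M (\<lambda>x. (f i x)\<^sup>2)" and g: "integrable M (\<lambda>x. (g x)\<^sup>2)"
    and lim: "(\<lambda>i. \<integral>x. (f i x - g x)\<^sup>2 \<partial>M) \<longlonglongrightarrow> 0"
  shows "(\<lambda>i. \<integral>x. \<rho> x * (f i x)\<^sup>2 \<partial>M) \<longlonglongrightarrow> (\<integral>x. \<rho> x * (g x)\<^sup>2 \<partial>M)"
proof (rule LIMSEQ_I)
  fix e :: real assume e: "0 < e"
  have B0: "0 \<le> B" using B[of undefined] abs_ge_zero[of "\<rho> undefined"] by linarith
  define G where "G = (\<integral>x. (g x)\<^sup>2 \<partial>M)"
  have G: "0 \<le> G" by (simp add: G_def)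
  define t where "t = e / (2 * (B * G + 1))"
  have t: "0 < t" using e B0 G by (simp add: t_def add_nonneg_pos)
  have t2: "B * (t * G) < e / 2"
  proof -
    have "B * G * e < e * (B * G + 1)" using e by (simp add: algebra_simps)
    moreover have "0 < B * G + 1" using B0 G by (simp add: add_nonneg_pos)
    ultimately have "B * G * e / (B * G + 1) < e" by (simp add: divide_less_eq)
    moreover have "B * (t * G) = B * G * e / (B * G + 1) / 2" by (simp add: t_def mult_ac)
    ultimately show ?thesis by (simp only: divide_strict_right_mono zero_less_numeral)
  qed
  have fg: "integrable M (\<lambda>x. (f i x - g x)\<^sup>2)" for i
  proof -
    have "integrable M (\<lambda>x. f i x * g x)" by (intro integrable_mult_of_squares f g) measurable
    then have "integrable M (\<lambda>x. (f i x)\<^sup>2 - 2 * (f i x * g x) + (g x)\<^sup>2)" using f g by simp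
    then show ?thesis by (simp add: power2_diff algebra_simps)
  qed
  have bi: "integrable M (\<lambda>x. \<rho> x * u x)" if u: "integrable M u" for u
  proof (rule Bochner_Integration.integrable_bound)
    show "integrable M (\<lambda>x. B * \<bar>u x\<bar>)" using u by simp
    have [measurable]: "u \<in> borel_measurable M" using u by auto
    show "(\<lambda>x. \<rho> x * u x) \<in> borel_measurable M" by measurable
    show "AE x in M. norm (\<rho> x * u x) \<le> norm (B * \<bar>u x\<bar>)"
      using B B0 by (auto simp: abs_mult intro!: mult_right_mono)
  qed
  have pt: "\<bar>\<rho> x * a\<^sup>2 - \<rho> x * b\<^sup>2\<bar> \<le> B * ((1 + 1 / t) * (a - b)\<^sup>2 + t * b\<^sup>2)" for x and a b :: real
  proof -
    have "2 * \<bar>b * (a - b)\<bar> \<le> t * b\<^sup>2 + (a - b)\<^sup>2 / t"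
    proof -
      have "0 \<le> (t * \<bar>b\<bar> - \<bar>a - b\<bar>)\<^sup>2" by simp
      also have "\<dots> = t\<^sup>2 * b\<^sup>2 - 2 * t * \<bar>b * (a - b)\<bar> + (a - b)\<^sup>2"
        by (simp add: power2_diff power_mult_distrib abs_mult)
      finally have "2 * t * \<bar>b * (a - b)\<bar> \<le> t\<^sup>2 * b\<^sup>2 + (a - b)\<^sup>2" by simp
      then show ?thesis using t by (simp add: field_simps power2_eq_square)
    qed
    moreover have "a\<^sup>2 - b\<^sup>2 = (a - b)\<^sup>2 + 2 * (b * (a - b))" by (simp add: power2_eq_square algebra_simps)
    moreover have "0 \<le> (a - b)\<^sup>2" by simp
    moreover have "(1 + 1 / t) * (a - b)\<^sup>2 = (a - b)\<^sup>2 + (a - b)\<^sup>2 / t" by (simp add: distrib_right)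
    ultimately have "\<bar>a\<^sup>2 - b\<^sup>2\<bar> \<le> (1 + 1 / t) * (a - b)\<^sup>2 + t * b\<^sup>2"
      by linarith
    moreover have "\<bar>\<rho> x * a\<^sup>2 - \<rho> x * b\<^sup>2\<bar> = \<bar>\<rho> x\<bar> * \<bar>a\<^sup>2 - b\<^sup>2\<bar>"
      by (simp add: right_diff_distrib[symmetric] abs_mult)
    ultimately show ?thesis using B[of x] by (simp add: mult_mono' )
  qed
  have "((\<lambda>i. B * ((1 + 1 / t) * (\<integral>x. (f i x - g x)\<^sup>2 \<partial>M) + t * G)) \<longlongrightarrow> B * ((1 + 1 / t) * 0 + t * G)) sequentially"
    by (intro tendsto_intros lim)
  then have "\<forall>\<^sub>F i in sequentially. B * ((1 + 1 / t) * (\<integral>x. (f i x - g x)\<^sup>2 \<partial>M) + t * G) < e"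
    by (rule order_tendstoD) (use t2 e in simp)
  then have "\<forall>\<^sub>F i in sequentially. norm ((\<integral>x. \<rho> x * (f i x)\<^sup>2 \<partial>M) - (\<integral>x. \<rho> x * (g x)\<^sup>2 \<partial>M)) < e"
  proof eventually_elim
    fix i assume i: "B * ((1 + 1 / t) * (\<integral>x. (f i x - g x)\<^sup>2 \<partial>M) + t * G) < e"
    have "\<bar>(\<integral>x. \<rho> x * (f i x)\<^sup>2 \<partial>M) - (\<integral>x. \<rho> x * (g x)\<^sup>2 \<partial>M)\<bar> = \<bar>\<integral>x. \<rho> x * (f i x)\<^sup>2 - \<rho> x * (g x)\<^sup>2 \<partial>M\<bar>"
      using bi f g by simp
    also have "\<dots> \<le> (\<integral>x. \<bar>\<rho> x * (f i x)\<^sup>2 - \<rho> x * (g x)\<^sup>2\<bar> \<partial>M)" by (rule integral_abs_bound)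
    also have "\<dots> \<le> (\<integral>x. B * ((1 + 1 / t) * (f i x - g x)\<^sup>2 + t * (g x)\<^sup>2) \<partial>M)"
      using bi f g fg by (intro integral_mono pt) auto
    also have "\<dots> = B * ((1 + 1 / t) * (\<integral>x. (f i x - g x)\<^sup>2 \<partial>M) + t * G)"
      using fg g by (simp add: G_def)
    finally show "norm ((\<integral>x. \<rho> x * (f i x)\<^sup>2 \<partial>M) - (\<integral>x. \<rho> x * (g x)\<^sup>2 \<partial>M)) < e"
      using i by simp
  qed
  then show "\<exists>no. \<forall>n\<ge>no. norm ((\<integral>x. \<rho> x * (f n x)\<^sup>2 \<partial>M) - (\<integral>x. \<rho> x * (g x)\<^sup>2 \<partial>M)) < e"
    by (simp add: eventually_sequentially)
qed

section \<open>The weighted quadratic form\<close>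

definition weight_form :: "('b::euclidean_space \<Rightarrow> real) \<Rightarrow> ('b \<Rightarrow> real) \<Rightarrow> ('b \<Rightarrow> real) \<Rightarrow> real" where
  "weight_form \<rho> u v = (\<integral>x. \<rho> x * u x * v x \<partial>lborel)"

lemma weight_form_integrable:
  assumes [measurable]: "\<rho> \<in> borel_measurable borel" and B: "\<And>x. \<bar>\<rho> x\<bar> \<le> B"
    and u: "u \<in> W0 s \<Omega>" and v: "v \<in> W0 s \<Omega>"
  shows "integrable lborel (\<lambda>x. \<rho> x * u x * v x)"
proof -
  note [measurable] = W0D(1)[OF u] W0D(1)[OF v]
  have i: "integrable lborel (\<lambda>x. u x * v x)"
    by (intro integrable_mult_of_squares W0D(3)[OF u] W0D(3)[OF v]) measurable
  show ?thesis
  proof (rule Bochner_Integration.integrable_bound)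
    show "integrable lborel (\<lambda>x. B * \<bar>u x * v x\<bar>)" using i by simp
    have "0 \<le> B" using B[of undefined] abs_ge_zero[of "\<rho> undefined"] by linarith
    then have "norm (\<rho> x * u x * v x) \<le> norm (B * \<bar>u x * v x\<bar>)" for x
      using mult_right_mono[OF B[of x], of "\<bar>u x * v x\<bar>"] by (simp add: abs_mult mult.assoc)
    then show "AE x in lborel. norm (\<rho> x * u x * v x) \<le> norm (B * \<bar>u x * v x\<bar>)" by simp
  qed measurable
qed

lemma weight_form_self: "weight_form \<rho> u u = (\<integral>x. \<rho> x * (u x)\<^sup>2 \<partial>lborel)"
  by (simp add: weight_form_def power2_eq_square mult.assoc)

lemma weight_form_scale: "weight_form \<rho> (\<lambda>x. t * u x) (\<lambda>x. t * u x) = t\<^sup>2 * weight_form \<rho> u u"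
proof -
  have "weight_form \<rho> (\<lambda>x. t * u x) (\<lambda>x. t * u x) = (\<integral>x. t\<^sup>2 * (\<rho> x * u x * u x) \<partial>lborel)"
    unfolding weight_form_def by (intro Bochner_Integration.integral_cong) (auto simp: power2_eq_square)
  then show ?thesis by (simp add: weight_form_def)
qed

lemma weight_form_add_scaled:
  assumes \<rho>: "\<rho> \<in> borel_measurable borel" "\<And>x. \<bar>\<rho> x\<bar> \<le> B"
    and u: "u \<in> W0 s \<Omega>" and w: "w \<in> W0 s \<Omega>"
  shows "weight_form \<rho> (\<lambda>x. u x + t * w x) (\<lambda>x. u x + t * w x)
    = weight_form \<rho> u u + 2 * t * weight_form \<rho> u w + t\<^sup>2 * weight_form \<rho> w w"
proof -
  have "weight_form \<rho> (\<lambda>x. u x + t * w x) (\<lambda>x. u x + t * w x)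
    = (\<integral>x. \<rho> x * u x * u x + (2 * t * (\<rho> x * u x * w x) + t\<^sup>2 * (\<rho> x * w x * w x)) \<partial>lborel)"
    unfolding weight_form_def by (intro Bochner_Integration.integral_cong) (auto simp: algebra_simps power2_eq_square)
  also have "\<dots> = weight_form \<rho> u u + (2 * t * weight_form \<rho> u w + t\<^sup>2 * weight_form \<rho> w w)"
    unfolding weight_form_def using weight_form_integrable[OF \<rho> u u] weight_form_integrable[OF \<rho> u w] weight_form_integrable[OF \<rho> w w]
    by (simp add: Bochner_Integration.integral_add)
  finally show ?thesis by simp
qed

lemma W0_AE_zero_iff:
  assumes u: "u \<in> W0 s \<Omega>"
  shows "(\<integral>x. (u x)\<^sup>2 \<partial>lborel) = 0 \<longleftrightarrow> (AE x in lborel. u x = 0)"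
  using W0D(3)[OF u] by (subst integral_nonneg_eq_0_iff_AE) auto

lemma energy_pos:
  assumes s: "0 < s" and \<Omega>: "bounded \<Omega>" and u: "u \<in> W0 s \<Omega>" and nz: "\<not> (AE x in lborel. u x = 0)"
  shows "0 < energy s u u"
proof -
  obtain C where C: "0 \<le> C" "(\<integral>x. (u x)\<^sup>2 \<partial>lborel) \<le> C * energy s u u"
    using Poincare[OF s \<Omega>] u by blast
  have "(\<integral>x. (u x)\<^sup>2 \<partial>lborel) \<noteq> 0" using W0_AE_zero_iff[OF u] nz by blast
  moreover have "0 \<le> (\<integral>x. (u x)\<^sup>2 \<partial>lborel)" by simp
  moreover have "(\<integral>x. (u x)\<^sup>2 \<partial>lborel) \<le> 0" if "energy s u u = 0" using C(2) that by simp
  ultimately have "energy s u u \<noteq> 0" by linarith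
  then show ?thesis using energy_nonneg[of s u] by linarith
qed

section \<open>Test functions\<close>

lemma infdist_compl_pos:
  fixes \<Omega> :: "'b::euclidean_space set"
  assumes \<Omega>: "open \<Omega>" "bounded \<Omega>" and x: "x \<in> \<Omega>"
  shows "0 < infdist x (- \<Omega>)"
proof -
  have "- \<Omega> \<noteq> {}"
  proof
    assume "- \<Omega> = {}"
    then have "\<Omega> = UNIV" by auto
    then show False using \<Omega>(2) not_bounded_UNIV by blast
  qed
  moreover have "closed (- \<Omega>)" using \<Omega>(1) by (simp only: closed_def double_complement)
  ultimately have "infdist x (- \<Omega>) \<noteq> 0" using in_closed_iff_infdist_zero[of "- \<Omega>" x] x by simp
  then show ?thesis using infdist_nonneg[of x "- \<Omega>"] by linarith
qed

lemma infdist_Lipschitz: "\<bar>infdist x A - infdist y A\<bar> \<le> norm (x - y)"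
  for x y :: "'b::euclidean_space"
  using infdist_triangle_abs[of x A y] by (simp add: dist_norm)

text \<open>
A Lipschitz function that is positive exactly on an open bounded \<open>\<Omega>\<close>; one such function serves as a cutoff for all of \<open>\<Omega>\<close>.
\<close>
definition cutoff :: "'b::euclidean_space set \<Rightarrow> 'b \<Rightarrow> real" where
  "cutoff \<Omega> x = min 1 (infdist x (- \<Omega>))"

lemma cutoff_bounds: "0 \<le> cutoff \<Omega> x" "cutoff \<Omega> x \<le> 1"
  by (auto simp: cutoff_def infdist_nonneg)

lemma cutoff_pos: "open \<Omega> \<Longrightarrow> bounded \<Omega> \<Longrightarrow> x \<in> \<Omega> \<Longrightarrow> 0 < cutoff \<Omega> x"
  by (simp add: cutoff_def infdist_compl_pos)

lemma cutoff_zero: "x \<notin> \<Omega> \<Longrightarrow> cutoff \<Omega> x = 0"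
  by (simp add: cutoff_def)

lemma cutoff_Lipschitz: "\<bar>cutoff \<Omega> x - cutoff \<Omega> y\<bar> \<le> norm (x - y)"
  using infdist_Lipschitz[of x "- \<Omega>" y] unfolding cutoff_def by linarith

lemma measurable_infdist [measurable]: "(\<lambda>x. infdist x A) \<in> borel_measurable (borel :: 'b::euclidean_space measure)"
  by (intro borel_measurable_continuous_onI continuous_intros)

lemma measurable_cutoff [measurable]: "cutoff \<Omega> \<in> borel_measurable borel"
  unfolding cutoff_def[abs_def] by measurable

lemma cutoff_W0:
  assumes "0 < s" "s < 1" "open \<Omega>" "bounded \<Omega>"
  shows "cutoff \<Omega> \<in> W0 s \<Omega>"
proof (rule W0_Lipschitz[where B = 1 and L = 1])
  show "\<bar>cutoff \<Omega> x\<bar> \<le> 1" for x using cutoff_bounds[of \<Omega> x] by simp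
qed (use assms cutoff_zero cutoff_Lipschitz in simp_all)

text \<open>
For a closed set \<open>K\<close> these Lipschitz functions decrease to \<open>cutoff \<Omega>\<close> on \<open>K\<close> and to \<open>0\<close> off \<open>K\<close>.
\<close>
definition bump :: "'b::euclidean_space set \<Rightarrow> 'b set \<Rightarrow> nat \<Rightarrow> 'b \<Rightarrow> real" where
  "bump \<Omega> K n x = min (cutoff \<Omega> x) (max 0 (1 - real n * infdist x K))"

lemma bump_bounds: "0 \<le> bump \<Omega> K n x" "bump \<Omega> K n x \<le> 1"
  using cutoff_bounds[of \<Omega> x] by (auto simp: bump_def)

lemma measurable_bump [measurable]: "bump \<Omega> K n \<in> borel_measurable borel"
  unfolding bump_def[abs_def] by measurable

lemma bump_W0:
  assumes "0 < s" "s < 1" "open \<Omega>" "bounded \<Omega>"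
  shows "bump \<Omega> K n \<in> W0 s \<Omega>"
proof (rule W0_Lipschitz[where B = 1 and L = "1 + real n"])
  show "bump \<Omega> K n x = 0" if "x \<notin> \<Omega>" for x using cutoff_zero[OF that] by (simp add: bump_def)
  show "\<bar>bump \<Omega> K n x\<bar> \<le> 1" for x using bump_bounds[of \<Omega> K n x] by simp
  show "\<bar>bump \<Omega> K n x - bump \<Omega> K n y\<bar> \<le> (1 + real n) * norm (x - y)" for x y
  proof -
    have "\<bar>real n * infdist x K - real n * infdist y K\<bar> \<le> real n * norm (x - y)"
      using mult_left_mono[OF infdist_Lipschitz[of x K y], of "real n"] by (simp add: right_diff_distrib[symmetric] abs_mult)
    moreover have "0 \<le> real n * norm (x - y)" by simp
    moreover have "\<bar>min a (max 0 (1 - p)) - min c (max 0 (1 - q))\<bar> \<le> \<bar>a - c\<bar> + \<bar>p - q\<bar>" for a c p q :: real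
    proof -
      have "\<bar>max 0 (1 - p) - max 0 (1 - q)\<bar> \<le> \<bar>p - q\<bar>" by linarith
      then show ?thesis by linarith
    qed
    ultimately show ?thesis
      using cutoff_Lipschitz[of \<Omega> x y] unfolding bump_def distrib_right mult_1
      by (meson add_mono order_trans)
  qed
qed (use assms in auto)

lemma bump_tendsto:
  assumes "closed K" "K \<noteq> {}"
  shows "(\<lambda>n. bump \<Omega> K n x) \<longlonglongrightarrow> cutoff \<Omega> x * indicator K x"
proof (cases "x \<in> K")
  case True
  then have "bump \<Omega> K n x = cutoff \<Omega> x" for n
    using cutoff_bounds[of \<Omega> x] by (simp add: bump_def)
  then show ?thesis using True by simp
next
  case False
  then have d: "0 < infdist x K"
    using in_closed_iff_infdist_zero[OF assms, of x] infdist_nonneg[of x K] by linarith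
  obtain m :: nat where m: "1 < real m * infdist x K"
    using reals_Archimedean3[OF d] by blast
  have "\<forall>\<^sub>F n in sequentially. bump \<Omega> K n x = 0"
    using eventually_ge_at_top[of m]
  proof eventually_elim
    fix n assume "m \<le> n"
    then have "real m * infdist x K \<le> real n * infdist x K" using d by simp
    then show "bump \<Omega> K n x = 0" using m cutoff_bounds[of \<Omega> x] by (simp add: bump_def)
  qed
  then show ?thesis using False by (simp add: tendsto_eventually)
qed

text \<open>
If \<open>g\<close> were positive on a set of positive measure, it would be so on a closed subset \<open>K\<close> of positive measure, and
the squared bumps of \<open>K\<close> would lead to \<open>\<integral>\<^sub>K g \<eta>\<^sup>2 \<le> 0\<close> with the positive cutoff \<open>\<eta>\<close>.
\<close>
lemma nonpos_of_test:
  fixes g :: "'b::euclidean_space \<Rightarrow> real"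
  assumes s: "0 < s" "s < 1" and \<Omega>: "open \<Omega>" "bounded \<Omega>"
    and g: "integrable lborel g"
    and test: "\<And>K n. (\<integral>x. g x * (bump \<Omega> K n x)\<^sup>2 \<partial>lborel) \<le> 0"
  shows "AE x in lborel. x \<in> \<Omega> \<longrightarrow> g x \<le> 0"
proof (rule ccontr)
  have [measurable]: "g \<in> borel_measurable borel" using g by auto
  have [measurable]: "\<Omega> \<in> sets borel" using \<Omega> by auto
  define P where "P = {x \<in> \<Omega>. 0 < g x}"
  have [measurable]: "P \<in> sets borel" unfolding P_def by measurable
  assume not: "\<not> (AE x in lborel. x \<in> \<Omega> \<longrightarrow> g x \<le> 0)"
  have pos: "0 < emeasure lborel P"
  proof (rule ccontr)
    assume "\<not> 0 < emeasure lborel P"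
    then have "P \<in> null_sets lborel" by (auto simp: null_sets_def)
    then have "AE x in lborel. x \<in> \<Omega> \<longrightarrow> g x \<le> 0"
      by (rule AE_I') (auto simp: P_def)
    with not show False ..
  qed
  have fin: "emeasure lborel P < \<infinity>"
    using emeasure_bounded_finite[of P] bounded_subset[OF \<Omega>(2), of P] by (auto simp: P_def)
  have Pl: "P \<in> sets lebesgue" by simp
  obtain e where e: "0 < e" "emeasure lborel P = ennreal e"
    using pos fin by (cases "emeasure lborel P") auto
  obtain K where K: "closed K" "K \<subseteq> P" "emeasure lebesgue (P - K) < ennreal e"
    by (rule sets_lebesgue_inner_closed[OF Pl e(1)]) blast
  have [measurable]: "K \<in> sets borel" using K by auto
  have "emeasure lborel (P - K) < emeasure lborel P" using K(3) e by simp
  then have Kpos: "0 < emeasure lborel K"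
    using emeasure_Diff_null_set[of K lborel P] by (cases "emeasure lborel K = 0") (auto simp: zero_less_iff_neq_zero null_sets_def)
  then have Kne: "K \<noteq> {}" by auto
  have "(\<lambda>n. \<integral>x. g x * (bump \<Omega> K n x)\<^sup>2 \<partial>lborel) \<longlonglongrightarrow> (\<integral>x. g x * (cutoff \<Omega> x * indicator K x)\<^sup>2 \<partial>lborel)"
  proof (rule integral_dominated_convergence[where w = "\<lambda>x. \<bar>g x\<bar>"])
    show "AE x in lborel. (\<lambda>n. g x * (bump \<Omega> K n x)\<^sup>2) \<longlonglongrightarrow> g x * (cutoff \<Omega> x * indicator K x)\<^sup>2"
      by (intro AE_I2 tendsto_intros bump_tendsto K Kne)
    show "AE x in lborel. norm (g x * (bump \<Omega> K n x)\<^sup>2) \<le> \<bar>g x\<bar>" for n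
    proof (intro AE_I2)
      fix x
      have "(bump \<Omega> K n x)\<^sup>2 \<le> 1" using bump_bounds[of \<Omega> K n x] by (simp add: power_le_one)
      then show "norm (g x * (bump \<Omega> K n x)\<^sup>2) \<le> \<bar>g x\<bar>" by (simp add: abs_mult mult_left_le)
    qed
  qed (use g in auto)
  then have le: "(\<integral>x. g x * (cutoff \<Omega> x * indicator K x)\<^sup>2 \<partial>lborel) \<le> 0"
    by (rule LIMSEQ_le_const2) (use test in auto)
  have nn: "0 \<le> g x * (cutoff \<Omega> x * indicator K x)\<^sup>2" for x
    using K(2) by (auto simp: indicator_def P_def)
  have int: "integrable lborel (\<lambda>x. g x * (cutoff \<Omega> x * indicator K x)\<^sup>2)"
  proof (rule Bochner_Integration.integrable_bound[OF g])
    have "(cutoff \<Omega> x * indicator K x)\<^sup>2 \<le> 1" for x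
      using cutoff_bounds[of \<Omega> x] by (auto simp: indicator_def power_le_one)
    then show "AE x in lborel. norm (g x * (cutoff \<Omega> x * indicator K x)\<^sup>2) \<le> norm (g x)"
      by (auto simp: abs_mult mult_left_le)
  qed measurable
  have "(\<integral>x. g x * (cutoff \<Omega> x * indicator K x)\<^sup>2 \<partial>lborel) = 0"
    using le nn by (intro antisym integral_nonneg) auto
  then have "AE x in lborel. g x * (cutoff \<Omega> x * indicator K x)\<^sup>2 = 0"
    using int nn by (subst (asm) integral_nonneg_eq_0_iff_AE) auto
  then have "AE x in lborel. x \<notin> K"
  proof eventually_elim
    fix x assume 0: "g x * (cutoff \<Omega> x * indicator K x)\<^sup>2 = 0"
    show "x \<notin> K"
    proof
      assume "x \<in> K"
      then have "x \<in> \<Omega>" "0 < g x" using K(2) by (auto simp: P_def)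
      then show False using 0 \<open>x \<in> K\<close> cutoff_pos[OF \<Omega> \<open>x \<in> \<Omega>\<close>] by simp
    qed
  qed
  then have "K \<in> null_sets lborel" by (subst AE_iff_null_sets) auto
  then show False using Kpos by (auto simp: null_sets_def)
qed

section \<open>The largest Rayleigh quotient and the least positive eigenvalue\<close>

text \<open>
The function \<open>u\<close> attains the largest Rayleigh quotient \<open>M\<close> of the weight \<open>\<rho>\<close>.  The inequality is written without a
quotient, so that \<open>f = 0\<close> needs no exception.
\<close>
definition maximizer :: "real \<Rightarrow> 'b::euclidean_space set \<Rightarrow> ('b \<Rightarrow> real) \<Rightarrow> real \<Rightarrow> ('b \<Rightarrow> real) \<Rightarrow> bool" where
  "maximizer s \<Omega> \<rho> M u \<longleftrightarrow> u \<in> W0 s \<Omega> \<and> \<not> (AE x in lborel. u x = 0) \<and>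
     weight_form \<rho> u u = M * energy s u u \<and> (\<forall>f\<in>W0 s \<Omega>. weight_form \<rho> f f \<le> M * energy s f f)"

text \<open>
A maximizing sequence in the unit ball has an \<open>L\<^sup>2\<close> limit \<open>g\<close> of energy at most \<open>1\<close>, and the weighted integral passes to
the limit.  The supremum \<open>M\<close> is positive because \<open>\<rho>\<close> is positive on a set that bumps detect; so \<open>g\<close> has energy exactly \<open>1\<close>.
\<close>
theorem maximizer_exists:
  fixes \<Omega> :: "'b::euclidean_space set"
  assumes s: "0 < s" "s < 1" and \<Omega>: "open \<Omega>" "bounded \<Omega>"
    and \<rho>: "\<rho> \<in> borel_measurable borel" "\<And>x. \<bar>\<rho> x\<bar> \<le> B"
    and pos: "\<not> (AE x in lborel. x \<in> \<Omega> \<longrightarrow> \<rho> x \<le> 0)"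
  shows "\<exists>M u. 0 < M \<and> maximizer s \<Omega> \<rho> M u"
proof -
  note [measurable] = \<rho>(1)
  have [measurable]: "\<Omega> \<in> sets borel" using \<Omega> by auto
  have B: "0 \<le> B" using \<rho>(2)[of undefined] abs_ge_zero[of "\<rho> undefined"] by linarith
  obtain C where C: "0 \<le> C" "\<And>u. u \<in> W0 s \<Omega> \<Longrightarrow> (\<integral>x. (u x)\<^sup>2 \<partial>lborel) \<le> C * energy s u u"
    using Poincare[OF s(1) \<Omega>(2)] by auto
  have bound: "weight_form \<rho> u u \<le> B * C * energy s u u" if u: "u \<in> W0 s \<Omega>" for u
  proof -
    have "weight_form \<rho> u u \<le> (\<integral>x. B * (u x)\<^sup>2 \<partial>lborel)"
      unfolding weight_form_self using weight_form_integrable[OF \<rho> u u] W0D(3)[OF u]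
      by (intro integral_mono) (auto simp: power2_eq_square mult.assoc intro!: mult_right_mono abs_le_D1[OF \<rho>(2)])
    also have "\<dots> \<le> B * (C * energy s u u)"
      using mult_left_mono[OF C(2)[OF u] B] by simp
    finally show ?thesis by simp
  qed
  define A where "A = {weight_form \<rho> u u | u. u \<in> W0 s \<Omega> \<and> energy s u u \<le> 1}"
  have bdd: "bdd_above A"
  proof (rule bdd_aboveI[of _ "B * C"])
    fix a assume "a \<in> A"
    then obtain u where u: "u \<in> W0 s \<Omega>" "energy s u u \<le> 1" "a = weight_form \<rho> u u" by (auto simp: A_def)
    have "B * C * energy s u u \<le> B * C * 1" using u B C by (intro mult_left_mono) auto
    then show "a \<le> B * C" using bound[OF u(1)] u by simp
  qed
  define M where "M = Sup A"
  have scaled: "weight_form \<rho> f f \<le> M * energy s f f" if f: "f \<in> W0 s \<Omega>" for f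
  proof (cases "energy s f f = 0")
    case True
    then show ?thesis using bound[OF f] by simp
  next
    case False
    then have Q: "0 < energy s f f" using energy_nonneg[of s f] by linarith
    define t where "t = 1 / sqrt (energy s f f)"
    have t: "t\<^sup>2 = 1 / energy s f f" using Q by (simp add: t_def power_divide)
    have "weight_form \<rho> (\<lambda>x. t * f x) (\<lambda>x. t * f x) \<in> A"
      unfolding A_def using W0_scale[OF f, of t] Q by (auto simp: energy_scale t)
    then have "t\<^sup>2 * weight_form \<rho> f f \<le> M" unfolding M_def weight_form_scale by (intro cSup_upper bdd)
    then show ?thesis using Q by (simp add: t field_simps)
  qed
  have "\<exists>f\<in>W0 s \<Omega>. 0 < weight_form \<rho> f f"
  proof (rule ccontr)
    assume neg: "\<not> ?thesis"
    have t: "(\<integral>x. (\<rho> x * indicator \<Omega> x) * (bump \<Omega> K n x)\<^sup>2 \<partial>lborel) \<le> 0" for K n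
    proof -
      have b: "bump \<Omega> K n \<in> W0 s \<Omega>" by (rule bump_W0[OF s \<Omega>])
      have "(\<integral>x. (\<rho> x * indicator \<Omega> x) * (bump \<Omega> K n x)\<^sup>2 \<partial>lborel) = weight_form \<rho> (bump \<Omega> K n) (bump \<Omega> K n)"
        unfolding weight_form_self using W0D(2)[OF b] by (intro Bochner_Integration.integral_cong) (auto simp: indicator_def)
      then show ?thesis using neg b by (simp add: not_less)
    qed
    have "integrable lborel (\<lambda>x. \<rho> x * indicator \<Omega> x)"
    proof (rule Bochner_Integration.integrable_bound)
      show "integrable lborel (\<lambda>x. B * indicator \<Omega> x)"
        using emeasure_bounded_finite[OF \<Omega>(2)] by simp
      show "AE x in lborel. norm (\<rho> x * indicator \<Omega> x) \<le> norm (B * indicator \<Omega> x)"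
        using \<rho>(2) B by (auto simp: indicator_def)
    qed measurable
    from nonpos_of_test[OF s \<Omega> this t] have "AE x in lborel. x \<in> \<Omega> \<longrightarrow> \<rho> x \<le> 0"
      by eventually_elim auto
    with pos show False ..
  qed
  then obtain f where f: "f \<in> W0 s \<Omega>" "0 < weight_form \<rho> f f" by auto
  have M: "0 < M"
  proof (rule ccontr)
    assume "\<not> 0 < M"
    then have "M * energy s f f \<le> 0" using energy_nonneg[of s f] by (simp add: mult_nonpos_nonneg)
    then show False using scaled[OF f(1)] f(2) by linarith
  qed
  have ne: "A \<noteq> {}"
    using W0_scale[OF f(1), of 0] energy_scale[of s 0 f] unfolding A_def by auto
  have "\<exists>u. u \<in> W0 s \<Omega> \<and> energy s u u \<le> 1 \<and> M - 1 / real (Suc n) < weight_form \<rho> u u" for n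
  proof -
    have "M - 1 / real (Suc n) < Sup A" unfolding M_def by simp
    then obtain a where "a \<in> A" "M - 1 / real (Suc n) < a" using less_cSup_iff[OF ne bdd] by blast
    then show ?thesis by (auto simp: A_def)
  qed
  then obtain v where v: "\<And>n. v n \<in> W0 s \<Omega>" "\<And>n. energy s (v n) (v n) \<le> 1"
    "\<And>n. M - 1 / real (Suc n) < weight_form \<rho> (v n) (v n)" by metis
  obtain r g where r: "strict_mono r" and g: "g \<in> W0 s \<Omega>" "energy s g g \<le> 1"
    and lim: "(\<lambda>i. \<integral>x. (v (r i) x - g x)\<^sup>2 \<partial>lborel) \<longlonglongrightarrow> 0"
    using Rellich_compactness[of s \<Omega> v, OF s(1) \<Omega> v(1,2)] by (elim exE conjE) (rule that)
  have "(\<lambda>i. \<integral>x. \<rho> x * (v (r i) x)\<^sup>2 \<partial>lborel) \<longlonglongrightarrow> (\<integral>x. \<rho> x * (g x)\<^sup>2 \<partial>lborel)"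
    by (rule tendsto_weighted_L2[OF _ _ _ \<rho>(2) _ _ lim])
       (use W0D[OF v(1)] W0D[OF g(1)] in auto)
  then have lim2: "(\<lambda>i. weight_form \<rho> (v (r i)) (v (r i))) \<longlonglongrightarrow> weight_form \<rho> g g"
    by (simp add: weight_form_self)
  have "(\<lambda>i. M - 1 / real (Suc (r i))) \<longlonglongrightarrow> M - 0"
    using LIMSEQ_subseq_LIMSEQ[OF lim_1_over_n[where 'a = real, THEN LIMSEQ_Suc] r] 
    by (intro tendsto_intros) (simp add: o_def)
  then have "M - 0 \<le> weight_form \<rho> g g"
    by (rule LIMSEQ_le[OF _ lim2]) (use v(3) in \<open>auto intro: less_imp_le\<close>)
  then have "M \<le> weight_form \<rho> g g" by simp
  moreover have "weight_form \<rho> g g \<le> M * energy s g g" by (rule scaled[OF g(1)])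
  moreover have "M * energy s g g \<le> M * 1" using M g(2) by (intro mult_left_mono) auto
  ultimately have eq: "weight_form \<rho> g g = M * energy s g g" "weight_form \<rho> g g = M" by linarith+
  have "\<not> (AE x in lborel. g x = 0)"
  proof
    assume "AE x in lborel. g x = 0"
    then have "weight_form \<rho> g g = (\<integral>x. 0 \<partial>(lborel :: 'b measure))"
      unfolding weight_form_def using W0D(1)[OF g(1)] by (intro integral_cong_AE) auto
    then show False using eq(2) M by simp
  qed
  then show ?thesis using M g eq scaled unfolding maximizer_def by blast
qed

text \<open>
The quadratic polynomial \<open>t \<mapsto> M \<parallel>u + t w\<parallel>\<^sup>2 - \<integral> \<rho> (u + t w)\<^sup>2\<close> is nonnegative and vanishes at \<open>t = 0\<close>, so its
linear coefficient is zero.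
\<close>
lemma maximizer_Euler_Lagrange:
  assumes \<rho>: "\<rho> \<in> borel_measurable borel" "\<And>x. \<bar>\<rho> x\<bar> \<le> B"
    and m: "maximizer s \<Omega> \<rho> M u" and w: "w \<in> W0 s \<Omega>"
  shows "weight_form \<rho> u w = M * energy s u w"
proof -
  have u: "u \<in> W0 s \<Omega>" and eq: "weight_form \<rho> u u = M * energy s u u"
    and le: "\<And>f. f \<in> W0 s \<Omega> \<Longrightarrow> weight_form \<rho> f f \<le> M * energy s f f"
    using m by (auto simp: maximizer_def)
  define b where "b = weight_form \<rho> u w - M * energy s u w"
  define a where "a = M * energy s w w - weight_form \<rho> w w"
  have a: "0 \<le> a" unfolding a_def using le[OF w] by simp
  have q: "2 * t * b \<le> t\<^sup>2 * a" for t
  proof -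
    have "weight_form \<rho> u u + 2 * t * weight_form \<rho> u w + t\<^sup>2 * weight_form \<rho> w w
      \<le> M * (energy s u u + 2 * t * energy s u w + t\<^sup>2 * energy s w w)"
      using le[OF W0_add_scaled[OF u w, of t]] by (simp only: weight_form_add_scaled[OF \<rho> u w] energy_add_scaled[OF u w])
    then show ?thesis unfolding a_def b_def eq by (simp add: algebra_simps)
  qed
  have "b = 0"
  proof (rule ccontr)
    assume b: "b \<noteq> 0"
    \<comment> \<open>The value \<open>t = b / (a + 1)\<close> keeps the quadratic term below half of the linear one.\<close>
    have "2 * (b / (a + 1)) * b \<le> (b / (a + 1))\<^sup>2 * a" by (rule q)
    also have "\<dots> = (b\<^sup>2 / (a + 1)) * (a / (a + 1))" by (simp add: power2_eq_square)
    also have "\<dots> \<le> (b\<^sup>2 / (a + 1)) * 1" using a by (intro mult_left_mono) auto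
    finally have "2 * (b\<^sup>2 / (a + 1)) \<le> b\<^sup>2 / (a + 1)" by (simp add: power2_eq_square)
    moreover have "0 < b\<^sup>2 / (a + 1)" using b a by simp
    ultimately show False by linarith
  qed
  then show ?thesis by (simp add: b_def)
qed

lemma energy_abs_le:
  assumes u: "u \<in> W0 s \<Omega>"
  shows "energy s (\<lambda>x. \<bar>u x\<bar>) (\<lambda>x. \<bar>u x\<bar>) \<le> energy s u u"
  unfolding energy_self
proof (rule integral_mono[OF W0D(4)[OF W0_abs[OF u]] W0D(4)[OF u]])
  fix z show "(\<bar>u (fst z)\<bar> - \<bar>u (snd z)\<bar>)\<^sup>2 \<le> (u (fst z) - u (snd z))\<^sup>2"
    using abs_triangle_ineq3[of "u (fst z)" "u (snd z)"] by (simp add: abs_le_square_iff)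
qed

text \<open>
Taking absolute values keeps the weighted integral and does not increase the energy.
\<close>
lemma maximizer_abs:
  assumes M: "0 < M" and m: "maximizer s \<Omega> \<rho> M u"
  shows "maximizer s \<Omega> \<rho> M (\<lambda>x. \<bar>u x\<bar>)"
proof -
  have u: "u \<in> W0 s \<Omega>" and eq: "weight_form \<rho> u u = M * energy s u u"
    and le: "\<And>f. f \<in> W0 s \<Omega> \<Longrightarrow> weight_form \<rho> f f \<le> M * energy s f f"
    using m by (auto simp: maximizer_def)
  have "weight_form \<rho> (\<lambda>x. \<bar>u x\<bar>) (\<lambda>x. \<bar>u x\<bar>) = weight_form \<rho> u u" by (simp add: weight_form_self)
  moreover have "M * energy s (\<lambda>x. \<bar>u x\<bar>) (\<lambda>x. \<bar>u x\<bar>) \<le> M * energy s u u"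
    using M energy_abs_le[OF u] by simp
  ultimately show ?thesis
    using m le[OF W0_abs[OF u]] W0_abs[OF u] eq unfolding maximizer_def by simp
qed

definition borel_eigenvalue :: "real \<Rightarrow> 'b::euclidean_space set \<Rightarrow> ('b \<Rightarrow> real) \<Rightarrow> real \<Rightarrow> bool" where
  "borel_eigenvalue s \<Omega> \<rho> \<mu> \<longleftrightarrow> (\<exists>u\<in>W0 s \<Omega>. \<not> (AE x in lborel. u x = 0) \<and>
     (\<forall>\<phi>\<in>W0 s \<Omega>. energy s u \<phi> = \<mu> * weight_form \<rho> u \<phi>))"

text \<open>
A maximizer is an eigenfunction by the Euler-Lagrange equation, and testing any eigenvalue equation with its own
eigenfunction shows that \<open>1/\<mu>\<close> is one of the Rayleigh quotients.
\<close>
lemma least_borel_eigenvalue: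
  assumes s: "0 < s" and \<Omega>: "bounded \<Omega>"
    and \<rho>: "\<rho> \<in> borel_measurable borel" "\<And>x. \<bar>\<rho> x\<bar> \<le> B"
    and M: "0 < M" and m: "maximizer s \<Omega> \<rho> M u"
  shows "(LEAST \<mu>. 0 < \<mu> \<and> borel_eigenvalue s \<Omega> \<rho> \<mu>) = 1 / M"
proof (rule Least_equality)
  show "0 < 1 / M \<and> borel_eigenvalue s \<Omega> \<rho> (1 / M)"
    using M m maximizer_Euler_Lagrange[OF \<rho> m] unfolding borel_eigenvalue_def maximizer_def by auto
  fix \<mu> assume \<mu>: "0 < \<mu> \<and> borel_eigenvalue s \<Omega> \<rho> \<mu>"
  then obtain v where v: "v \<in> W0 s \<Omega>" "\<not> (AE x in lborel. v x = 0)" "energy s v v = \<mu> * weight_form \<rho> v v"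
    unfolding borel_eigenvalue_def by blast
  have "0 < energy s v v" by (rule energy_pos[OF s \<Omega> v(1,2)])
  moreover have "weight_form \<rho> v v \<le> M * energy s v v" using m v(1) unfolding maximizer_def by blast
  then have "\<mu> * weight_form \<rho> v v \<le> \<mu> * (M * energy s v v)" using \<mu> by (intro mult_left_mono) auto
  then have "energy s v v \<le> (\<mu> * M) * energy s v v" using v(3) by (simp add: mult.assoc)
  ultimately have "1 \<le> \<mu> * M" by simp
  then show "1 / M \<le> \<mu>" using M by (simp add: field_simps)
qed

section \<open>Positivity of optimal functions\<close>

text \<open>
The kernel is positive off the diagonal.
\<close>
lemma AE_gagliardo_iff:
  fixes P :: "'b::euclidean_space \<times> 'b \<Rightarrow> bool"
  shows "(AE z in gagliardo s. P z) \<longleftrightarrow> (AE z in lborel. fst z \<noteq> snd z \<longrightarrow> P z)"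
  unfolding gagliardo_def kernel_def by (subst AE_density) (auto intro!: AE_cong simp: zero_less_divide_iff)

lemma null_rectangle:
  fixes A :: "'a::euclidean_space set" and B :: "'b::euclidean_space set"
  assumes [measurable]: "A \<in> sets borel" "B \<in> sets borel"
    and ae: "AE z in lborel. \<not> (fst z \<in> A \<and> snd z \<in> B)"
  shows "emeasure lborel A = 0 \<or> emeasure lborel B = 0"
proof -
  have m: "A \<times> B \<in> sets (lborel \<Otimes>\<^sub>M lborel)" by measurable
  have "AE z in lborel \<Otimes>\<^sub>M lborel. z \<notin> A \<times> B"
    using ae unfolding lborel_prod by eventually_elim auto
  then have "A \<times> B \<in> null_sets (lborel \<Otimes>\<^sub>M lborel)" using m by (subst AE_iff_null_sets) auto
  then have "emeasure lborel A * emeasure lborel B = 0"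
    by (simp add: null_sets_def lborel.emeasure_pair_measure_Times)
  then show ?thesis by simp
qed

text \<open>
The strong maximum principle.  Formally, at a point where \<open>u = 0\<close> the equation reads \<open>0 = (-\<Delta>)\<^sup>s u = - \<integral> u(y) k(x, y) dy\<close>, which is
negative unless \<open>u\<close> vanishes identically.  To make sense of this on the set \<open>{u = 0}\<close>, which need not support any
nonzero function of the energy space, the equation is tested with \<open>\<eta> max(0, 1 - n u)\<close>.  These functions tend to \<open>\<eta> 1\<^bsub>{u = 0}\<^esub>\<close>; the
weighted integral is \<open>O(1/n)\<close> because \<open>u \<le> 1/n\<close> wherever the test function is not zero, and in the energy the part
without an integrable majorant has a sign, so that Fatou's lemma applies to it.
\<close>
theorem maximizer_positive:
  fixes u :: "'b::euclidean_space \<Rightarrow> real"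
  assumes s: "0 < s" "s < 1" and \<Omega>: "open \<Omega>" "bounded \<Omega>"
    and \<rho>: "\<rho> \<in> borel_measurable borel" "\<And>x. \<bar>\<rho> x\<bar> \<le> B"
    and M: "0 < M" and m: "maximizer s \<Omega> \<rho> M u" and u0: "\<And>x. 0 \<le> u x"
  shows "AE x in lborel. x \<in> \<Omega> \<longrightarrow> 0 < u x"
proof -
  note [measurable] = \<rho>(1)
  have [measurable]: "\<Omega> \<in> sets borel" using \<Omega> by auto
  have B: "0 \<le> B" using \<rho>(2)[of undefined] abs_ge_zero[of "\<rho> undefined"] by linarith
  have u: "u \<in> W0 s \<Omega>" and unz: "\<not> (AE x in lborel. u x = 0)" using m by (auto simp: maximizer_def)
  note [measurable] = W0D(1)[OF u]
  let ?\<eta> = "cutoff \<Omega>"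
  have \<eta>: "?\<eta> \<in> W0 s \<Omega>" by (rule cutoff_W0[OF s \<Omega>])
  define w where "w n x = max 0 (1 - real n * u x)" for n :: nat and x
  have w: "0 \<le> w n x" "w n x \<le> 1" for n x using u0[of x] by (auto simp: w_def)
  have [measurable]: "w n \<in> borel_measurable borel" for n unfolding w_def[abs_def] by measurable
  define \<phi> where "\<phi> n x = ?\<eta> x * w n x" for n x
  have [measurable]: "\<phi> n \<in> borel_measurable borel" for n unfolding \<phi>_def[abs_def] by measurable
  have \<phi>: "\<phi> n \<in> W0 s \<Omega>" for n
  proof (rule W0_dominated[OF \<eta> u, where C = "1 + real n"])
    show "\<bar>\<phi> n x\<bar> \<le> (1 + real n) * (\<bar>?\<eta> x\<bar> + \<bar>u x\<bar>)" for x
    proof -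
      have "\<bar>\<phi> n x\<bar> \<le> \<bar>?\<eta> x\<bar> * 1" unfolding \<phi>_def abs_mult using w[of n x] by (intro mult_left_mono) auto
      also have "\<dots> \<le> (1 + real n) * (\<bar>?\<eta> x\<bar> + \<bar>u x\<bar>)" by (simp add: algebra_simps)
      finally show ?thesis .
    qed
    show "\<bar>\<phi> n x - \<phi> n y\<bar> \<le> (1 + real n) * (\<bar>?\<eta> x - ?\<eta> y\<bar> + \<bar>u x - u y\<bar>)" for x y
    proof -
      have "\<phi> n x - \<phi> n y = (?\<eta> x - ?\<eta> y) * w n x + ?\<eta> y * (w n x - w n y)"
        by (simp add: \<phi>_def algebra_simps)
      also have "\<bar>\<dots>\<bar> \<le> \<bar>?\<eta> x - ?\<eta> y\<bar> * \<bar>w n x\<bar> + \<bar>?\<eta> y\<bar> * \<bar>w n x - w n y\<bar>"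
        unfolding abs_mult[symmetric] by (rule abs_triangle_ineq)
      also have "\<dots> \<le> \<bar>?\<eta> x - ?\<eta> y\<bar> * 1 + 1 * \<bar>w n x - w n y\<bar>"
        using w[of n x] cutoff_bounds[of \<Omega> y] by (intro add_mono mult_left_mono mult_right_mono) auto
      also have "\<bar>w n x - w n y\<bar> \<le> real n * \<bar>u x - u y\<bar>"
      proof -
        have "\<bar>w n x - w n y\<bar> \<le> \<bar>real n * u x - real n * u y\<bar>" unfolding w_def by linarith
        then show ?thesis by (simp add: right_diff_distrib[symmetric] abs_mult)
      qed
      finally have "\<bar>\<phi> n x - \<phi> n y\<bar> \<le> \<bar>?\<eta> x - ?\<eta> y\<bar> + real n * \<bar>u x - u y\<bar>" by simp
      also have "\<dots> \<le> (1 + real n) * (\<bar>?\<eta> x - ?\<eta> y\<bar> + \<bar>u x - u y\<bar>)" by (simp add: algebra_simps)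
      finally show ?thesis .
    qed
  qed measurable
  define Z where "Z x = (if u x = 0 then 1 else 0 :: real)" for x
  have [measurable]: "Z \<in> borel_measurable borel" unfolding Z_def[abs_def] by measurable
  have wlim: "(\<lambda>n. w n x) \<longlonglongrightarrow> Z x" for x
  proof (cases "u x = 0")
    case True then show ?thesis by (simp add: w_def Z_def)
  next
    case False
    then have "0 < u x" using u0[of x] by simp
    then obtain N :: nat where N: "1 < real N * u x" using reals_Archimedean3 by blast
    have "\<forall>\<^sub>F n in sequentially. w n x = 0" using eventually_ge_at_top[of N]
    proof eventually_elim
      fix n assume "N \<le> n"
      then have "real N * u x \<le> real n * u x" using u0[of x] by (intro mult_right_mono) auto
      then show "w n x = 0" using N by (simp add: w_def)
    qed
    then show ?thesis using False by (simp add: Z_def tendsto_eventually)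
  qed
  have wf0: "(\<lambda>n. energy s u (\<phi> n)) \<longlonglongrightarrow> 0"
  proof -
    define V where "V = measure lborel \<Omega>"
    have bd: "\<bar>energy s u (\<phi> n)\<bar> \<le> B * V / M * (1 / real n)" if n: "0 < n" for n
    proof -
      have pt: "\<bar>\<rho> x * u x * \<phi> n x\<bar> \<le> (B / real n) * indicator \<Omega> x" for x
      proof (cases "x \<in> \<Omega>")
        case True
        have "u x * w n x \<le> 1 / real n"
        proof (cases "real n * u x \<le> 1")
          case True
          then have "u x \<le> 1 / real n" using n by (simp add: field_simps)
          then show ?thesis using mult_left_le[OF w(2)[of n x] u0[of x]] by linarith
        next
          case False then show ?thesis by (simp add: w_def)
        qed
        moreover have "0 \<le> u x * w n x" using u0 w by simp
        ultimately have "\<bar>?\<eta> x * (u x * w n x)\<bar> \<le> 1 * (1 / real n)"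
          unfolding abs_mult using cutoff_bounds[of \<Omega> x] by (intro mult_mono) auto
        from mult_mono[OF \<rho>(2)[of x] this] B
        show ?thesis using True by (simp add: \<phi>_def abs_mult mult_ac)
      next
        case False then show ?thesis using W0D(2)[OF u] by simp
      qed
      have "\<bar>weight_form \<rho> u (\<phi> n)\<bar> \<le> (\<integral>x. \<bar>\<rho> x * u x * \<phi> n x\<bar> \<partial>lborel)"
        unfolding weight_form_def by (rule integral_abs_bound)
      also have "\<dots> \<le> (\<integral>x. (B / real n) * indicator \<Omega> x \<partial>lborel)"
        using weight_form_integrable[OF \<rho> u \<phi>] emeasure_bounded_finite[OF \<Omega>(2)]
        by (intro integral_mono pt) auto
      also have "\<dots> = B / real n * V" by (simp add: V_def)
      finally have "M * \<bar>energy s u (\<phi> n)\<bar> \<le> B / real n * V"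
        using maximizer_Euler_Lagrange[OF \<rho> m \<phi>, of n] M by (simp add: abs_mult)
      then have "\<bar>energy s u (\<phi> n)\<bar> \<le> (B / real n * V) / M"
        by (subst pos_le_divide_eq[OF M]) (simp add: mult.commute)
      then show ?thesis by (simp add: mult_ac)
    qed
    have "(\<lambda>n. B * V / M * (1 / real n)) \<longlonglongrightarrow> B * V / M * 0"
      by (intro tendsto_intros lim_1_over_n)
    then have "(\<lambda>n. B * V / M * (1 / real n)) \<longlonglongrightarrow> 0" by simp
    then show ?thesis
      by (rule Lim_null_comparison[rotated])
         (use bd in \<open>auto intro: eventually_mono[OF eventually_gt_at_top[of 0]]\<close>)
  qed
  define U where "U z = u (fst z) - u (snd z)" for z :: "'b \<times> 'b"
  define E where "E z = ?\<eta> (fst z) - ?\<eta> (snd z)" for z :: "'b \<times> 'b"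
  define A where "A z = (?\<eta> (fst z) + ?\<eta> (snd z)) / 2" for z :: "'b \<times> 'b"
  have [measurable]: "U \<in> borel_measurable borel" "E \<in> borel_measurable borel" "A \<in> borel_measurable borel"
    unfolding U_def[abs_def] E_def[abs_def] A_def[abs_def] by measurable
  define S where "S n z = U z * E z * ((w n (fst z) + w n (snd z)) / 2)" for n z
  define S' where "S' z = U z * E z * ((Z (fst z) + Z (snd z)) / 2)" for z
  define T where "T n z = A z * (- (U z * (w n (fst z) - w n (snd z))))" for n z
  define T' where "T' z = A z * (- (U z * (Z (fst z) - Z (snd z))))" for z
  have [measurable]: "S n \<in> borel_measurable borel" "T n \<in> borel_measurable borel" for n
    unfolding S_def[abs_def] T_def[abs_def] by measurable
  have [measurable]: "S' \<in> borel_measurable borel" "T' \<in> borel_measurable borel"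
    unfolding S'_def[abs_def] T'_def[abs_def] by measurable
  \<comment> \<open>The increment of the product \<open>\<phi> = \<eta> w\<close> is symmetrized: \<open>S\<close> carries the increment of \<open>\<eta>\<close> and is dominated,
  \<open>T\<close> carries the increment of \<open>w\<close> and is nonnegative, since \<open>w\<close> is a decreasing function of \<open>u\<close>.\<close>
  have decomp: "U z * (\<phi> n (fst z) - \<phi> n (snd z)) = S n z - T n z" for n z
    by (simp add: S_def T_def A_def E_def \<phi>_def field_simps)
  have A0: "0 \<le> A z" for z using cutoff_bounds[of \<Omega>] by (simp add: A_def)
  have T0: "0 \<le> T n z" for n z
  proof -
    have "U z * (w n (fst z) - w n (snd z)) \<le> 0"
    proof (cases "u (fst z) \<le> u (snd z)")
      case True
      then have "real n * u (fst z) \<le> real n * u (snd z)" by (intro mult_left_mono) auto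
      then have "w n (snd z) \<le> w n (fst z)" by (simp add: w_def)
      then show ?thesis using True by (simp add: U_def mult_nonpos_nonneg)
    next
      case False
      then have "real n * u (snd z) \<le> real n * u (fst z)" by (intro mult_left_mono) auto
      then have "w n (fst z) \<le> w n (snd z)" by (simp add: w_def)
      then show ?thesis using False by (simp add: U_def mult_nonneg_nonpos)
    qed
    then show ?thesis unfolding T_def using A0 by (intro mult_nonneg_nonneg) auto
  qed
  have iUE: "integrable (gagliardo s) (\<lambda>z. \<bar>U z * E z\<bar>)"
    using energy_integrable[OF u \<eta>] by (simp add: U_def E_def)
  have Sb: "norm (S n z) \<le> \<bar>U z * E z\<bar>" for n z
  proof -
    have "\<bar>(w n (fst z) + w n (snd z)) / 2\<bar> \<le> 1" using w[of n "fst z"] w[of n "snd z"] by simp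
    then show ?thesis unfolding S_def real_norm_def abs_mult[of "U z * E z"] by (rule mult_left_le) simp
  qed
  have iS: "integrable (gagliardo s) (S n)" for n
    by (rule Bochner_Integration.integrable_bound[OF iUE]) (use Sb in auto)
  have iU: "integrable (gagliardo s) (\<lambda>z. U z * (\<phi> n (fst z) - \<phi> n (snd z)))" for n
    using energy_integrable[OF u \<phi>] by (simp add: U_def)
  have iT: "integrable (gagliardo s) (T n)" for n
  proof -
    have "integrable (gagliardo s) (\<lambda>z. S n z - U z * (\<phi> n (fst z) - \<phi> n (snd z)))"
      by (intro Bochner_Integration.integrable_diff iS iU)
    then show ?thesis by (simp add: decomp)
  qed
  have Slim: "(\<lambda>n. \<integral>z. S n z \<partial>gagliardo s) \<longlonglongrightarrow> (\<integral>z. S' z \<partial>gagliardo s)"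
  proof (rule integral_dominated_convergence[where w = "\<lambda>z. \<bar>U z * E z\<bar>", OF _ _ iUE])
    show "AE z in gagliardo s. (\<lambda>n. S n z) \<longlonglongrightarrow> S' z"
      unfolding S_def S'_def by (intro AE_I2 tendsto_intros wlim) auto
  qed (use Sb in auto)
  have iS': "integrable (gagliardo s) S'"
  proof (rule Bochner_Integration.integrable_bound[OF iUE])
    have "norm (S' z) \<le> \<bar>U z * E z\<bar>" for z
    proof -
      have "\<bar>(Z (fst z) + Z (snd z)) / 2\<bar> \<le> 1" by (simp add: Z_def)
      then show ?thesis unfolding S'_def real_norm_def abs_mult[of "U z * E z"] by (rule mult_left_le) simp
    qed
    then show "AE z in gagliardo s. norm (S' z) \<le> norm \<bar>U z * E z\<bar>" by simp
  qed measurable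
  have formT: "energy s u (\<phi> n) = (\<integral>z. S n z \<partial>gagliardo s) - (\<integral>z. T n z \<partial>gagliardo s)" for n
    unfolding energy_def using decomp[of _ n] iS iT by (simp add: U_def[symmetric])
  have Tlim: "(\<lambda>n. \<integral>z. T n z \<partial>gagliardo s) \<longlonglongrightarrow> (\<integral>z. S' z \<partial>gagliardo s)"
    using tendsto_diff[OF Slim wf0] by (simp add: formT)
  have T'0: "0 \<le> T' z" for z
  proof (rule LIMSEQ_le_const)
    show "(\<lambda>n. T n z) \<longlonglongrightarrow> T' z" unfolding T_def T'_def by (intro tendsto_intros wlim)
  qed (use T0 in auto)
  have "(\<integral>\<^sup>+z. ennreal (T' z) \<partial>gagliardo s) = (\<integral>\<^sup>+z. liminf (\<lambda>n. ennreal (T n z)) \<partial>gagliardo s)"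
  proof (rule nn_integral_cong)
    fix z
    have "(\<lambda>n. ennreal (T n z)) \<longlonglongrightarrow> ennreal (T' z)"
      unfolding T_def T'_def by (intro tendsto_ennrealI tendsto_intros wlim)
    then show "ennreal (T' z) = liminf (\<lambda>n. ennreal (T n z))" by (intro lim_imp_Liminf[symmetric]) auto
  qed
  also have "\<dots> \<le> liminf (\<lambda>n. \<integral>\<^sup>+z. ennreal (T n z) \<partial>gagliardo s)"
    by (rule nn_integral_liminf) measurable
  also have "\<dots> = liminf (\<lambda>n. ennreal (\<integral>z. T n z \<partial>gagliardo s))"
    using iT T0 by (simp add: nn_integral_eq_integral)
  also have "\<dots> = ennreal (\<integral>z. S' z \<partial>gagliardo s)"
    by (intro lim_imp_Liminf tendsto_ennrealI Tlim) simp
  finally have T'le: "(\<integral>\<^sup>+z. ennreal (T' z) \<partial>gagliardo s) \<le> ennreal (\<integral>z. S' z \<partial>gagliardo s)" .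
  have iT': "integrable (gagliardo s) T'"
    using T'le T'0 by (intro integrableI_nonneg) (auto intro: le_less_trans)
  have S'0: "0 \<le> (\<integral>z. S' z \<partial>gagliardo s)"
    by (rule LIMSEQ_le_const[OF Tlim]) (use T0 in \<open>auto intro!: integral_nonneg\<close>)
  have "ennreal (\<integral>z. T' z \<partial>gagliardo s) \<le> ennreal (\<integral>z. S' z \<partial>gagliardo s)"
    using T'le iT' T'0 by (simp add: nn_integral_eq_integral)
  then have le: "(\<integral>z. T' z \<partial>gagliardo s) \<le> (\<integral>z. S' z \<partial>gagliardo s)" using S'0 by simp
  have D: "T' z - S' z = - (U z * (?\<eta> (fst z) * Z (fst z) - ?\<eta> (snd z) * Z (snd z)))" for z
    by (simp add: S'_def T'_def A_def E_def field_simps)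
  \<comment> \<open>The limit integrand is \<open>\<eta>(x) u(y)\<close> on pairs with \<open>u(x) = 0 < u(y)\<close>, its mirror image with \<open>x, y\<close> exchanged, and \<open>0\<close> elsewhere.\<close>
  have Dpos: "0 \<le> T' z - S' z" for z
    unfolding D using cutoff_bounds[of \<Omega>] u0 by (auto simp: U_def Z_def intro!: mult_nonneg_nonneg)
  have "(\<integral>z. T' z - S' z \<partial>gagliardo s) = 0"
  proof (rule antisym)
    show "0 \<le> (\<integral>z. T' z - S' z \<partial>gagliardo s)" by (rule Bochner_Integration.integral_nonneg[OF Dpos])
  qed (use le iT' iS' in simp)
  then have "AE z in gagliardo s. T' z - S' z = 0"
    using iT' iS' Dpos by (subst (asm) integral_nonneg_eq_0_iff_AE) auto
  then have ae: "AE z in lborel. fst z \<noteq> snd z \<longrightarrow> T' z - S' z = 0" by (simp only: AE_gagliardo_iff)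
  define P where "P = {x \<in> \<Omega>. u x = 0}"
  define Q where "Q = {x. 0 < u x}"
  have [measurable]: "P \<in> sets borel" "Q \<in> sets borel" unfolding P_def Q_def by measurable
  have "AE z in lborel. \<not> (fst z \<in> P \<and> snd z \<in> Q)"
    using ae
  proof eventually_elim
    fix z assume z: "fst z \<noteq> snd z \<longrightarrow> T' z - S' z = 0"
    show "\<not> (fst z \<in> P \<and> snd z \<in> Q)"
    proof
      assume *: "fst z \<in> P \<and> snd z \<in> Q"
      then have "fst z \<noteq> snd z" by (auto simp: P_def Q_def)
      then have "T' z - S' z = 0" using z by simp
      then have "u (snd z) * ?\<eta> (fst z) = 0" using * unfolding D by (simp add: U_def Z_def P_def Q_def)
      moreover have "0 < ?\<eta> (fst z)" using * cutoff_pos[OF \<Omega>] by (simp add: P_def)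
      ultimately show False using * by (simp add: Q_def)
    qed
  qed
  then have "emeasure lborel P = 0 \<or> emeasure lborel Q = 0" by (intro null_rectangle) auto
  moreover have "emeasure lborel Q \<noteq> 0"
  proof
    assume "emeasure lborel Q = 0"
    then have "AE x in lborel. u x = 0"
      using u0 by (intro AE_I'[of Q]) (auto simp: null_sets_def Q_def less_le)
    with unz show False ..
  qed
  ultimately have "P \<in> null_sets lborel" by (auto simp: null_sets_def)
  then show ?thesis
    using u0 by (intro AE_I'[of P]) (auto simp: P_def less_le)
qed

section \<open>Reflections and polarization\<close>

definition mirror :: "real \<Rightarrow> real \<times> 'a \<Rightarrow> real \<times> 'a" where
  "mirror a x = (2 * a - fst x, snd x)"

lemma mirror_mirror [simp]: "mirror a (mirror a x) = x"
  by (simp add: mirror_def)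

lemma measurable_mirror [measurable]:
  "mirror a \<in> borel_measurable (borel :: (real \<times> 'a::euclidean_space) measure)"
  unfolding mirror_def[abs_def] by (intro borel_measurable_continuous_onI continuous_intros)

lemma norm_mirror_diff: "norm (mirror a x - mirror a y) = norm (x - y)"
  for x y :: "real \<times> 'a::euclidean_space"
  by (simp add: mirror_def norm_prod_def power2_commute minus_diff_commute abs_minus_commute)

lemma norm_mirror_right: "norm (mirror a x - y) = norm (x - mirror a y)"
  for x y :: "real \<times> 'a::euclidean_space"
  using norm_mirror_diff[of a x "mirror a y"] by simp

lemma distr_map_prod:
  fixes f :: "'a::euclidean_space \<Rightarrow> 'a" and g :: "'b::euclidean_space \<Rightarrow> 'b"
  assumes [measurable]: "f \<in> borel_measurable borel" "g \<in> borel_measurable borel"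
    and f: "distr lborel borel f = lborel" and g: "distr lborel borel g = lborel"
  shows "distr lborel borel (\<lambda>z. (f (fst z), g (snd z))) = lborel"
proof -
  have g': "sigma_finite_measure (distr lborel borel g)" unfolding g by (rule lborel.sigma_finite_measure_axioms)
  have "distr lborel borel f \<Otimes>\<^sub>M distr lborel borel g
     = distr (lborel \<Otimes>\<^sub>M lborel) (borel \<Otimes>\<^sub>M borel) (\<lambda>(x, y). (f x, g y))"
    by (rule pair_measure_distr[OF _ _ g']) measurable
  then show ?thesis unfolding f g
    by (simp add: lborel_prod borel_prod case_prod_beta')
qed

lemma distr_mirror: "distr lborel borel (mirror a) = (lborel :: (real \<times> 'a::euclidean_space) measure)"
proof -
  have "distr lborel borel (\<lambda>t::real. 2 * a - t) = lborel"
  proof -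
    have "distr (distr lborel borel uminus) borel ((+) (2 * a)) = (lborel :: real measure)"
      unfolding lborel_distr_uminus by (rule lborel_distr_plus)
    then show ?thesis by (simp add: distr_distr o_def)
  qed
  moreover have "distr lborel borel (\<lambda>x. x) = (lborel :: 'a measure)" by (simp add: distr_id2)
  ultimately have "distr lborel borel (\<lambda>z. (2 * a - fst z, snd z)) = (lborel :: (real \<times> 'a) measure)"
    using distr_map_prod[of "\<lambda>t. 2 * a - t" "\<lambda>x :: 'a. x"] by simp
  then show ?thesis by (simp add: mirror_def[abs_def])
qed

lemma integral_mirror:
  fixes f :: "real \<times> 'a::euclidean_space \<Rightarrow> real"
  assumes [measurable]: "f \<in> borel_measurable borel"
  shows "integrable lborel (\<lambda>x. f (mirror a x)) \<longleftrightarrow> integrable lborel f"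
    "(\<integral>x. f (mirror a x) \<partial>lborel) = (\<integral>x. f x \<partial>lborel)"
proof -
  show "integrable lborel (\<lambda>x. f (mirror a x)) \<longleftrightarrow> integrable lborel f"
    by (subst (2) distr_mirror[of a, symmetric]) (simp add: integrable_distr_eq)
  show "(\<integral>x. f (mirror a x) \<partial>lborel) = (\<integral>x. f x \<partial>lborel)"
    by (subst (2) distr_mirror[of a, symmetric]) (simp add: integral_distr)
qed

lemma AE_mirror:
  assumes "AE x in (lborel :: (real \<times> 'a::euclidean_space) measure). P x"
  shows "AE x in lborel. P (mirror a x)"
proof -
  have "AE x in distr lborel borel (mirror a). P x" unfolding distr_mirror by (rule assms)
  then show ?thesis by (rule AE_distrD[rotated]) measurable
qed

text \<open>
For \<open>a \<noteq> 0\<close>, the open side of \<open>{x\<^sub>1 = a}\<close> that contains the origin; multiplying by \<open>a\<close> treats both signs at once.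
\<close>
definition halfspace :: "real \<Rightarrow> (real \<times> 'a) set" where
  "halfspace a = {x. a * fst x < a\<^sup>2}"

definition polarize :: "real \<Rightarrow> (real \<times> 'a \<Rightarrow> real) \<Rightarrow> real \<times> 'a \<Rightarrow> real" where
  "polarize a u x = (if x \<in> halfspace a then max (u x) (u (mirror a x)) else min (u x) (u (mirror a x)))"

lemma halfspace_borel [measurable]: "halfspace a \<in> sets (borel :: (real \<times> 'a::euclidean_space) measure)"
  unfolding halfspace_def by measurable

lemma mirror_halfspace: "a \<noteq> 0 \<Longrightarrow> mirror a x \<in> halfspace a \<longleftrightarrow> a * fst x > a\<^sup>2"
  by (auto simp: halfspace_def mirror_def power2_eq_square algebra_simps)

lemma not_halfspace_mirror: "x \<notin> halfspace a \<Longrightarrow> mirror a x \<notin> halfspace a \<Longrightarrow> a \<noteq> 0 \<Longrightarrow> mirror a x = x"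
proof -
  assume "x \<notin> halfspace a" "mirror a x \<notin> halfspace a" "a \<noteq> 0"
  then have "a * fst x = a * a" by (auto simp: mirror_halfspace power2_eq_square) (simp add: halfspace_def power2_eq_square)
  then have "fst x = a" using \<open>a \<noteq> 0\<close> by simp
  then show ?thesis by (simp add: mirror_def prod_eq_iff)
qed

lemma polarize_mirror:
  assumes "a \<noteq> 0"
  shows "polarize a u (mirror a x) = (if x \<in> halfspace a then min (u x) (u (mirror a x)) else max (u x) (u (mirror a x)))"
proof (cases "x \<in> halfspace a")
  case True
  then have "mirror a x \<notin> halfspace a" using assms by (auto simp: mirror_halfspace) (simp add: halfspace_def)
  then show ?thesis using True by (simp add: polarize_def min.commute)
next
  case False
  then show ?thesis using not_halfspace_mirror[OF False _ assms] by (auto simp: polarize_def max.commute)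
qed

lemma measurable_polarize [measurable]:
  assumes [measurable]: "u \<in> borel_measurable borel"
  shows "polarize a u \<in> borel_measurable (borel :: (real \<times> 'a::euclidean_space) measure)"
  unfolding polarize_def[abs_def] by measurable

text \<open>
The difference of the two squared distances is \<open>4 (x\<^sub>1 - a) (y\<^sub>1 - a)\<close>.
\<close>
lemma norm_halfspace:
  fixes x y :: "real \<times> 'a::euclidean_space"
  assumes "a \<noteq> 0"
  shows "x \<in> halfspace a \<Longrightarrow> y \<in> halfspace a \<Longrightarrow> norm (x - y) < norm (x - mirror a y)"
    "x \<notin> halfspace a \<Longrightarrow> y \<notin> halfspace a \<Longrightarrow> norm (x - y) \<le> norm (x - mirror a y)"
    "x \<in> halfspace a \<Longrightarrow> y \<notin> halfspace a \<Longrightarrow> norm (x - mirror a y) \<le> norm (x - y)"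
    "x \<notin> halfspace a \<Longrightarrow> y \<in> halfspace a \<Longrightarrow> norm (x - mirror a y) \<le> norm (x - y)"
proof -
  have n: "(norm (x - z))\<^sup>2 = (fst x - fst z)\<^sup>2 + (norm (snd x - snd z))\<^sup>2" for z
    by (simp add: norm_prod_def)
  have d: "a\<^sup>2 * ((norm (x - mirror a y))\<^sup>2 - (norm (x - y))\<^sup>2) = 4 * ((a * fst x - a\<^sup>2) * (a * fst y - a\<^sup>2))"
    unfolding n by (simp add: mirror_def power2_eq_square algebra_simps)
  have a2: "0 < a\<^sup>2" using assms by simp
  have lt: "norm p < norm q" if "0 < a\<^sup>2 * ((norm q)\<^sup>2 - (norm p)\<^sup>2)" for p q :: "real \<times> 'a"
  proof -
    have "(norm p)\<^sup>2 < (norm q)\<^sup>2" using that a2 by (simp add: zero_less_mult_iff)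
    then show ?thesis by (rule power_less_imp_less_base) simp
  qed
  have le: "norm p \<le> norm q" if "0 \<le> a\<^sup>2 * ((norm q)\<^sup>2 - (norm p)\<^sup>2)" for p q :: "real \<times> 'a"
  proof -
    have "(norm p)\<^sup>2 \<le> (norm q)\<^sup>2" using that a2 by (simp add: zero_le_mult_iff)
    then show ?thesis by (rule power2_le_imp_le) simp
  qed
  have d': "a\<^sup>2 * ((norm (x - y))\<^sup>2 - (norm (x - mirror a y))\<^sup>2) = - (4 * ((a * fst x - a\<^sup>2) * (a * fst y - a\<^sup>2)))"
    using d by (simp add: algebra_simps)
  show "norm (x - y) < norm (x - mirror a y)" if "x \<in> halfspace a" "y \<in> halfspace a"
    by (rule lt, unfold d) (use that in \<open>simp add: halfspace_def mult_neg_neg\<close>)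
  show "norm (x - y) \<le> norm (x - mirror a y)" if "x \<notin> halfspace a" "y \<notin> halfspace a"
    by (rule le, unfold d) (use that in \<open>simp add: halfspace_def\<close>)
  show "norm (x - mirror a y) \<le> norm (x - y)" if "x \<in> halfspace a" "y \<notin> halfspace a"
    by (rule le, unfold d') (use that in \<open>simp add: halfspace_def mult_nonpos_nonneg\<close>)
  show "norm (x - mirror a y) \<le> norm (x - y)" if "x \<notin> halfspace a" "y \<in> halfspace a"
    by (rule le, unfold d') (use that in \<open>simp add: halfspace_def mult_nonneg_nonpos\<close>)
qed

section \<open>Polarization decreases the energy\<close>

lemma kernel_nonneg: "0 \<le> kernel s x y" by (simp add: kernel_def)

lemma kernel_mono:
  fixes x y z :: "'b::euclidean_space"
  assumes "0 < s" "x \<noteq> y" "norm (x - y) \<le> norm (x - z)"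
  shows "kernel s x z \<le> kernel s x y"
  unfolding kernel_def using assms by (intro frac_le powr_mono2) auto

lemma kernel_strict_mono:
  fixes x y z :: "'b::euclidean_space"
  assumes "0 < s" "x \<noteq> y" "norm (x - y) < norm (x - z)"
  shows "kernel s x z < kernel s x y"
  unfolding kernel_def using assms
  by (intro divide_strict_left_mono powr_less_mono2 mult_pos_pos) (auto simp: add_pos_pos powr_gt_zero)

lemma kernel_mirror_mirror: "kernel s (mirror a x) (mirror a y) = kernel s x y"
  and kernel_mirror_left: "kernel s (mirror a x) y = kernel s x (mirror a y)"
  for x y :: "real \<times> 'a::euclidean_space"
  by (simp_all add: kernel_def norm_mirror_diff norm_mirror_right)

lemma measurable_kernel [measurable]:
  "(\<lambda>z. kernel s (fst z) (snd z)) \<in> borel_measurable (borel :: ('b::euclidean_space \<times> 'b) measure)"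
  unfolding kernel_def by measurable

lemma gagliardo_lborel:
  fixes f :: "'b::euclidean_space \<times> 'b \<Rightarrow> real"
  assumes [measurable]: "f \<in> borel_measurable borel"
  shows "integrable (gagliardo s) f \<longleftrightarrow> integrable lborel (\<lambda>z. kernel s (fst z) (snd z) * f z)"
    "(\<integral>z. f z \<partial>gagliardo s) = (\<integral>z. kernel s (fst z) (snd z) * f z \<partial>lborel)"
  unfolding gagliardo_def kernel_def by (simp_all add: integrable_density integral_density)

definition energy_density :: "real \<Rightarrow> ('b::euclidean_space \<Rightarrow> real) \<Rightarrow> 'b \<times> 'b \<Rightarrow> real" where
  "energy_density s u z = kernel s (fst z) (snd z) * (u (fst z) - u (snd z))\<^sup>2"

text \<open>
The sum of the energy density over the four pairs formed from \<open>x, \<sigma> x\<close> and \<open>y, \<sigma> y\<close>.  Polarization acts on such a group of four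
pairs at a time, and reflecting either variable preserves the measure, so the sum has four times the integral.
\<close>
definition sym_density :: "real \<Rightarrow> real \<Rightarrow> (real \<times> 'a::euclidean_space \<Rightarrow> real) \<Rightarrow> (real \<times> 'a) \<times> (real \<times> 'a) \<Rightarrow> real" where
  "sym_density s a u z = energy_density s u z + energy_density s u (mirror a (fst z), mirror a (snd z))
     + energy_density s u (mirror a (fst z), snd z) + energy_density s u (fst z, mirror a (snd z))"

lemma measurable_energy_density [measurable]:
  assumes [measurable]: "u \<in> borel_measurable borel"
  shows "energy_density s u \<in> borel_measurable borel"
  unfolding energy_density_def[abs_def] by measurable

lemma integral_map_prod:
  fixes F :: "'b::euclidean_space \<times> 'c::euclidean_space \<Rightarrow> real" and f :: "'b \<Rightarrow> 'b" and g :: "'c \<Rightarrow> 'c"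
  assumes [measurable]: "F \<in> borel_measurable borel" and [measurable]: "f \<in> borel_measurable borel" "g \<in> borel_measurable borel"
    and f: "distr lborel borel f = lborel" and g: "distr lborel borel g = lborel"
  shows "integrable lborel (\<lambda>z. F (f (fst z), g (snd z))) \<longleftrightarrow> integrable lborel F"
    "(\<integral>z. F (f (fst z), g (snd z)) \<partial>lborel) = (\<integral>z. F z \<partial>lborel)"
proof -
  have [measurable]: "(\<lambda>z. (f (fst z), g (snd z))) \<in> borel_measurable borel" by measurable
  note d = distr_map_prod[of f g, OF _ _ f g]
  show "integrable lborel (\<lambda>z. F (f (fst z), g (snd z))) \<longleftrightarrow> integrable lborel F"
    by (subst (2) d[symmetric]) (simp_all add: integrable_distr_eq)
  show "(\<integral>z. F (f (fst z), g (snd z)) \<partial>lborel) = (\<integral>z. F z \<partial>lborel)"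
    by (subst (2) d[symmetric]) (simp_all add: integral_distr)
qed

lemma sym_density_integral:
  fixes u :: "real \<times> 'a::euclidean_space \<Rightarrow> real"
  assumes [measurable]: "u \<in> borel_measurable borel"
  shows "integrable lborel (energy_density s u) \<Longrightarrow> integrable lborel (sym_density s a u)"
    "integrable lborel (energy_density s u) \<Longrightarrow> (\<integral>z. sym_density s a u z \<partial>lborel) = 4 * (\<integral>z. energy_density s u z \<partial>lborel)"
proof -
  assume i: "integrable lborel (energy_density s u)"
  note r = distr_mirror[of a, where 'a = 'a]
  have id: "distr lborel borel (\<lambda>x. x) = (lborel :: (real \<times> 'a) measure)" by (simp add: distr_id2)
  have m: "energy_density s u \<in> borel_measurable borel" by measurable
  have im: "(\<lambda>x. x) \<in> borel_measurable (borel :: (real \<times> 'a) measure)" by simp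
  note 1 = integral_map_prod[OF m measurable_mirror measurable_mirror r r]
  note 2 = integral_map_prod[OF m measurable_mirror im r id, simplified]
  note 3 = integral_map_prod[OF m im measurable_mirror id r, simplified]
  show "integrable lborel (sym_density s a u)"
    unfolding sym_density_def[abs_def] using i 1(1) 2(1) 3(1) by (intro Bochner_Integration.integrable_add) auto
  show "(\<integral>z. sym_density s a u z \<partial>lborel) = 4 * (\<integral>z. energy_density s u z \<partial>lborel)"
    unfolding sym_density_def using i 1 2 3 by simp
qed

lemma sym_density_eq:
  fixes u :: "real \<times> 'a::euclidean_space \<Rightarrow> real"
  shows "sym_density s a u (x, y) =
    kernel s x y * ((u x - u y)\<^sup>2 + (u (mirror a x) - u (mirror a y))\<^sup>2)
    + kernel s x (mirror a y) * ((u x - u (mirror a y))\<^sup>2 + (u (mirror a x) - u y)\<^sup>2)"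
  by (simp add: sym_density_def energy_density_def kernel_mirror_mirror kernel_mirror_left algebra_simps)

text \<open>
Ordering both pairs of numbers the same way picks the smaller of the two possible sums of squares, ordering
them oppositely picks the larger.
\<close>
lemma two_point:
  fixes a b c d k l :: real
  defines "P \<equiv> (a - c)\<^sup>2 + (b - d)\<^sup>2" and "R \<equiv> (a - d)\<^sup>2 + (b - c)\<^sup>2"
  shows "(max a b - max c d)\<^sup>2 + (min a b - min c d)\<^sup>2 = min P R"
    "(max a b - min c d)\<^sup>2 + (min a b - max c d)\<^sup>2 = max P R"
    "P - R = - 2 * ((a - b) * (c - d))"
proof -
  show e: "P - R = - 2 * ((a - b) * (c - d))" by (simp add: P_def R_def power2_eq_square algebra_simps)
  have "P \<le> R" if "0 \<le> (a - b) * (c - d)" using e that by linarith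
  moreover have "R \<le> P" if "(a - b) * (c - d) \<le> 0" using e that by linarith
  ultimately have c: "a \<le> b \<and> c \<le> d \<or> b \<le> a \<and> d \<le> c \<Longrightarrow> P \<le> R"
    "a \<le> b \<and> d \<le> c \<or> b \<le> a \<and> c \<le> d \<Longrightarrow> R \<le> P"
    by (auto simp: mult_nonpos_nonpos mult_nonneg_nonpos mult_nonpos_nonneg)
  consider "a \<le> b" "c \<le> d" | "b \<le> a" "d \<le> c" | "a \<le> b" "d \<le> c" | "b \<le> a" "c \<le> d" by linarith
  then show "(max a b - max c d)\<^sup>2 + (min a b - min c d)\<^sup>2 = min P R"
    by cases (use c in \<open>simp_all add: max_absorb1 max_absorb2 min_absorb1 min_absorb2\<close>, simp_all add: P_def R_def power2_commute)
  consider "a \<le> b" "c \<le> d" | "b \<le> a" "d \<le> c" | "a \<le> b" "d \<le> c" | "b \<le> a" "c \<le> d" by linarith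
  then show "(max a b - min c d)\<^sup>2 + (min a b - max c d)\<^sup>2 = max P R"
    by cases (use c in \<open>simp_all add: max_absorb1 max_absorb2 min_absorb1 min_absorb2\<close>, simp_all add: P_def R_def power2_commute)
qed

text \<open>
The sums of squares for the two pairings of \<open>u(x), u(\<sigma> x)\<close> with \<open>u(y), u(\<sigma> y)\<close> are \<open>P\<close> and \<open>R\<close>; polarization can
only swap them.
\<close>
lemma sym_density_polarize_cases:
  fixes u :: "real \<times> 'a::euclidean_space \<Rightarrow> real"
  assumes a: "a \<noteq> 0"
  defines "P x y \<equiv> (u x - u y)\<^sup>2 + (u (mirror a x) - u (mirror a y))\<^sup>2"
    and "R x y \<equiv> (u x - u (mirror a y))\<^sup>2 + (u (mirror a x) - u y)\<^sup>2"
  shows "sym_density s a (polarize a u) (x, y) =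
    (if x \<in> halfspace a \<longleftrightarrow> y \<in> halfspace a
     then kernel s x y * min (P x y) (R x y) + kernel s x (mirror a y) * max (P x y) (R x y)
     else kernel s x y * max (P x y) (R x y) + kernel s x (mirror a y) * min (P x y) (R x y))"
proof -
  have 1: "min (P x y) (R x y) = (max (u x) (u (mirror a x)) - max (u y) (u (mirror a y)))\<^sup>2
      + (min (u x) (u (mirror a x)) - min (u y) (u (mirror a y)))\<^sup>2"
    unfolding P_def R_def by (rule two_point(1)[symmetric])
  have 2: "max (P x y) (R x y) = (max (u x) (u (mirror a x)) - min (u y) (u (mirror a y)))\<^sup>2
      + (min (u x) (u (mirror a x)) - max (u y) (u (mirror a y)))\<^sup>2"
    unfolding P_def R_def by (rule two_point(2)[symmetric])
  show ?thesis unfolding sym_density_eq 1 2 polarize_mirror[OF a]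
    by (auto simp: polarize_def add.commute)
qed

text \<open>
Polarization gives the larger of the two kernel values the smaller of the two sums of squares.
\<close>
lemma sym_density_polarize_le:
  fixes u :: "real \<times> 'a::euclidean_space \<Rightarrow> real"
  assumes s: "0 < s" and a: "a \<noteq> 0"
  shows "sym_density s a (polarize a u) z \<le> sym_density s a u z"
proof -
  obtain x y where z: "z = (x, y)" by (cases z)
  define P where "P = (u x - u y)\<^sup>2 + (u (mirror a x) - u (mirror a y))\<^sup>2"
  define R where "R = (u x - u (mirror a y))\<^sup>2 + (u (mirror a x) - u y)\<^sup>2"
  define k where "k = kernel s x y"
  define l where "l = kernel s x (mirror a y)"
  have same: "k * min P R + l * max P R \<le> k * P + l * R" if "l \<le> k \<or> P \<le> R"
  proof (cases "P \<le> R")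
    case False
    then have "l \<le> k" "R \<le> P" using that by auto
    then have "0 \<le> (k - l) * (P - R)" by simp
    then show ?thesis using \<open>R \<le> P\<close> by (simp add: min_absorb2 max_absorb1 algebra_simps)
  qed (simp add: min_absorb1 max_absorb2)
  have opp: "k * max P R + l * min P R \<le> k * P + l * R" if "k \<le> l \<or> R \<le> P"
  proof (cases "R \<le> P")
    case False
    then have "k \<le> l" "P \<le> R" using that by auto
    then have "0 \<le> (l - k) * (R - P)" by simp
    then show ?thesis using \<open>P \<le> R\<close> by (simp add: min_absorb1 max_absorb2 algebra_simps)
  qed (simp add: min_absorb2 max_absorb1)
  have P0: "0 \<le> P" "0 \<le> R" by (simp_all add: P_def R_def)
  have "sym_density s a (polarize a u) z = (if x \<in> halfspace a \<longleftrightarrow> y \<in> halfspace a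
     then k * min P R + l * max P R else k * max P R + l * min P R)"
    unfolding z sym_density_polarize_cases[OF a] P_def R_def k_def l_def by simp
  moreover have "sym_density s a u z = k * P + l * R"
    unfolding z sym_density_eq P_def R_def k_def l_def by simp
  \<comment> \<open>The kernel vanishes on its diagonal by convention, which spoils its monotonicity for \<open>x = y\<close>; there \<open>P = 0\<close>.\<close>
  moreover have "l \<le> k \<or> P \<le> R" if "x \<in> halfspace a \<longleftrightarrow> y \<in> halfspace a"
  proof (cases "x = y")
    case True then show ?thesis using P0 by (simp add: P_def)
  next
    case False
    have "norm (x - y) \<le> norm (x - mirror a y)"
      using that norm_halfspace(1,2)[OF a, of x y] by (cases "x \<in> halfspace a") (auto intro: less_imp_le)
    then show ?thesis unfolding k_def l_def using kernel_mono[OF s False] by blast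
  qed
  \<comment> \<open>Likewise \<open>R = 0\<close> if \<open>x\<close> is the mirror image of \<open>y\<close>.\<close>
  moreover have "k \<le> l \<or> R \<le> P" if "\<not> (x \<in> halfspace a \<longleftrightarrow> y \<in> halfspace a)"
  proof (cases "x = mirror a y")
    case True then show ?thesis using P0 by (simp add: R_def)
  next
    case False
    have "norm (x - mirror a y) \<le> norm (x - y)"
      using that norm_halfspace(3,4)[OF a, of x y] by (cases "x \<in> halfspace a") auto
    then show ?thesis unfolding k_def l_def using kernel_mono[OF s False] by blast
  qed
  ultimately show ?thesis using same opp by simp
qed

text \<open>
Within the open half-space the two kernel values differ strictly, so swapping the two sums changes the total.
\<close>
lemma sym_density_polarize_eqD:
  fixes u :: "real \<times> 'a::euclidean_space \<Rightarrow> real"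
  assumes s: "0 < s" and a: "a \<noteq> 0" and xy: "x \<in> halfspace a" "y \<in> halfspace a" "x \<noteq> y"
    and eq: "sym_density s a (polarize a u) (x, y) = sym_density s a u (x, y)"
  shows "0 \<le> (u x - u (mirror a x)) * (u y - u (mirror a y))"
proof (rule ccontr)
  assume neg: "\<not> ?thesis"
  define P where "P = (u x - u y)\<^sup>2 + (u (mirror a x) - u (mirror a y))\<^sup>2"
  define R where "R = (u x - u (mirror a y))\<^sup>2 + (u (mirror a x) - u y)\<^sup>2"
  have lt: "R < P" using two_point(3)[of "u x" "u y" "u (mirror a x)" "u (mirror a y)"] neg
    unfolding P_def R_def by linarith
  have k: "kernel s x (mirror a y) < kernel s x y"
    by (rule kernel_strict_mono[OF s xy(3) norm_halfspace(1)[OF a xy(1,2)]])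
  have "kernel s x y * min P R + kernel s x (mirror a y) * max P R = kernel s x y * P + kernel s x (mirror a y) * R"
    using eq unfolding sym_density_polarize_cases[OF a] sym_density_eq[of s a u] P_def R_def using xy by simp
  then have "(kernel s x y - kernel s x (mirror a y)) * (P - R) = 0"
    using lt by (simp add: min_absorb2 max_absorb1 algebra_simps)
  then show False using k lt by simp
qed

definition foldable :: "real \<Rightarrow> (real \<times> 'a) set \<Rightarrow> bool" where
  "foldable a \<Omega> \<longleftrightarrow> (\<forall>x\<in>\<Omega>. x \<notin> halfspace a \<longrightarrow> mirror a x \<in> \<Omega>)"

lemma W0_energy_density: "u \<in> W0 s \<Omega> \<Longrightarrow> integrable lborel (energy_density s u)"
  and energy_eq_density_integral: "u \<in> W0 s \<Omega> \<Longrightarrow> energy s u u = (\<integral>z. energy_density s u z \<partial>lborel)"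
proof -
  assume u: "u \<in> W0 s \<Omega>"
  note [measurable] = W0D(1)[OF u]
  have [measurable]: "(\<lambda>z. (u (fst z) - u (snd z))\<^sup>2) \<in> borel_measurable borel" by measurable
  show "integrable lborel (energy_density s u)" "energy s u u = (\<integral>z. energy_density s u z \<partial>lborel)"
    unfolding energy_self energy_density_def[abs_def] using W0D(4)[OF u] by (simp_all add: gagliardo_lborel)
qed

text \<open>
The same condition seen from outside: it makes the polarization of a nonnegative function vanish off \<open>\<Omega>\<close>.
\<close>
lemma foldable_outside:
  assumes a: "a \<noteq> 0" and fold: "foldable a \<Omega>" and x: "x \<notin> \<Omega>" "x \<in> halfspace a"
  shows "mirror a x \<notin> \<Omega>"
proof
  assume "mirror a x \<in> \<Omega>"
  moreover have "mirror a x \<notin> halfspace a" using x(2) by (simp add: mirror_halfspace[OF a]) (simp add: halfspace_def)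
  ultimately show False using fold x(1) unfolding foldable_def by fastforce
qed

lemma polarize_W0:
  fixes u :: "real \<times> 'a::euclidean_space \<Rightarrow> real"
  assumes s: "0 < s" and a: "a \<noteq> 0" and fold: "foldable a \<Omega>"
    and u: "u \<in> W0 s \<Omega>" and u0: "\<And>x. 0 \<le> u x"
  shows "polarize a u \<in> W0 s \<Omega>"
proof -
  note [measurable] = W0D(1)[OF u]
  show ?thesis unfolding W0_def
  proof (intro CollectI conjI allI impI)
    fix x assume x: "x \<notin> \<Omega>"
    show "polarize a u x = 0"
    proof (cases "x \<in> halfspace a")
      case True
      then show ?thesis using W0D(2)[OF u] x foldable_outside[OF a fold x True] by (simp add: polarize_def)
    next
      case False
      then show ?thesis using W0D(2)[OF u x] u0[of "mirror a x"] by (simp add: polarize_def)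
    qed
  next
    show "integrable lborel (\<lambda>x. (polarize a u x)\<^sup>2)"
    proof (rule Bochner_Integration.integrable_bound)
      show "integrable lborel (\<lambda>x. (u x)\<^sup>2 + (u (mirror a x))\<^sup>2)"
        using W0D(3)[OF u] integral_mirror(1)[of "\<lambda>x. (u x)\<^sup>2" a] by simp
      show "AE x in lborel. norm ((polarize a u x)\<^sup>2) \<le> norm ((u x)\<^sup>2 + (u (mirror a x))\<^sup>2)"
        by (simp add: polarize_def max_def min_def)
    qed measurable
    have "integrable lborel (energy_density s (polarize a u))"
    proof (rule Bochner_Integration.integrable_bound[OF sym_density_integral(1)[OF _ W0_energy_density[OF u], of a]])
      have nn: "0 \<le> energy_density s v z" for v :: "real \<times> 'a \<Rightarrow> real" and z by (simp add: energy_density_def kernel_nonneg)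
      have "energy_density s (polarize a u) z \<le> sym_density s a (polarize a u) z" for z
        unfolding sym_density_def using nn[of "polarize a u"] by (simp add: add.assoc)
      then have "norm (energy_density s (polarize a u) z) \<le> norm (sym_density s a u z)" for z
        using sym_density_polarize_le[OF s a, of u z] nn[of "polarize a u" z] by (smt (verit) real_norm_def)
      then show "AE z in lborel. norm (energy_density s (polarize a u) z) \<le> norm (sym_density s a u z)" by simp
    qed measurable
    then show "integrable (gagliardo s) (\<lambda>z. (polarize a u (fst z) - polarize a u (snd z))\<^sup>2)"
      by (subst gagliardo_lborel) (simp_all add: energy_density_def[abs_def])
  qed measurable
qed

lemma energy_polarize_le:
  fixes u :: "real \<times> 'a::euclidean_space \<Rightarrow> real"
  assumes s: "0 < s" and a: "a \<noteq> 0" and fold: "foldable a \<Omega>"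
    and u: "u \<in> W0 s \<Omega>" and u0: "\<And>x. 0 \<le> u x"
  shows "energy s (polarize a u) (polarize a u) \<le> energy s u u"
proof -
  note v = polarize_W0[OF assms]
  note [measurable] = W0D(1)[OF u]
  have "(\<integral>z. sym_density s a (polarize a u) z \<partial>lborel) \<le> (\<integral>z. sym_density s a u z \<partial>lborel)"
    by (intro integral_mono sym_density_integral(1) W0_energy_density[OF u] W0_energy_density[OF v] sym_density_polarize_le[OF s a]) measurable
  then show ?thesis
    by (simp add: energy_eq_density_integral[OF u] energy_eq_density_integral[OF v] sym_density_integral(2) W0_energy_density[OF u] W0_energy_density[OF v])
qed

text \<open>
Equality makes \<open>u(x) - u(\<sigma> x)\<close> and \<open>u(y) - u(\<sigma> y)\<close> have the same sign for almost all pairs in the half-space; the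
sets where this difference is positive and negative form a null rectangle, so one of them is null.
\<close>
lemma energy_polarize_eq:
  fixes u :: "real \<times> 'a::euclidean_space \<Rightarrow> real"
  assumes s: "0 < s" and a: "a \<noteq> 0" and fold: "foldable a \<Omega>"
    and u: "u \<in> W0 s \<Omega>" and u0: "\<And>x. 0 \<le> u x"
    and eq: "energy s (polarize a u) (polarize a u) = energy s u u"
  shows "(AE x in lborel. x \<in> halfspace a \<longrightarrow> u (mirror a x) \<le> u x) \<or>
    (AE x in lborel. x \<in> halfspace a \<longrightarrow> u x \<le> u (mirror a x))"
proof -
  note v = polarize_W0[OF s a fold u u0]
  note [measurable] = W0D(1)[OF u]
  have iu: "integrable lborel (sym_density s a u)" and iv: "integrable lborel (sym_density s a (polarize a u))"
    by (intro sym_density_integral(1) W0_energy_density[OF u] W0_energy_density[OF v], measurable)+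
  have "(\<integral>z. sym_density s a u z - sym_density s a (polarize a u) z \<partial>lborel) = 0"
    using iu iv eq by (simp add: energy_eq_density_integral[OF u] energy_eq_density_integral[OF v] sym_density_integral(2) W0_energy_density[OF u] W0_energy_density[OF v])
  then have ae: "AE z in lborel. sym_density s a u z - sym_density s a (polarize a u) z = 0"
    by (subst (asm) integral_nonneg_eq_0_iff_AE) (use iu iv in \<open>simp_all add: sym_density_polarize_le[OF s a]\<close>)
  define A where "A = {x \<in> halfspace a. u (mirror a x) < u x}"
  define B where "B = {x \<in> halfspace a. u x < u (mirror a x)}"
  have [measurable]: "A \<in> sets borel" "B \<in> sets borel" unfolding A_def B_def by measurable
  have "AE z in lborel. \<not> (fst z \<in> A \<and> snd z \<in> B)"
    using ae
  proof eventually_elim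
    fix z assume z: "sym_density s a u z - sym_density s a (polarize a u) z = 0"
    show "\<not> (fst z \<in> A \<and> snd z \<in> B)"
    proof
      assume *: "fst z \<in> A \<and> snd z \<in> B"
      then have "0 \<le> (u (fst z) - u (mirror a (fst z))) * (u (snd z) - u (mirror a (snd z)))"
        using z by (intro sym_density_polarize_eqD[OF s a]) (auto simp: A_def B_def)
      moreover have "(u (fst z) - u (mirror a (fst z))) * (u (snd z) - u (mirror a (snd z))) < 0"
        using * by (intro mult_pos_neg) (auto simp: A_def B_def)
      ultimately show False by linarith
    qed
  qed
  then have "emeasure lborel A = 0 \<or> emeasure lborel B = 0" by (intro null_rectangle) auto
  then show ?thesis
  proof
    assume "emeasure lborel A = 0"
    then have "AE x in lborel. x \<in> halfspace a \<longrightarrow> u x \<le> u (mirror a x)"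
      by (intro AE_I'[of A]) (auto simp: null_sets_def A_def)
    then show ?thesis ..
  next
    assume "emeasure lborel B = 0"
    then have "AE x in lborel. x \<in> halfspace a \<longrightarrow> u (mirror a x) \<le> u x"
      by (intro AE_I'[of B]) (auto simp: null_sets_def B_def)
    then show ?thesis ..
  qed
qed

section \<open>Polarization of the weight\<close>

text \<open>
Polarizing the weight only where both mirror points lie in \<open>\<Omega>\<close> keeps it a rearrangement on \<open>\<Omega>\<close>.
\<close>
definition fold_weight :: "real \<Rightarrow> (real \<times> 'a) set \<Rightarrow> (real \<times> 'a \<Rightarrow> real) \<Rightarrow> real \<times> 'a \<Rightarrow> real" where
  "fold_weight a \<Omega> \<rho> x = (if x \<in> \<Omega> \<and> mirror a x \<in> \<Omega> then polarize a \<rho> x else \<rho> x)"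

lemma measurable_fold_weight [measurable]:
  fixes \<Omega> :: "(real \<times> 'a::euclidean_space) set"
  assumes [measurable]: "\<Omega> \<in> sets borel" "\<rho> \<in> borel_measurable borel"
  shows "fold_weight a \<Omega> \<rho> \<in> borel_measurable borel"
  unfolding fold_weight_def[abs_def] by measurable

lemma fold_weight_bound:
  assumes "\<And>x. \<bar>\<rho> x\<bar> \<le> B" shows "\<bar>fold_weight a \<Omega> \<rho> x\<bar> \<le> B"
  using assms[of x] assms[of "mirror a x"] by (auto simp: fold_weight_def polarize_def)

lemma max_min_rearrange:
  fixes a b c d :: real
  shows "a * c + b * d \<le> max a b * max c d + min a b * min c d"
proof -
  have "0 \<le> (a - b) * (c - d)" if "a \<le> b \<and> c \<le> d \<or> b \<le> a \<and> d \<le> c"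
    using that by (auto simp: mult_nonpos_nonpos)
  moreover have "(a - b) * (c - d) \<le> 0" if "a \<le> b \<and> d \<le> c \<or> b \<le> a \<and> c \<le> d"
    using that by (auto simp: mult_nonneg_nonpos mult_nonpos_nonneg)
  ultimately show ?thesis
    by (simp add: max_def min_def algebra_simps)
qed

text \<open>
On each pair \<open>{x, \<sigma> x}\<close> in \<open>\<Omega>\<close> this is the rearrangement inequality for two numbers; if \<open>\<sigma> x\<close> lies outside \<open>\<Omega>\<close>, then \<open>u(\<sigma> x) = 0\<close>
and nothing changes.
\<close>
lemma weight_form_fold_le:
  fixes u :: "real \<times> 'a::euclidean_space \<Rightarrow> real"
  assumes s: "0 < s" and a: "a \<noteq> 0" and fold: "foldable a \<Omega>" and \<Omega>: "open \<Omega>"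
    and u: "u \<in> W0 s \<Omega>" and u0: "\<And>x. 0 \<le> u x"
    and \<rho>: "\<rho> \<in> borel_measurable borel" "\<And>x. \<bar>\<rho> x\<bar> \<le> B"
  shows "weight_form \<rho> u u \<le> weight_form (fold_weight a \<Omega> \<rho>) (polarize a u) (polarize a u)"
proof -
  note v = polarize_W0[OF s a fold u u0]
  have [measurable]: "\<Omega> \<in> sets borel" using \<Omega> by auto
  note [measurable] = W0D(1)[OF u] \<rho>(1)
  let ?r = "fold_weight a \<Omega> \<rho>"
  define f where "f x = \<rho> x * u x * u x" for x
  define g where "g x = ?r x * polarize a u x * polarize a u x" for x
  have [measurable]: "f \<in> borel_measurable borel" "g \<in> borel_measurable borel"
    unfolding f_def[abs_def] g_def[abs_def] by measurable
  have "integrable lborel f" unfolding f_def[abs_def] by (rule weight_form_integrable[OF \<rho> u u])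
  moreover have "integrable lborel g" unfolding g_def[abs_def]
    by (rule weight_form_integrable[OF _ fold_weight_bound[OF \<rho>(2)] v v]) measurable
  ultimately have i: "integrable lborel f" "integrable lborel g"
    "integrable lborel (\<lambda>x. f (mirror a x))" "integrable lborel (\<lambda>x. g (mirror a x))"
    by (simp_all add: integral_mirror(1))
  have pt: "f x + f (mirror a x) \<le> g x + g (mirror a x)" for x
  proof -
    have *: "f x + f (mirror a x) \<le> g x + g (mirror a x)" if H: "x \<in> halfspace a" for x
    proof -
      have p: "polarize a u x = max (u x) (u (mirror a x))" "polarize a u (mirror a x) = min (u x) (u (mirror a x))"
        using H polarize_mirror[OF a, of u x] by (simp_all add: polarize_def)
      show ?thesis
      proof (cases "x \<in> \<Omega> \<and> mirror a x \<in> \<Omega>")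
        case True
        then have r: "?r x = max (\<rho> x) (\<rho> (mirror a x))" "?r (mirror a x) = min (\<rho> x) (\<rho> (mirror a x))"
          using H polarize_mirror[OF a, of \<rho> x] by (simp_all add: fold_weight_def polarize_def)
        have m: "(max (u x) (u (mirror a x)))\<^sup>2 = max ((u x)\<^sup>2) ((u (mirror a x))\<^sup>2)"
          "(min (u x) (u (mirror a x)))\<^sup>2 = min ((u x)\<^sup>2) ((u (mirror a x))\<^sup>2)"
          using u0[of x] u0[of "mirror a x"] by (auto simp: max_def min_def)
        have "\<rho> x * (u x)\<^sup>2 + \<rho> (mirror a x) * (u (mirror a x))\<^sup>2
            \<le> max (\<rho> x) (\<rho> (mirror a x)) * (max (u x) (u (mirror a x)))\<^sup>2
              + min (\<rho> x) (\<rho> (mirror a x)) * (min (u x) (u (mirror a x)))\<^sup>2"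
          unfolding m by (rule max_min_rearrange)
        then show ?thesis by (simp add: f_def g_def p r power2_eq_square mult.assoc)
      next
        case False
        then have n: "mirror a x \<notin> \<Omega>" using foldable_outside[OF a fold _ H] by blast
        then have "u (mirror a x) = 0" using W0D(2)[OF u] by blast
        then show ?thesis using n u0[of x] by (simp add: f_def g_def p fold_weight_def)
      qed
    qed
    show ?thesis
    proof (cases "x \<in> halfspace a \<or> mirror a x \<in> halfspace a")
      case True
      then show ?thesis using *[of x] *[of "mirror a x"] by (auto simp: add.commute)
    next
      case False
      then have "mirror a x = x" using not_halfspace_mirror[OF _ _ a] by blast
      then show ?thesis by (simp add: f_def g_def polarize_def fold_weight_def)
    qed
  qed
  have "(\<integral>x. f x + f (mirror a x) \<partial>lborel) \<le> (\<integral>x. g x + g (mirror a x) \<partial>lborel)"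
    using i by (intro integral_mono pt) auto
  then have "(\<integral>x. f x \<partial>lborel) \<le> (\<integral>x. g x \<partial>lborel)"
    using i by (simp add: integral_mirror(2))
  then show ?thesis by (simp add: weight_form_def f_def g_def)
qed

section \<open>Polarization of an optimal weight\<close>

text \<open>
The pointwise content of Steiner symmetry that polarization needs: each slice in the \<open>x\<^sub>1\<close> direction is an interval centred at \<open>0\<close>.
\<close>
definition x1_symmetric_convex :: "(real \<times> 'a) set \<Rightarrow> bool" where
  "x1_symmetric_convex \<Omega> \<longleftrightarrow> (\<forall>t \<tau> x. (t, x) \<in> \<Omega> \<longrightarrow> \<bar>\<tau>\<bar> \<le> \<bar>t\<bar> \<longrightarrow> (\<tau>, x) \<in> \<Omega>)"

lemma halfspace_iff:
  assumes "a \<noteq> 0"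
  shows "x \<in> halfspace a \<longleftrightarrow> \<bar>fst x\<bar> < \<bar>2 * a - fst x\<bar>"
proof -
  have "\<bar>fst x\<bar> < \<bar>2 * a - fst x\<bar> \<longleftrightarrow> (fst x)\<^sup>2 < (2 * a - fst x)\<^sup>2"
    using abs_le_square_iff[of "2 * a - fst x" "fst x"] by (simp add: not_le[symmetric])
  also have "\<dots> \<longleftrightarrow> a * fst x < a\<^sup>2" by (simp add: power2_eq_square algebra_simps)
  finally show ?thesis by (simp add: halfspace_def)
qed

lemma x1_symmetric_convex_foldable:
  assumes "x1_symmetric_convex \<Omega>" "a \<noteq> 0"
  shows "foldable a \<Omega>"
  unfolding foldable_def
proof (intro ballI impI)
  fix x assume "x \<in> \<Omega>" "x \<notin> halfspace a"
  then show "mirror a x \<in> \<Omega>"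
    using assms(1)[unfolded x1_symmetric_convex_def, rule_format, of "fst x" "snd x" "2 * a - fst x"]
    by (simp add: halfspace_iff[OF assms(2)] mirror_def)
qed

text \<open>
The first coordinate of the centre of mass of \<open>\<Omega>\<close> is \<open>0\<close>, by the symmetry in \<open>x\<^sub>1\<close>; a symmetry about \<open>{x\<^sub>1 = a}\<close> would make it \<open>a\<close>.
\<close>
lemma not_mirror_symmetric:
  fixes \<Omega> :: "(real \<times> 'a::euclidean_space) set"
  assumes \<Omega>: "open \<Omega>" "bounded \<Omega>" "\<Omega> \<noteq> {}" and conv: "x1_symmetric_convex \<Omega>" and a: "a \<noteq> 0"
  shows "\<not> (AE x in lborel. x \<in> \<Omega> \<longrightarrow> mirror a x \<in> \<Omega>)"
proof
  assume ae: "AE x in lborel. x \<in> \<Omega> \<longrightarrow> mirror a x \<in> \<Omega>"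
  have [measurable]: "\<Omega> \<in> sets borel" using \<Omega> by auto
  have fin: "emeasure lborel \<Omega> < \<infinity>" using emeasure_bounded_finite[OF \<Omega>(2)] by simp
  define V where "V = measure lborel \<Omega>"
  have "emeasure lborel \<Omega> \<noteq> 0"
    using open_not_negligible[OF \<Omega>(1,3)] by (simp add: negligible_iff_null_sets null_sets_def)
  then have V: "V \<noteq> 0" unfolding V_def using fin by (simp add: measure_def enn2real_eq_0_iff)
  obtain R where R: "\<And>x. x \<in> \<Omega> \<Longrightarrow> norm x \<le> R" using \<Omega>(2) by (auto simp: bounded_iff)
  define f where "f x = indicator \<Omega> x * fst x" for x :: "real \<times> 'a"
  have [measurable]: "f \<in> borel_measurable borel" unfolding f_def[abs_def] by measurable
  have iI: "integrable lborel (indicator \<Omega> :: _ \<Rightarrow> real)" using fin by simp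
  have i: "integrable lborel f"
  proof (rule Bochner_Integration.integrable_bound)
    show "integrable lborel (\<lambda>x. R * indicator \<Omega> x)" using iI by simp
    have "\<bar>fst x\<bar> \<le> R" if "x \<in> \<Omega>" for x
      using R[OF that] norm_fst_le[of "fst x" "snd x"] by simp
    then have "norm (f x) \<le> norm (R * indicator \<Omega> x)" for x
    proof (cases "x \<in> \<Omega>")
      case True
      then have "\<bar>fst x\<bar> \<le> \<bar>R\<bar>" using \<open>\<And>x. x \<in> \<Omega> \<Longrightarrow> \<bar>fst x\<bar> \<le> R\<close>[of x] by linarith
      then show ?thesis using True by (simp add: f_def)
    qed (simp add: f_def)
    then show "AE x in lborel. norm (f x) \<le> norm (R * indicator \<Omega> x)" by simp
  qed measurable
  have inv: "(\<integral>x. f x \<partial>lborel) = b * V" if "AE x in lborel. x \<in> \<Omega> \<longrightarrow> mirror b x \<in> \<Omega>" for b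
  proof -
    have "AE x in lborel. f (mirror b x) = 2 * b * indicator \<Omega> x - f x"
      using that AE_mirror[OF that, of b]
    proof eventually_elim
      fix x assume "x \<in> \<Omega> \<longrightarrow> mirror b x \<in> \<Omega>" "mirror b x \<in> \<Omega> \<longrightarrow> mirror b (mirror b x) \<in> \<Omega>"
      then show "f (mirror b x) = 2 * b * indicator \<Omega> x - f x"
        by (auto simp: f_def indicator_def) (auto simp: mirror_def)
    qed
    then have "(\<integral>x. f (mirror b x) \<partial>lborel) = (\<integral>x. 2 * b * indicator \<Omega> x - f x \<partial>lborel)"
      by (intro integral_cong_AE) auto
    also have "\<dots> = 2 * b * V - (\<integral>x. f x \<partial>lborel)" using iI i by (simp add: V_def)
    finally show ?thesis by (simp add: integral_mirror(2))
  qed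
  \<comment> \<open>Both \<open>0\<close> and \<open>a\<close> are then centres of symmetry, so the first moment is \<open>0\<close> and \<open>a V\<close>.\<close>
  have "AE x in lborel. x \<in> \<Omega> \<longrightarrow> mirror 0 x \<in> \<Omega>"
    using conv by (auto simp: x1_symmetric_convex_def mirror_def)
  from inv[OF this] inv[OF ae] have "a * V = 0" by simp
  then show False using a V by simp
qed

text \<open>
Here \<open>opt\<close> expresses the minimality of \<open>\<lambda>\<^sub>1(\<rho>)\<close>: polarizing the weight cannot produce a larger Rayleigh quotient.  Then \<open>u\<close> and
its polarization are optimal for both weights, and positivity of \<open>u\<close> turns equality into \<open>\<rho>\<^sub>H = \<rho>\<close>.
\<close>
theorem polarization_optimal:
  fixes \<Omega> :: "(real \<times> 'a::euclidean_space) set"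
  assumes s: "0 < s" "s < 1" and \<Omega>: "open \<Omega>" "bounded \<Omega>" "\<Omega> \<noteq> {}" "x1_symmetric_convex \<Omega>"
    and \<rho>: "\<rho> \<in> borel_measurable borel" "\<And>x. \<bar>\<rho> x\<bar> \<le> B"
    and a: "a \<noteq> 0" and M: "0 < M" and m: "maximizer s \<Omega> \<rho> M u" and u0: "\<And>x. 0 \<le> u x"
    and opt: "\<And>f. f \<in> W0 s \<Omega> \<Longrightarrow> weight_form (fold_weight a \<Omega> \<rho>) f f \<le> M * energy s f f"
  shows "AE x in lborel. x \<in> \<Omega> \<and> x \<in> halfspace a \<and> mirror a x \<in> \<Omega> \<longrightarrow> \<rho> (mirror a x) \<le> \<rho> x"
proof -
  have [measurable]: "\<Omega> \<in> sets borel" using \<Omega> by auto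
  have u: "u \<in> W0 s \<Omega>" and eq: "weight_form \<rho> u u = M * energy s u u" and unz: "\<not> (AE x in lborel. u x = 0)"
    using m by (auto simp: maximizer_def)
  note [measurable] = W0D(1)[OF u] \<rho>(1)
  have fold: "foldable a \<Omega>" by (rule x1_symmetric_convex_foldable[OF \<Omega>(4) a])
  let ?r = "fold_weight a \<Omega> \<rho>"
  have r: "?r \<in> borel_measurable borel" "\<And>x. \<bar>?r x\<bar> \<le> B"
    by (measurable, rule fold_weight_bound[OF \<rho>(2)])
  have v: "polarize a u \<in> W0 s \<Omega>" by (rule polarize_W0[OF s(1) a fold u u0])
  have 1: "weight_form \<rho> u u \<le> weight_form ?r (polarize a u) (polarize a u)"
    by (rule weight_form_fold_le[OF s(1) a fold \<Omega>(1) u u0 \<rho>])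
  have 2: "weight_form ?r (polarize a u) (polarize a u) \<le> M * energy s (polarize a u) (polarize a u)" by (rule opt[OF v])
  have 3: "energy s (polarize a u) (polarize a u) \<le> energy s u u" by (rule energy_polarize_le[OF s(1) a fold u u0])
  have 4: "M * energy s (polarize a u) (polarize a u) \<le> M * energy s u u" using 3 M by simp
  have "M * energy s (polarize a u) (polarize a u) = M * energy s u u" using 1 2 4 eq by linarith
  then have feq: "energy s (polarize a u) (polarize a u) = energy s u u" using M by simp
  have weq: "weight_form ?r (polarize a u) (polarize a u) = M * energy s u u" using 1 2 4 eq by linarith
  have pos: "AE x in lborel. x \<in> \<Omega> \<longrightarrow> 0 < u x" by (rule maximizer_positive[OF s \<Omega>(1,2) \<rho> M m u0])
  from energy_polarize_eq[OF s(1) a fold u u0 feq] consider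
    (up) "AE x in lborel. x \<in> halfspace a \<longrightarrow> u (mirror a x) \<le> u x"
    | (down) "AE x in lborel. x \<in> halfspace a \<longrightarrow> u x \<le> u (mirror a x)" by blast
  then show ?thesis
  proof cases
    case down
    have "AE x in lborel. x \<in> \<Omega> \<longrightarrow> mirror a x \<in> \<Omega>"
      using down pos
    proof eventually_elim
      fix x assume *: "x \<in> halfspace a \<longrightarrow> u x \<le> u (mirror a x)" "x \<in> \<Omega> \<longrightarrow> 0 < u x"
      show "x \<in> \<Omega> \<longrightarrow> mirror a x \<in> \<Omega>"
      proof
        assume x: "x \<in> \<Omega>"
        show "mirror a x \<in> \<Omega>"
        proof (cases "x \<in> halfspace a")
          case True
          then have "0 < u (mirror a x)" using * x by simp
          then show ?thesis using W0D(2)[OF u, of "mirror a x"] by auto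
        next
          case False then show ?thesis using fold x by (simp add: foldable_def)
        qed
      qed
    qed
    with not_mirror_symmetric[OF \<Omega> a] show ?thesis ..
  next
    case up
    have pu: "AE x in lborel. polarize a u x = u x"
      using up AE_mirror[OF up, of a]
    proof eventually_elim
      fix x assume *: "x \<in> halfspace a \<longrightarrow> u (mirror a x) \<le> u x"
        "mirror a x \<in> halfspace a \<longrightarrow> u (mirror a (mirror a x)) \<le> u (mirror a x)"
      show "polarize a u x = u x"
      proof (cases "x \<in> halfspace a \<or> mirror a x \<in> halfspace a")
        case True then show ?thesis using * by (auto simp: polarize_def)
      next
        case False
        then have "mirror a x = x" using not_halfspace_mirror[OF _ _ a] by blast
        then show ?thesis by (simp add: polarize_def)
      qed
    qed
    have "weight_form ?r (polarize a u) (polarize a u) = weight_form ?r u u"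
      unfolding weight_form_def using pu by (intro integral_cong_AE) (auto elim!: eventually_mono)
    then have m2: "maximizer s \<Omega> ?r M u"
      unfolding maximizer_def using u unz weq opt by auto
    define g where "g x = (?r x - \<rho> x) * u x" for x
    have g_eq: "(\<integral>x. g x * \<phi> x \<partial>lborel) = 0" if \<phi>: "\<phi> \<in> W0 s \<Omega>" for \<phi>
    proof -
      have "(\<integral>x. g x * \<phi> x \<partial>lborel) = (\<integral>x. ?r x * u x * \<phi> x - \<rho> x * u x * \<phi> x \<partial>lborel)"
        by (intro Bochner_Integration.integral_cong) (auto simp: g_def algebra_simps)
      also have "\<dots> = weight_form ?r u \<phi> - weight_form \<rho> u \<phi>"
        unfolding weight_form_def using weight_form_integrable[OF r u \<phi>] weight_form_integrable[OF \<rho> u \<phi>] by simp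
      also have "\<dots> = 0"
        using maximizer_Euler_Lagrange[OF r m2 \<phi>] maximizer_Euler_Lagrange[OF \<rho> m \<phi>] by simp
      finally show ?thesis .
    qed
    have ig: "integrable lborel g"
    proof (rule Bochner_Integration.integrable_bound)
      show "integrable lborel (\<lambda>x. 2 * B * u x)" using W0_integrable[OF \<Omega>(1,2) u] by simp
      have "\<bar>?r x - \<rho> x\<bar> \<le> \<bar>2 * B\<bar>" for x using r(2)[of x] \<rho>(2)[of x] by linarith
      then show "AE x in lborel. norm (g x) \<le> norm (2 * B * u x)"
        unfolding g_def real_norm_def abs_mult[of _ "u _"] by (intro AE_I2 mult_right_mono) auto
    qed (simp add: g_def[abs_def])
    \<comment> \<open>The squares of bumps are again test functions, so the linear identity \<open>g_eq\<close> can be used in \<open>nonpos_of_test\<close>.\<close>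
    have bb: "(\<lambda>x. (bump \<Omega> K n x)\<^sup>2) \<in> W0 s \<Omega>" for K n
    proof -
      have b: "bump \<Omega> K n \<in> W0 s \<Omega>" by (rule bump_W0[OF s \<Omega>(1,2)])
      show ?thesis
      proof (rule W0_dominated[OF b b, where C = 2])
        fix x y
        have bx: "0 \<le> bump \<Omega> K n x" "bump \<Omega> K n x \<le> 1" for x by (rule bump_bounds)+
        have "\<bar>bump \<Omega> K n x\<bar> * \<bar>bump \<Omega> K n x\<bar> \<le> \<bar>bump \<Omega> K n x\<bar> * 1" using bx[of x] by (intro mult_left_mono) auto
        then show "\<bar>(bump \<Omega> K n x)\<^sup>2\<bar> \<le> 2 * (\<bar>bump \<Omega> K n x\<bar> + \<bar>bump \<Omega> K n x\<bar>)"
          by (simp add: power2_eq_square)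
        have "\<bar>(bump \<Omega> K n x)\<^sup>2 - (bump \<Omega> K n y)\<^sup>2\<bar> = \<bar>bump \<Omega> K n x - bump \<Omega> K n y\<bar> * \<bar>bump \<Omega> K n x + bump \<Omega> K n y\<bar>"
          unfolding abs_mult[symmetric] by (simp add: power2_eq_square algebra_simps)
        also have "\<dots> \<le> \<bar>bump \<Omega> K n x - bump \<Omega> K n y\<bar> * 2"
          using bx[of x] bx[of y] by (intro mult_left_mono) auto
        finally show "\<bar>(bump \<Omega> K n x)\<^sup>2 - (bump \<Omega> K n y)\<^sup>2\<bar>
            \<le> 2 * (\<bar>bump \<Omega> K n x - bump \<Omega> K n y\<bar> + \<bar>bump \<Omega> K n x - bump \<Omega> K n y\<bar>)" by simp
      qed measurable
    qed
    have "AE x in lborel. x \<in> \<Omega> \<longrightarrow> g x \<le> 0"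
      by (rule nonpos_of_test[OF s \<Omega>(1,2) ig]) (simp add: g_eq[OF bb])
    moreover have "AE x in lborel. x \<in> \<Omega> \<longrightarrow> - g x \<le> 0"
      by (rule nonpos_of_test[OF s \<Omega>(1,2)]) (use ig in \<open>simp_all add: g_eq[OF bb]\<close>)
    ultimately show ?thesis using pos
    proof eventually_elim
      fix x assume *: "x \<in> \<Omega> \<longrightarrow> g x \<le> 0" "x \<in> \<Omega> \<longrightarrow> - g x \<le> 0" "x \<in> \<Omega> \<longrightarrow> 0 < u x"
      show "x \<in> \<Omega> \<and> x \<in> halfspace a \<and> mirror a x \<in> \<Omega> \<longrightarrow> \<rho> (mirror a x) \<le> \<rho> x"
      proof
        assume x: "x \<in> \<Omega> \<and> x \<in> halfspace a \<and> mirror a x \<in> \<Omega>"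
        then have "g x = 0" "0 < u x" using * by auto
        then have "?r x = \<rho> x" by (simp add: g_def)
        then show "\<rho> (mirror a x) \<le> \<rho> x" using x by (simp add: fold_weight_def polarize_def)
      qed
    qed
  qed
qed

section \<open>From polarization to Steiner symmetry\<close>

lemma AE_snd:
  assumes "AE y in (lborel :: 'b::euclidean_space measure). P y"
  shows "AE z in (lborel :: ('a::euclidean_space \<times> 'b) measure). P (snd z)"
proof -
  from AE_E[OF assms] obtain N where N: "{x \<in> space lborel. \<not> P x} \<subseteq> N" "emeasure lborel N = 0" "N \<in> sets lborel" .
  then have "UNIV \<times> N \<in> null_sets (lborel \<Otimes>\<^sub>M lborel)"
    by (auto simp: null_sets_def lborel.emeasure_pair_measure_Times)
  then have "(UNIV :: 'a set) \<times> N \<in> null_sets lborel" unfolding lborel_prod .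
  then show ?thesis using N(1) by (intro AE_I'[of "UNIV \<times> N"]) auto
qed

text \<open>
Let \<open>A\<close> be the superlevel set and \<open>J\<close> the centred interval of the same length.  The order relation fails for
every pair in \<open>(J - A) \<times> (A - J)\<close>, so one of these two sets is null; having equal measure, both are.
\<close>
lemma ordered_superlevel_interval:
  fixes f :: "real \<Rightarrow> real"
  assumes [measurable]: "I \<in> sets borel" "f \<in> borel_measurable borel"
    and I: "\<And>t \<tau>. t \<in> I \<Longrightarrow> \<bar>\<tau>\<bar> \<le> \<bar>t\<bar> \<Longrightarrow> \<tau> \<in> I" and fin: "emeasure lborel I < \<infinity>"
    and ord: "AE t in lborel. AE \<tau> in lborel. \<bar>t\<bar> < \<bar>\<tau>\<bar> \<and> t \<in> I \<and> \<tau> \<in> I \<longrightarrow> f \<tau> \<le> f t"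
  shows "AE t in lborel. t \<in> I \<longrightarrow> (c < f t \<longleftrightarrow> ennreal (2 * \<bar>t\<bar>) < emeasure lborel {\<tau> \<in> I. c < f \<tau>})"
proof -
  define A where "A = {\<tau> \<in> I. c < f \<tau>}"
  have [measurable]: "A \<in> sets borel" unfolding A_def by measurable
  have Afin: "emeasure lborel A < \<infinity>"
  proof -
    have "emeasure lborel A \<le> emeasure lborel I" by (intro emeasure_mono) (auto simp: A_def)
    then show ?thesis using fin by simp
  qed
  define r where "r = measure lborel A / 2"
  have r0: "0 \<le> r" by (simp add: r_def)
  have eA: "emeasure lborel A = ennreal (2 * r)"
    unfolding r_def using Afin by (simp add: emeasure_eq_ennreal_measure less_top)
  define J where "J = {-r<..<r}"
  have [measurable]: "J \<in> sets borel" unfolding J_def by simp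
  have eJ: "emeasure lborel J = ennreal (2 * r)" unfolding J_def using r0 by simp
  have JI: "J \<subseteq> I"
  proof
    fix t assume t: "t \<in> J"
    show "t \<in> I"
    proof (rule ccontr)
      assume "t \<notin> I"
      then have "A \<subseteq> {- \<bar>t\<bar><..<\<bar>t\<bar>}"
        using I[of _ t] unfolding A_def by (force simp: abs_less_iff)
      then have "emeasure lborel A \<le> emeasure lborel {- \<bar>t\<bar><..<\<bar>t\<bar>}" by (intro emeasure_mono) auto
      then have "r \<le> \<bar>t\<bar>" unfolding eA by simp
      then show False using t by (auto simp: J_def)
    qed
  qed
  define B where "B = J - A"
  define C where "C = A - J"
  have [measurable]: "B \<in> sets borel" "C \<in> sets borel" unfolding B_def C_def by measurable
  have AE1: "AE t in lborel. t \<in> B \<longrightarrow> (AE \<tau> in lborel. \<tau> \<notin> C)"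
    using ord
  proof eventually_elim
    fix t assume t: "AE \<tau> in lborel. \<bar>t\<bar> < \<bar>\<tau>\<bar> \<and> t \<in> I \<and> \<tau> \<in> I \<longrightarrow> f \<tau> \<le> f t"
    show "t \<in> B \<longrightarrow> (AE \<tau> in lborel. \<tau> \<notin> C)"
    proof
      assume tB: "t \<in> B"
      show "AE \<tau> in lborel. \<tau> \<notin> C" using t
      proof eventually_elim
        fix \<tau> assume *: "\<bar>t\<bar> < \<bar>\<tau>\<bar> \<and> t \<in> I \<and> \<tau> \<in> I \<longrightarrow> f \<tau> \<le> f t"
        show "\<tau> \<notin> C"
        proof
          assume "\<tau> \<in> C"
          moreover have "t \<in> I" using tB JI by (auto simp: B_def)
          ultimately have "\<bar>t\<bar> < \<bar>\<tau>\<bar> \<and> t \<in> I \<and> \<tau> \<in> I" "f t \<le> c" "c < f \<tau>"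
            using tB by (auto simp: B_def C_def A_def J_def)
          then show False using * by auto
        qed
      qed
    qed
  qed
  have fin2: "emeasure lborel (A \<inter> J) < \<infinity>"
    using emeasure_mono[of "A \<inter> J" A lborel] Afin by (simp add: le_less_trans)
  have BC: "emeasure lborel B = emeasure lborel C"
  proof -
    have "emeasure lborel B = emeasure lborel J - emeasure lborel (A \<inter> J)"
      unfolding B_def using fin2 by (subst emeasure_Diff[symmetric]) (auto intro!: arg_cong[where f = "emeasure lborel"])
    moreover have "emeasure lborel C = emeasure lborel A - emeasure lborel (A \<inter> J)"
      unfolding C_def using fin2 by (subst emeasure_Diff[symmetric]) (auto intro!: arg_cong[where f = "emeasure lborel"])
    ultimately show ?thesis using eA eJ by simp
  qed
  have null: "emeasure lborel B = 0 \<and> emeasure lborel C = 0"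
  proof (cases "emeasure lborel C = 0")
    case True then show ?thesis using BC by simp
  next
    case False
    then have "\<not> (AE \<tau> in lborel. \<tau> \<notin> C)"
      by (subst AE_iff_null_sets[symmetric]) (auto simp: null_sets_def)
    then have "AE t in lborel. t \<notin> B" using AE1 by simp
    then have "B \<in> null_sets lborel" by (subst AE_iff_null_sets) auto
    then show ?thesis using BC by (simp add: null_sets_def)
  qed
  then have "AE t in lborel. t \<notin> B" "AE t in lborel. t \<notin> C"
    by (subst AE_iff_null_sets[symmetric]; auto simp: null_sets_def)+
  then show ?thesis
  proof eventually_elim
    fix t assume t: "t \<notin> B" "t \<notin> C"
    have "ennreal (2 * \<bar>t\<bar>) < emeasure lborel A \<longleftrightarrow> t \<in> J"
      unfolding eA J_def by (simp add: ennreal_less_iff abs_less_iff) auto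
    then show "t \<in> I \<longrightarrow> (c < f t \<longleftrightarrow> ennreal (2 * \<bar>t\<bar>) < emeasure lborel {\<tau> \<in> I. c < f \<tau>})"
      using t unfolding A_def[symmetric] by (auto simp: B_def C_def A_def)
  qed
qed

text \<open>
Countably many levels suffice, which allows the exceptional null sets of the levels to be united.
\<close>
lemma Sup_eq_of_rational_levels:
  fixes m :: "real \<Rightarrow> ennreal" and v :: real
  assumes m: "\<And>c d. c \<le> d \<Longrightarrow> m d \<le> m c"
    and lev: "\<And>c. c \<in> \<rat> \<Longrightarrow> c < v \<longleftrightarrow> e < m c"
  shows "Sup {c. e < m c} = v"
proof (rule cSup_eq)
  fix c assume c: "c \<in> {c. e < m c}"
  show "c \<le> v"
  proof (rule ccontr)
    assume "\<not> c \<le> v"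
    then obtain q where q: "q \<in> \<rat>" "v < q" "q < c" using Rats_dense_in_real[of v c] by auto
    then have "e < m q" using c m[of q c] by (auto intro: less_le_trans)
    then show False using lev[OF q(1)] q by auto
  qed
next
  fix y assume y: "\<And>c. c \<in> {c. e < m c} \<Longrightarrow> c \<le> y"
  show "v \<le> y"
  proof (rule ccontr)
    assume "\<not> v \<le> y"
    then obtain q where q: "q \<in> \<rat>" "y < q" "q < v" using Rats_dense_in_real[of y v] by auto
    then show False using y[of q] lev[OF q(1)] by auto
  qed
qed

text \<open>
For fixed \<open>x'\<close> the pair of points \<open>t, \<tau> = 2 a - t\<close> runs through all pairs when \<open>t\<close> and \<open>a\<close> do.  The exceptional sets, null for every
\<open>a\<close>, are therefore combined by Fubini's theorem in the variables \<open>(a, t, x')\<close>.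
\<close>
lemma mirror_ordered_slices:
  fixes \<Omega> :: "(real \<times> 'a::euclidean_space) set" and r :: "real \<times> 'a \<Rightarrow> real"
  assumes [measurable]: "\<Omega> \<in> sets borel" "r \<in> borel_measurable borel"
    and ord: "\<And>a. a \<noteq> 0 \<Longrightarrow> AE x in lborel. x \<in> \<Omega> \<and> x \<in> halfspace a \<and> mirror a x \<in> \<Omega> \<longrightarrow> r (mirror a x) \<le> r x"
  shows "AE x' in lborel. AE t in lborel. AE \<tau> in lborel.
    \<bar>t\<bar> < \<bar>\<tau>\<bar> \<and> (t, x') \<in> \<Omega> \<and> (\<tau>, x') \<in> \<Omega> \<longrightarrow> r (\<tau>, x') \<le> r (t, x')"
proof -
  define Q where "Q a x \<longleftrightarrow> (x \<in> \<Omega> \<and> \<bar>fst x\<bar> < \<bar>2 * a - fst x\<bar> \<and> (2 * a - fst x, snd x) \<in> \<Omega> \<longrightarrow> r (2 * a - fst x, snd x) \<le> r x)"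
    for a :: real and x :: "real \<times> 'a"
  have Qm: "Measurable.pred borel (\<lambda>z :: real \<times> (real \<times> 'a). Q (fst z) (snd z))"
  proof -
    define p where "p z = snd z" for z :: "real \<times> (real \<times> 'a)"
    define F where "F z = (2 * fst z - fst (snd z), snd (snd z))" for z :: "real \<times> (real \<times> 'a)"
    define p1 where "p1 z = fst (snd z)" for z :: "real \<times> (real \<times> 'a)"
    define F1 where "F1 z = 2 * fst z - fst (snd z)" for z :: "real \<times> (real \<times> 'a)"
    have [measurable]: "p \<in> borel_measurable borel" "F \<in> borel_measurable borel"
        "p1 \<in> borel_measurable borel" "F1 \<in> borel_measurable borel"
      unfolding p_def[abs_def] F_def[abs_def] p1_def[abs_def] F1_def[abs_def]
      by (intro borel_measurable_continuous_onI continuous_intros)+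
    have "Measurable.pred borel (\<lambda>z. p z \<in> \<Omega> \<and> \<bar>p1 z\<bar> < \<bar>F1 z\<bar> \<and> F z \<in> \<Omega> \<longrightarrow> r (F z) \<le> r (p z))"
      by measurable
    then show ?thesis by (simp add: Q_def p_def F_def p1_def F1_def)
  qed
  have 1: "AE x in lborel. Q a x" for a
  proof (cases "a = 0")
    case True then show ?thesis by (simp add: Q_def)
  next
    case False
    from ord[OF this] show ?thesis
      by eventually_elim (auto simp: Q_def halfspace_iff[OF False] mirror_def)
  qed
  have "AE x in lborel. AE a in lborel. Q a x"
  proof (subst lborel_pair.AE_commute[symmetric])
    show "{x \<in> space (lborel \<Otimes>\<^sub>M lborel). Q (fst x) (snd x)} \<in> sets (lborel \<Otimes>\<^sub>M (lborel :: (real \<times> 'a) measure))"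
      unfolding lborel_prod using Qm by (simp add: pred_def)
  qed (use 1 in simp)
  then have 2: "AE x in lborel. AE \<tau> in lborel. \<bar>fst x\<bar> < \<bar>\<tau>\<bar> \<and> x \<in> \<Omega> \<and> (\<tau>, snd x) \<in> \<Omega> \<longrightarrow> r (\<tau>, snd x) \<le> r x"
  proof eventually_elim
    fix x assume x: "AE a in lborel. Q a x"
    have "Measurable.pred borel (\<lambda>a. Q a x)" unfolding Q_def by measurable
    \<comment> \<open>The substitution \<open>a = (t + \<tau>) / 2\<close>.\<close>
    from AE_borel_affine[OF _ this x, of "1 / 2" "fst x / 2"]
    have "AE \<tau> in lborel. Q (fst x / 2 + 1 / 2 * \<tau>) x" by simp
    then show "AE \<tau> in lborel. \<bar>fst x\<bar> < \<bar>\<tau>\<bar> \<and> x \<in> \<Omega> \<and> (\<tau>, snd x) \<in> \<Omega> \<longrightarrow> r (\<tau>, snd x) \<le> r x"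
      by eventually_elim (auto simp: Q_def)
  qed
  define G where "G x \<longleftrightarrow> (AE \<tau> in lborel. \<bar>fst x\<bar> < \<bar>\<tau>\<bar> \<and> x \<in> \<Omega> \<and> (\<tau>, snd x) \<in> \<Omega> \<longrightarrow> r (\<tau>, snd x) \<le> r x)"
    for x :: "real \<times> 'a"
  define N where "N = {z :: (real \<times> 'a) \<times> real. \<not> (\<bar>fst (fst z)\<bar> < \<bar>snd z\<bar> \<and> fst z \<in> \<Omega> \<and> (snd z, snd (fst z)) \<in> \<Omega>
     \<longrightarrow> r (snd z, snd (fst z)) \<le> r (fst z))}"
  have [measurable]: "N \<in> sets borel"
  proof -
    define p where "p z = fst z" for z :: "(real \<times> 'a) \<times> real"
    define F where "F z = (snd z, snd (fst z))" for z :: "(real \<times> 'a) \<times> real"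
    have [measurable]: "p \<in> borel_measurable borel" "F \<in> borel_measurable borel"
      unfolding p_def[abs_def] F_def[abs_def] by (intro borel_measurable_continuous_onI continuous_intros)+
    have "N = {z. \<not> (\<bar>fst (p z)\<bar> < \<bar>fst (F z)\<bar> \<and> p z \<in> \<Omega> \<and> F z \<in> \<Omega> \<longrightarrow> r (F z) \<le> r (p z))}"
      by (simp add: N_def p_def F_def)
    then show ?thesis by simp
  qed
  have Nm: "N \<in> sets (lborel \<Otimes>\<^sub>M lborel)" unfolding lborel_prod by simp
  have Geq: "G x \<longleftrightarrow> emeasure lborel (Pair x -` N) = 0" for x
  proof -
    have "Pair x -` N \<in> sets lborel" using Nm by (rule sets_Pair1)
    then have "emeasure lborel (Pair x -` N) = 0 \<longleftrightarrow> (AE \<tau> in lborel. \<tau> \<notin> Pair x -` N)"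
      by (subst AE_iff_null_sets[symmetric]) (auto simp: null_sets_def)
    moreover have "G x \<longleftrightarrow> (AE \<tau> in lborel. \<tau> \<notin> Pair x -` N)"
      unfolding G_def by (rule AE_cong) (auto simp: N_def)
    ultimately show ?thesis by simp
  qed
  have Gm: "{x \<in> space (lborel \<Otimes>\<^sub>M (lborel :: 'a measure)). G (fst x, snd x)} \<in> sets (lborel \<Otimes>\<^sub>M lborel)"
  proof -
    have [measurable]: "(\<lambda>x. emeasure lborel (Pair x -` N)) \<in> borel_measurable (lborel :: (real \<times> 'a) measure)"
      by (rule lborel.measurable_emeasure_Pair[OF Nm])
    have "{x \<in> space lborel. emeasure lborel (Pair x -` N) = 0} \<in> sets (lborel :: (real \<times> 'a) measure)" by measurable
    then show ?thesis unfolding lborel_prod by (simp add: Geq)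
  qed
  have "AE x in lborel \<Otimes>\<^sub>M (lborel :: 'a measure). G x" using 2 unfolding G_def[symmetric] lborel_prod .
  from lborel_pair.AE_pair[OF this] have "AE t in lborel. AE x' in (lborel :: 'a measure). G (t, x')" .
  then have "AE x' in (lborel :: 'a measure). AE t in lborel. G (t, x')"
    by (subst (asm) lborel_pair.AE_commute[OF Gm])
  then show ?thesis by (simp add: G_def)
qed

lemma emeasure_lebesgue_AE_eq:
  fixes S T :: "'a::euclidean_space set"
  assumes T: "T \<in> sets borel" and ae: "AE x in lborel. x \<in> S \<longleftrightarrow> x \<in> T"
  shows "emeasure lebesgue S = emeasure lborel T"
proof -
  have "AE x in lebesgue. indicator T x = (indicator S x :: real)"
    using AE_completion[OF ae] by eventually_elim (auto simp: indicator_def)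
  moreover have "(indicator T :: 'a \<Rightarrow> real) \<in> borel_measurable lebesgue"
    by (intro borel_measurable_indicator) (use T in simp)
  ultimately have "(indicator S :: 'a \<Rightarrow> real) \<in> borel_measurable lebesgue" by (rule borel_measurable_AE[rotated])
  then have "S \<in> sets lebesgue" by (simp add: borel_measurable_indicator_iff)
  then have "emeasure lebesgue S = emeasure lebesgue T"
    using AE_completion[OF ae] T by (intro emeasure_eq_AE) auto
  then show ?thesis using T by simp
qed

text \<open>
On almost every slice the superlevel sets are centred intervals up to null sets, hence almost every point \<open>z\<close> satisfies, for
all rational \<open>c\<close>: \<open>c < \<rho>(z)\<close> iff \<open>z\<close> lies in the symmetrization of \<open>{\<rho> > c}\<close>.  The supremum defining \<open>\<rho>\<^sup>\<sharp>(z)\<close> is then \<open>\<rho>(z)\<close>.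
\<close>
theorem steiner_fun_of_mirror_ordered:
  fixes \<Omega> :: "(real \<times> 'a::euclidean_space) set"
  assumes \<Omega>: "open \<Omega>" "bounded \<Omega>" "x1_symmetric_convex \<Omega>"
    and r: "r \<in> borel_measurable borel"
    and ord: "\<And>a. a \<noteq> 0 \<Longrightarrow> AE x in lborel. x \<in> \<Omega> \<and> x \<in> halfspace a \<and> mirror a x \<in> \<Omega> \<longrightarrow> r (mirror a x) \<le> r x"
    and \<rho>: "AE x in lborel. x \<in> \<Omega> \<longrightarrow> \<rho> x = r x"
  shows "AE x in lborel. x \<in> \<Omega> \<longrightarrow> steiner_fun \<Omega> \<rho> x = \<rho> x"
proof -
  note [measurable] = r
  have [measurable]: "\<Omega> \<in> sets borel" using \<Omega> by auto
  define m where "m c x' = emeasure lborel {\<tau>. (\<tau>, x') \<in> \<Omega> \<and> c < r (\<tau>, x')}" for c and x' :: 'a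
  have mm [measurable]: "m c \<in> borel_measurable borel" for c
  proof -
    have "{z \<in> \<Omega>. c < r z} \<in> sets (lborel \<Otimes>\<^sub>M (lborel :: 'a measure))" unfolding lborel_prod by measurable
    from lborel_pair.measurable_emeasure_Pair2[OF this] show ?thesis by (simp add: m_def[abs_def] vimage_def)
  qed
  define W where "W c z \<longleftrightarrow> (z \<in> \<Omega> \<longrightarrow> (c < r z \<longleftrightarrow> ennreal (2 * \<bar>fst z\<bar>) < m c (snd z)))" for c and z :: "real \<times> 'a"
  have slices: "AE x' in lborel. AE t in lborel. AE \<tau> in lborel.
      \<bar>t\<bar> < \<bar>\<tau>\<bar> \<and> (t, x') \<in> \<Omega> \<and> (\<tau>, x') \<in> \<Omega> \<longrightarrow> r (\<tau>, x') \<le> r (t, x')"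
    by (rule mirror_ordered_slices[OF _ r ord]) measurable
  have "AE x' in lborel. AE t in lborel. W c (t, x')" for c
    using slices
  proof eventually_elim
    fix x' :: 'a
    assume o: "AE t in lborel. AE \<tau> in lborel. \<bar>t\<bar> < \<bar>\<tau>\<bar> \<and> (t, x') \<in> \<Omega> \<and> (\<tau>, x') \<in> \<Omega> \<longrightarrow> r (\<tau>, x') \<le> r (t, x')"
    define I where "I = {t. (t, x') \<in> \<Omega>}"
    have [measurable]: "I \<in> sets borel" "(\<lambda>t. r (t, x')) \<in> borel_measurable borel" unfolding I_def by measurable
    obtain R where R: "\<And>x. x \<in> \<Omega> \<Longrightarrow> norm x \<le> R" using \<Omega>(2) by (auto simp: bounded_iff)
    have "bounded I" unfolding bounded_iff
    proof (intro exI ballI)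
      fix t assume "t \<in> I"
      then show "norm t \<le> R" using R[of "(t, x')"] norm_fst_le[of t x'] by (simp add: I_def)
    qed
    then have fin: "emeasure lborel I < \<infinity>" using emeasure_bounded_finite by simp
    have "AE t in lborel. t \<in> I \<longrightarrow> (c < r (t, x') \<longleftrightarrow> ennreal (2 * \<bar>t\<bar>) < emeasure lborel {\<tau> \<in> I. c < r (\<tau>, x')})"
      by (rule ordered_superlevel_interval[OF _ _ _ fin]) (use \<Omega>(3) o in \<open>auto simp: I_def x1_symmetric_convex_def\<close>)
    then show "AE t in lborel. W c (t, x')" by (simp add: W_def I_def m_def)
  qed
  moreover have Wm: "Measurable.pred borel (W c)" for c unfolding W_def[abs_def] by measurable
  ultimately have W: "AE z in lborel. W c z" for c
  proof -
    have s: "{z \<in> space (lborel \<Otimes>\<^sub>M (lborel :: 'a measure)). W c (fst z, snd z)} \<in> sets (lborel \<Otimes>\<^sub>M lborel)"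
      using Wm[of c] unfolding lborel_prod by (simp add: pred_def)
    have "AE t in lborel. AE x' in (lborel :: 'a measure). W c (t, x')"
      by (subst lborel_pair.AE_commute[OF s]) fact
    then have "AE z in lborel \<Otimes>\<^sub>M (lborel :: 'a measure). W c (fst z, snd z)"
      by (subst (asm) lborel_pair.AE_pair_iff[OF s])
    then show ?thesis unfolding lborel_prod by simp
  qed
  have "AE z in lborel. \<forall>c\<in>\<rat>. W c z"
    using W countable_rat by (subst AE_ball_countable) auto
  moreover have "AE z in (lborel :: (real \<times> 'a) measure). AE \<tau> in lborel. (\<tau>, snd z) \<in> \<Omega> \<longrightarrow> \<rho> (\<tau>, snd z) = r (\<tau>, snd z)"
  proof (rule AE_snd)
    obtain N where N: "{x \<in> space lborel. \<not> (x \<in> \<Omega> \<longrightarrow> \<rho> x = r x)} \<subseteq> N" "emeasure lborel N = 0" "N \<in> sets lborel"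
      using AE_E[OF \<rho>] .
    then have "AE z in lborel \<Otimes>\<^sub>M (lborel :: 'a measure). z \<notin> N"
      unfolding lborel_prod by (subst AE_iff_null_sets[symmetric]) (auto simp: null_sets_def)
    from lborel_pair.AE_pair[OF this] have "AE t in lborel. AE x' in (lborel :: 'a measure). (t, x') \<notin> N" .
    moreover have "{z \<in> space (lborel \<Otimes>\<^sub>M (lborel :: 'a measure)). (fst z, snd z) \<notin> N} \<in> sets (lborel \<Otimes>\<^sub>M lborel)"
      using N(3) unfolding lborel_prod by simp
    ultimately have "AE x' in (lborel :: 'a measure). AE t in lborel. (t, x') \<notin> N"
      by (subst (asm) lborel_pair.AE_commute) auto
    then show "AE x' in lborel. AE \<tau> in lborel. (\<tau>, x') \<in> \<Omega> \<longrightarrow> \<rho> (\<tau>, x') = r (\<tau>, x')"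
      by eventually_elim (use N(1) in \<open>auto elim!: eventually_mono\<close>)
  qed
  ultimately show ?thesis using \<rho>
  proof eventually_elim
    fix z :: "real \<times> 'a"
    assume W: "\<forall>c\<in>\<rat>. W c z" and sl: "AE \<tau> in lborel. (\<tau>, snd z) \<in> \<Omega> \<longrightarrow> \<rho> (\<tau>, snd z) = r (\<tau>, snd z)"
      and eq: "z \<in> \<Omega> \<longrightarrow> \<rho> z = r z"
    show "z \<in> \<Omega> \<longrightarrow> steiner_fun \<Omega> \<rho> z = \<rho> z"
    proof
      assume z: "z \<in> \<Omega>"
      have lev: "emeasure lebesgue {\<tau>. (\<tau>, snd z) \<in> {y \<in> \<Omega>. c < \<rho> y}} = m c (snd z)" for c
        unfolding m_def
      proof (rule emeasure_lebesgue_AE_eq)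
        show "AE \<tau> in lborel. \<tau> \<in> {\<tau>. (\<tau>, snd z) \<in> {y \<in> \<Omega>. c < \<rho> y}} \<longleftrightarrow> \<tau> \<in> {\<tau>. (\<tau>, snd z) \<in> \<Omega> \<and> c < r (\<tau>, snd z)}"
          using sl by eventually_elim auto
      qed measurable
      have "{c. z \<in> steiner_set {y \<in> \<Omega>. c < \<rho> y}} = {c. ennreal (2 * \<bar>fst z\<bar>) < m c (snd z)}"
        unfolding lev[symmetric] steiner_set_def by (auto simp: case_prod_beta')
      then have "steiner_fun \<Omega> \<rho> z = Sup {c. ennreal (2 * \<bar>fst z\<bar>) < m c (snd z)}"
        by (simp add: steiner_fun_def)
      also have "\<dots> = r z"
      proof (rule Sup_eq_of_rational_levels)
        show "m d (snd z) \<le> m c (snd z)" if "c \<le> d" for c d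
          unfolding m_def using that by (intro emeasure_mono) auto
        show "c < r z \<longleftrightarrow> ennreal (2 * \<bar>fst z\<bar>) < m c (snd z)" if "c \<in> \<rat>" for c
          using W that z by (auto simp: W_def)
      qed
      finally show "steiner_fun \<Omega> \<rho> z = \<rho> z" using eq z by simp
    qed
  qed
qed

section \<open>Lebesgue measurable functions and Borel representatives\<close>

definition energy_integrand :: "real \<Rightarrow> ('b::euclidean_space \<Rightarrow> real) \<Rightarrow> ('b \<Rightarrow> real) \<Rightarrow> 'b \<times> 'b \<Rightarrow> real" where
  "energy_integrand s u v z = (u (fst z) - u (snd z)) * (v (fst z) - v (snd z))
     / norm (fst z - snd z) powr (real DIM('b) + 2 * s)"

lemma energy_integrand_kernel: "energy_integrand s u v z = kernel s (fst z) (snd z) * ((u (fst z) - u (snd z)) * (v (fst z) - v (snd z)))"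
  by (simp add: energy_integrand_def kernel_def)

lemma Hs0_inner_energy_integrand: "Hs0_inner s u v = (LINT z|lebesgue. energy_integrand s u v z)"
  by (simp add: Hs0_inner_def energy_integrand_def case_prod_beta')

lemma measurable_energy_integrand:
  assumes [measurable]: "u \<in> borel_measurable borel" "v \<in> borel_measurable borel"
  shows "energy_integrand s u v \<in> borel_measurable borel"
  unfolding energy_integrand_kernel[abs_def] by measurable

text \<open>
Changing \<open>u\<close> on a null set \<open>N\<close> changes the integrand on the null set \<open>N \<times> \<real>\<^sup>N \<union> \<real>\<^sup>N \<times> N\<close> only.
\<close>
lemma energy_integrand_AE:
  fixes u u' v v' :: "'b::euclidean_space \<Rightarrow> real"
  assumes u: "AE x in lborel. u x = u' x" and v: "AE x in lborel. v x = v' x"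
    and m: "u' \<in> borel_measurable borel" "v' \<in> borel_measurable borel"
  shows "AE z in lebesgue. energy_integrand s u v z = energy_integrand s u' v' z"
    "energy_integrand s u v \<in> borel_measurable lebesgue" "energy_integrand s u' v' \<in> borel_measurable lebesgue"
proof -
  show 1: "AE z in lebesgue. energy_integrand s u v z = energy_integrand s u' v' z"
    using AE_completion[OF AE_fst_snd[OF u]] AE_completion[OF AE_fst_snd[OF v]]
    by eventually_elim (simp add: energy_integrand_def)
  show 2: "energy_integrand s u' v' \<in> borel_measurable lebesgue"
    using measurable_energy_integrand[OF m] by (intro measurable_completion) simp
  show "energy_integrand s u v \<in> borel_measurable lebesgue"
    by (rule borel_measurable_AE[OF 2]) (use 1 in eventually_elim, simp)
qed

lemma Hs0_inner_eq_energy: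
  assumes u: "AE x in lborel. u x = u' x" and v: "AE x in lborel. v x = v' x"
    and m: "u' \<in> borel_measurable borel" "v' \<in> borel_measurable borel"
  shows "Hs0_inner s u v = energy s u' v'"
proof -
  note [measurable] = m
  have "Hs0_inner s u v = (LINT z|lebesgue. energy_integrand s u' v' z)"
    unfolding Hs0_inner_energy_integrand using energy_integrand_AE[OF assms, of s] by (intro integral_cong_AE) auto
  also have "\<dots> = (LINT z|lborel. energy_integrand s u' v' z)"
    using measurable_energy_integrand[OF m] by (intro integral_completion) simp
  also have "\<dots> = energy s u' v'"
    unfolding energy_def by (subst gagliardo_lborel) (auto simp: energy_integrand_kernel[abs_def])
  finally show ?thesis .
qed

lemma integrable_energy_integrand_iff:
  assumes u: "AE x in lborel. u x = u' x" and m: "u' \<in> borel_measurable borel"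
  shows "integrable lebesgue (energy_integrand s u u) \<longleftrightarrow> integrable (gagliardo s) (\<lambda>z. (u' (fst z) - u' (snd z))\<^sup>2)"
proof -
  note [measurable] = m
  have "integrable lebesgue (energy_integrand s u u) \<longleftrightarrow> integrable lebesgue (energy_integrand s u' u')"
    using energy_integrand_AE[OF u u m m, of s] by (intro integrable_cong_AE) auto
  also have "\<dots> \<longleftrightarrow> integrable lborel (energy_integrand s u' u')"
    using measurable_energy_integrand[OF m m] by (intro integrable_completion) simp
  also have "\<dots> \<longleftrightarrow> integrable (gagliardo s) (\<lambda>z. (u' (fst z) - u' (snd z))\<^sup>2)"
    by (subst gagliardo_lborel) (auto simp: energy_integrand_kernel[abs_def] power2_eq_square)
  finally show ?thesis .
qed

lemma Hs0_representative:
  fixes u :: "real \<times> 'a::euclidean_space \<Rightarrow> real"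
  assumes \<Omega>: "open \<Omega>" and u: "u \<in> Hs0 s \<Omega>"
  shows "\<exists>u'\<in>W0 s \<Omega>. AE x in lborel. u x = u' x"
proof -
  have [measurable]: "\<Omega> \<in> sets borel" using \<Omega> by auto
  have um: "u \<in> borel_measurable lebesgue" and u2: "integrable lebesgue (\<lambda>x. (u x)\<^sup>2)"
    and uE: "integrable lebesgue (energy_integrand s u u)" and u0: "AE x in lborel. x \<notin> \<Omega> \<longrightarrow> u x = 0"
    using u by (auto simp: Hs0_def Hs_def energy_integrand_def[abs_def] case_prod_beta' power2_eq_square AE_completion_iff)
  from completion_ex_borel_measurable_real[OF um] obtain w where
    [measurable]: "w \<in> borel_measurable borel" and w: "AE x in lborel. u x = w x" by auto
  define u' where "u' x = indicator \<Omega> x * w x" for x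
  have m [measurable]: "u' \<in> borel_measurable borel" unfolding u'_def[abs_def] by measurable
  have ae: "AE x in lborel. u x = u' x"
    using w u0 by eventually_elim (auto simp: u'_def indicator_def)
  have "integrable lebesgue (\<lambda>x. (u' x)\<^sup>2)"
  proof (rule integrable_cong_AE_imp[OF u2])
    show "(\<lambda>x. (u' x)\<^sup>2) \<in> borel_measurable lebesgue" by (intro measurable_completion) simp
    show "AE x in lebesgue. (u x)\<^sup>2 = (u' x)\<^sup>2" using AE_completion[OF ae] by eventually_elim simp
  qed
  then have "integrable lborel (\<lambda>x. (u' x)\<^sup>2)" by (subst (asm) integrable_completion) auto
  moreover have "integrable (gagliardo s) (\<lambda>z. (u' (fst z) - u' (snd z))\<^sup>2)"
    using uE integrable_energy_integrand_iff[OF ae m] by blast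
  ultimately have "u' \<in> W0 s \<Omega>" by (auto simp: W0_def u'_def)
  then show ?thesis using ae by blast
qed

lemma W0_in_Hs0:
  fixes u :: "real \<times> 'a::euclidean_space \<Rightarrow> real"
  assumes u: "u \<in> W0 s \<Omega>"
  shows "u \<in> Hs0 s \<Omega>"
proof -
  note m = W0D(1)[OF u]
  note [measurable] = m
  have "u \<in> borel_measurable lebesgue" by (intro measurable_completion) simp
  moreover have "integrable lebesgue (\<lambda>x. (u x)\<^sup>2)"
    using W0D(3)[OF u] by (subst integrable_completion) auto
  moreover have "integrable lebesgue (energy_integrand s u u)"
    using W0D(4)[OF u] by (subst integrable_energy_integrand_iff[OF _ m]) auto
  ultimately show ?thesis
    using W0D(2)[OF u] by (auto simp: Hs0_def Hs_def energy_integrand_def[abs_def] case_prod_beta' power2_eq_square)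
qed

lemma weighted_integral_eq_weight_form:
  fixes u v :: "real \<times> 'a::euclidean_space \<Rightarrow> real"
  assumes \<Omega>: "open \<Omega>" and \<rho>: "AE x in lborel. x \<in> \<Omega> \<longrightarrow> \<rho> x = r x" and r: "r \<in> borel_measurable borel"
    and u: "AE x in lborel. u x = u' x" "u' \<in> W0 s \<Omega>" and v: "AE x in lborel. v x = v' x" "v' \<in> W0 s \<Omega>"
  shows "(LINT x|lebesgue_on \<Omega>. \<rho> x * u x * v x) = weight_form r u' v'"
proof -
  note [measurable] = r W0D(1)[OF u(2)] W0D(1)[OF v(2)]
  let ?f = "\<lambda>x. indicator \<Omega> x *\<^sub>R (\<rho> x * u x * v x)" and ?g = "\<lambda>x. r x * u' x * v' x"
  have ae: "AE x in lborel. ?f x = ?g x"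
    using \<rho> u(1) v(1) by eventually_elim (auto simp: indicator_def W0D(2)[OF u(2)])
  have g: "?g \<in> borel_measurable lebesgue" by (intro measurable_completion) simp
  have "AE x in lebesgue. ?g x = ?f x" using AE_completion[OF ae] by eventually_elim simp
  then have f: "?f \<in> borel_measurable lebesgue" by (rule borel_measurable_AE[OF g])
  have "(LINT x|lebesgue_on \<Omega>. \<rho> x * u x * v x) = (LINT x|lebesgue. ?f x)"
    using \<Omega> by (intro integral_restrict_space) auto
  also have "\<dots> = (LINT x|lebesgue. ?g x)"
    using f g AE_completion[OF ae] by (intro integral_cong_AE) auto
  also have "\<dots> = weight_form r u' v'" unfolding weight_form_def by (intro integral_completion) simp
  finally show ?thesis .
qed

lemma eigenvalue_iff_borel_eigenvalue:
  fixes \<Omega> :: "(real \<times> 'a::euclidean_space) set"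
  assumes \<Omega>: "open \<Omega>" and \<rho>: "AE x in lborel. x \<in> \<Omega> \<longrightarrow> \<rho> x = r x" and r: "r \<in> borel_measurable borel"
  shows "eigenvalue s \<Omega> \<rho> \<mu> \<longleftrightarrow> borel_eigenvalue s \<Omega> r \<mu>"
proof
  assume "eigenvalue s \<Omega> \<rho> \<mu>"
  then obtain u where u: "u \<in> Hs0 s \<Omega>" "\<not> (AE x in lebesgue. u x = 0)"
    "\<And>\<phi>. \<phi> \<in> Hs0 s \<Omega> \<Longrightarrow> Hs0_inner s u \<phi> = \<mu> * (LINT x|lebesgue_on \<Omega>. \<rho> x * u x * \<phi> x)"
    unfolding eigenvalue_def by blast
  obtain u' where u': "u' \<in> W0 s \<Omega>" "AE x in lborel. u x = u' x" using Hs0_representative[OF \<Omega> u(1)] by blast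
  have "\<not> (AE x in lborel. u' x = 0)"
  proof
    assume "AE x in lborel. u' x = 0"
    then have "AE x in lborel. u x = 0" using u'(2) by eventually_elim simp
    then show False using u(2) AE_completion by blast
  qed
  moreover have "energy s u' \<phi> = \<mu> * weight_form r u' \<phi>" if \<phi>: "\<phi> \<in> W0 s \<Omega>" for \<phi>
  proof -
    have ae: "AE x in lborel. \<phi> x = \<phi> x" by simp
    show ?thesis
      using u(3)[OF W0_in_Hs0[OF \<phi>]]
      unfolding Hs0_inner_eq_energy[OF u'(2) ae W0D(1)[OF u'(1)] W0D(1)[OF \<phi>]]
        weighted_integral_eq_weight_form[OF \<Omega> \<rho> r u'(2,1) ae \<phi>] .
  qed
  ultimately show "borel_eigenvalue s \<Omega> r \<mu>" unfolding borel_eigenvalue_def using u'(1) by blast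
next
  assume "borel_eigenvalue s \<Omega> r \<mu>"
  then obtain u where u: "u \<in> W0 s \<Omega>" "\<not> (AE x in lborel. u x = 0)"
    "\<And>\<phi>. \<phi> \<in> W0 s \<Omega> \<Longrightarrow> energy s u \<phi> = \<mu> * weight_form r u \<phi>"
    unfolding borel_eigenvalue_def by blast
  have "Hs0_inner s u \<phi> = \<mu> * (LINT x|lebesgue_on \<Omega>. \<rho> x * u x * \<phi> x)" if \<phi>: "\<phi> \<in> Hs0 s \<Omega>" for \<phi>
  proof -
    have ae: "AE x in lborel. u x = u x" by simp
    obtain \<phi>' where \<phi>': "\<phi>' \<in> W0 s \<Omega>" "AE x in lborel. \<phi> x = \<phi>' x" using Hs0_representative[OF \<Omega> \<phi>] by blast
    show ?thesis
      unfolding Hs0_inner_eq_energy[OF ae \<phi>'(2) W0D(1)[OF u(1)] W0D(1)[OF \<phi>'(1)]]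
        weighted_integral_eq_weight_form[OF \<Omega> \<rho> r ae u(1) \<phi>'(2,1)] by (rule u(3)[OF \<phi>'(1)])
  qed
  then show "eigenvalue s \<Omega> \<rho> \<mu>"
    unfolding eigenvalue_def using W0_in_Hs0[OF u(1)] u(2) by (auto simp: AE_completion_iff)
qed

lemma lambda1_eq:
  fixes \<Omega> :: "(real \<times> 'a::euclidean_space) set"
  assumes s: "0 < s" and \<Omega>: "open \<Omega>" "bounded \<Omega>"
    and \<rho>: "AE x in lborel. x \<in> \<Omega> \<longrightarrow> \<rho> x = r x"
    and r: "r \<in> borel_measurable borel" "\<And>x. \<bar>r x\<bar> \<le> B"
    and M: "0 < M" "maximizer s \<Omega> r M u"
  shows "lambda1 s \<Omega> \<rho> = 1 / M"
  unfolding lambda1_def eigenvalue_iff_borel_eigenvalue[OF \<Omega>(1) \<rho> r(1)]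
  by (rule least_borel_eigenvalue[OF s \<Omega>(2) r M])

section \<open>Rearrangement classes\<close>

lemma borel_representative:
  fixes g :: "real \<times> 'a::euclidean_space \<Rightarrow> real"
  assumes \<Omega>: "open \<Omega>" and g: "g \<in> borel_measurable (lebesgue_on \<Omega>)"
  shows "\<exists>r\<in>borel_measurable borel. AE x in lborel. x \<in> \<Omega> \<longrightarrow> g x = r x"
proof -
  have "(\<lambda>x. indicator \<Omega> x *\<^sub>R g x) \<in> borel_measurable lebesgue"
    using g \<Omega> by (subst (asm) borel_measurable_restrict_space_iff) auto
  from completion_ex_borel_measurable_real[OF this] obtain r where r: "r \<in> borel_measurable borel"
    "AE x in lborel. indicator \<Omega> x *\<^sub>R g x = r x" by auto
  from r(2) have "AE x in lborel. x \<in> \<Omega> \<longrightarrow> g x = r x" by eventually_elim auto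
  then show ?thesis using r(1) by blast
qed

lemma emeasure_superlevel_representative:
  fixes g :: "real \<times> 'a::euclidean_space \<Rightarrow> real"
  assumes \<Omega>: "open \<Omega>" and [measurable]: "r \<in> borel_measurable borel" and g: "AE x in lborel. x \<in> \<Omega> \<longrightarrow> g x = r x"
  shows "emeasure lebesgue {x \<in> \<Omega>. g x > t} = emeasure lborel {x \<in> \<Omega>. r x > t}"
proof (rule emeasure_lebesgue_AE_eq)
  have [measurable]: "\<Omega> \<in> sets borel" using \<Omega> by auto
  show "{x \<in> \<Omega>. r x > t} \<in> sets borel" by measurable
  show "AE x in lborel. x \<in> {x \<in> \<Omega>. g x > t} \<longleftrightarrow> x \<in> {x \<in> \<Omega>. r x > t}"
    using g by eventually_elim auto
qed

text \<open>
Rearrangements share the measures of all superlevel sets, so the essential bounds of \<open>\<rho>\<^sub>0\<close> pass to \<open>g\<close>; truncating a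
Borel representative at these bounds makes it bounded everywhere.
\<close>
lemma rearrangement_class_representative:
  fixes \<Omega> :: "(real \<times> 'a::euclidean_space) set"
  assumes \<Omega>: "open \<Omega>" "bounded \<Omega>" and \<rho>0: "\<rho>\<^sub>0 \<in> Linfty \<Omega>" and g: "g \<in> rearrangement_class \<Omega> \<rho>\<^sub>0"
  shows "\<exists>r B. r \<in> borel_measurable borel \<and> (\<forall>x. \<bar>r x\<bar> \<le> B) \<and> (AE x in lborel. x \<in> \<Omega> \<longrightarrow> g x = r x)"
proof -
  have [measurable]: "\<Omega> \<in> sets borel" using \<Omega> by auto
  obtain M where M: "AE x in lebesgue_on \<Omega>. \<bar>\<rho>\<^sub>0 x\<bar> \<le> M" and m0: "\<rho>\<^sub>0 \<in> borel_measurable (lebesgue_on \<Omega>)"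
    using \<rho>0 by (auto simp: Linfty_def)
  obtain p where [measurable]: "p \<in> borel_measurable borel" and p: "AE x in lborel. x \<in> \<Omega> \<longrightarrow> \<rho>\<^sub>0 x = p x"
    using borel_representative[OF \<Omega>(1) m0] by blast
  have "AE x in lborel. x \<in> \<Omega> \<longrightarrow> \<bar>\<rho>\<^sub>0 x\<bar> \<le> M"
    using M \<Omega>(1) by (simp add: AE_restrict_space_iff AE_completion_iff)
  then have pM: "AE x in lborel. x \<in> \<Omega> \<longrightarrow> \<bar>p x\<bar> \<le> M" using p by eventually_elim auto
  obtain q where [measurable]: "q \<in> borel_measurable borel" and q: "AE x in lborel. x \<in> \<Omega> \<longrightarrow> g x = q x"
    using borel_representative[OF \<Omega>(1)] g by (auto simp: rearrangement_class_def)
  have eq: "emeasure lborel {x \<in> \<Omega>. q x > t} = emeasure lborel {x \<in> \<Omega>. p x > t}" for t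
    using g emeasure_superlevel_representative[OF \<Omega>(1) _ q, of t] emeasure_superlevel_representative[OF \<Omega>(1) _ p, of t]
    by (simp add: rearrangement_class_def rearrangement_def)
  have fin: "emeasure lborel \<Omega> < \<infinity>" using emeasure_bounded_finite[OF \<Omega>(2)] .
  have "emeasure lborel {x \<in> space lborel. x \<in> \<Omega> \<and> p x > M} = 0"
    by (rule emeasure_eq_0_AE) (use pM in eventually_elim, auto)
  then have "{x \<in> \<Omega>. q x > M} \<in> null_sets lborel" using eq[of M] by (simp add: null_sets_def)
  then have up: "AE x in lborel. x \<in> \<Omega> \<longrightarrow> q x \<le> M" by (rule AE_I') auto
  \<comment> \<open>The level \<open>- M - 1\<close> lies strictly below all values of \<open>p\<close>; the strict superlevel set at \<open>- M\<close> could miss part of \<open>\<Omega>\<close>.\<close>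
  have "emeasure lborel {x \<in> \<Omega>. p x > - M - 1} = emeasure lborel \<Omega>"
    by (rule emeasure_eq_AE) (use pM in eventually_elim, auto)
  then have "emeasure lborel (\<Omega> - {x \<in> \<Omega>. q x > - M - 1}) = 0"
    using eq[of "- M - 1"] fin by (subst emeasure_Diff) auto
  then have "\<Omega> - {x \<in> \<Omega>. q x > - M - 1} \<in> null_sets lborel" by (simp add: null_sets_def)
  then have low: "AE x in lborel. x \<in> \<Omega> \<longrightarrow> - M - 1 < q x" by (rule AE_I') auto
  define B where "B = \<bar>M\<bar> + 1"
  define r where "r x = max (- B) (min B (q x))" for x
  have "r \<in> borel_measurable borel" unfolding r_def[abs_def] by measurable
  moreover have "\<bar>r x\<bar> \<le> B" for x by (auto simp: r_def B_def)
  moreover have "AE x in lborel. x \<in> \<Omega> \<longrightarrow> g x = r x"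
    using q up low by eventually_elim (auto simp: r_def B_def max_def min_def)
  ultimately show ?thesis by blast
qed

text \<open>
Polarization permutes the two values on each pair of mirror points, so the number of points of the pair that lie in the
superlevel set stays the same.
\<close>
lemma emeasure_fold_weight:
  fixes \<Omega> :: "(real \<times> 'a::euclidean_space) set"
  assumes \<Omega>: "open \<Omega>" "bounded \<Omega>" and [measurable]: "r \<in> borel_measurable borel" and a: "a \<noteq> 0"
  shows "emeasure lborel {x \<in> \<Omega>. fold_weight a \<Omega> r x > t} = emeasure lborel {x \<in> \<Omega>. r x > t}"
proof -
  have [measurable]: "\<Omega> \<in> sets borel" using \<Omega> by auto
  define A where "A = {x \<in> \<Omega>. fold_weight a \<Omega> r x > t}"
  define C where "C = {x \<in> \<Omega>. r x > t}"
  have [measurable]: "A \<in> sets borel" "C \<in> sets borel" unfolding A_def C_def by measurable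
  have fin: "emeasure lborel A < \<infinity>" "emeasure lborel C < \<infinity>"
    by (rule emeasure_bounded_finite, rule bounded_subset[OF \<Omega>(2)], force simp: A_def C_def)+
  have pt: "indicator A x + indicator A (mirror a x) = (indicator C x + indicator C (mirror a x) :: real)" for x
  proof (cases "x \<in> \<Omega> \<and> mirror a x \<in> \<Omega>")
    case True
    then show ?thesis
      using polarize_mirror[OF a, of r x]
      by (auto simp: A_def C_def indicator_def fold_weight_def polarize_def max_def min_def)
  next
    case False
    then show ?thesis by (auto simp: A_def C_def indicator_def fold_weight_def)
  qed
  have i: "integrable lborel (indicator A :: _ \<Rightarrow> real)" "integrable lborel (indicator C :: _ \<Rightarrow> real)"
    using fin by auto
  then have j: "integrable lborel (\<lambda>x. indicator A (mirror a x) :: real)" "integrable lborel (\<lambda>x. indicator C (mirror a x) :: real)"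
    by (simp_all add: integral_mirror(1)[of "indicator A"] integral_mirror(1)[of "indicator C"])
  have "(\<integral>x. indicator A x + indicator A (mirror a x) \<partial>lborel) = (\<integral>x. indicator C x + (indicator C (mirror a x) :: real) \<partial>lborel)"
    by (simp only: pt)
  then have "2 * measure lborel A = 2 * measure lborel C"
    using i j by (simp add: integral_mirror(2)[of "indicator A"] integral_mirror(2)[of "indicator C"])
  then show ?thesis
    using fin unfolding A_def[symmetric] C_def[symmetric] by (simp add: emeasure_eq_ennreal_measure less_top)
qed

section \<open>Steiner symmetry of optimal weights\<close>

lemma steiner_set_x1_symmetric_convex: "steiner_set \<Omega> = \<Omega> \<Longrightarrow> x1_symmetric_convex \<Omega>"
  unfolding x1_symmetric_convex_def
proof (intro allI impI)
  fix t \<tau> x assume \<Omega>: "steiner_set \<Omega> = \<Omega>" and t: "(t, x) \<in> \<Omega>" "\<bar>\<tau>\<bar> \<le> \<bar>t\<bar>"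
  have "(t, x) \<in> steiner_set \<Omega>" using \<Omega> t by simp
  then have "ennreal (2 * \<bar>t\<bar>) < emeasure lebesgue {t. (t, x) \<in> \<Omega>}" by (simp add: steiner_set_def)
  moreover have "ennreal (2 * \<bar>\<tau>\<bar>) \<le> ennreal (2 * \<bar>t\<bar>)" using t by (intro ennreal_leI) simp
  ultimately have "ennreal (2 * \<bar>\<tau>\<bar>) < emeasure lebesgue {t. (t, x) \<in> \<Omega>}" by (rule le_less_trans[rotated])
  then have "(\<tau>, x) \<in> steiner_set \<Omega>" by (simp add: steiner_set_def)
  then show "(\<tau>, x) \<in> \<Omega>" using \<Omega> by simp
qed

theorem theorem5p4:
  fixes \<Omega> :: "(real \<times> 'a::euclidean_space) set"
    and s :: real
    and \<rho>\<^sub>0 \<rho> :: "real \<times> 'a \<Rightarrow> real"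
  assumes "0 < s" and "s < 1"
    and "bounded_C2_domain \<Omega>"
    and "steiner_set \<Omega> = \<Omega>"
    and "\<rho>\<^sub>0 \<in> Linfty \<Omega>"
    and "emeasure lebesgue {x \<in> \<Omega>. \<rho>\<^sub>0 x > 0} > 0"
    and "is_arg_min (lambda1 s \<Omega>) (\<lambda>g. g \<in> rearrangement_class \<Omega> \<rho>\<^sub>0) \<rho>"
  shows "AE x in lebesgue_on \<Omega>. steiner_fun \<Omega> \<rho> x = \<rho> x"
proof -
  note s = assms(1,2)
  have \<Omega>: "open \<Omega>" "bounded \<Omega>" "\<Omega> \<noteq> {}" using assms(3) by (auto simp: bounded_C2_domain_def)
  have conv: "x1_symmetric_convex \<Omega>" by (rule steiner_set_x1_symmetric_convex[OF assms(4)])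
  have [measurable]: "\<Omega> \<in> sets borel" using \<Omega> by auto
  have cls: "\<rho> \<in> rearrangement_class \<Omega> \<rho>\<^sub>0"
    and opt: "\<And>g. g \<in> rearrangement_class \<Omega> \<rho>\<^sub>0 \<Longrightarrow> lambda1 s \<Omega> \<rho> \<le> lambda1 s \<Omega> g"
    using assms(7) by (auto simp: is_arg_min_def not_less)
  obtain r B where r: "r \<in> borel_measurable borel" "\<And>x. \<bar>r x\<bar> \<le> B"
    and \<rho>: "AE x in lborel. x \<in> \<Omega> \<longrightarrow> \<rho> x = r x"
    using rearrangement_class_representative[OF \<Omega>(1,2) assms(5) cls] by blast
  note [measurable] = r(1)
  have lev: "emeasure lborel {x \<in> \<Omega>. r x > t} = emeasure lebesgue {x \<in> \<Omega>. \<rho>\<^sub>0 x > t}" for t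
    using cls emeasure_superlevel_representative[OF \<Omega>(1) r(1) \<rho>, of t]
    by (simp add: rearrangement_class_def rearrangement_def)
  have posw: "\<not> (AE x in lborel. x \<in> \<Omega> \<longrightarrow> w x \<le> 0)"
    if [measurable]: "w \<in> borel_measurable borel"
      and w: "emeasure lborel {x \<in> \<Omega>. w x > 0} = emeasure lborel {x \<in> \<Omega>. r x > 0}" for w :: "real \<times> 'a \<Rightarrow> real"
  proof
    assume "AE x in lborel. x \<in> \<Omega> \<longrightarrow> w x \<le> 0"
    then have "emeasure lborel {x \<in> space lborel. x \<in> \<Omega> \<and> w x > 0} = 0"
      by (intro emeasure_eq_0_AE) (auto elim!: eventually_mono)
    then show False using w lev[of 0] assms(6) by simp
  qed
  obtain M u\<^sub>0 where M: "0 < M" and m0: "maximizer s \<Omega> r M u\<^sub>0"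
    using maximizer_exists[OF s \<Omega>(1,2) r posw[OF r(1) refl]] by blast
  define u where "u x = \<bar>u\<^sub>0 x\<bar>" for x
  have m: "maximizer s \<Omega> r M u" unfolding u_def by (rule maximizer_abs[OF M m0])
  have l: "lambda1 s \<Omega> \<rho> = 1 / M" by (rule lambda1_eq[OF s(1) \<Omega>(1,2) \<rho> r M m])
  have "AE x in lborel. x \<in> \<Omega> \<and> x \<in> halfspace a \<and> mirror a x \<in> \<Omega> \<longrightarrow> r (mirror a x) \<le> r x" if a: "a \<noteq> 0" for a
  proof (rule polarization_optimal[OF s \<Omega> conv r a M m])
    show "0 \<le> u x" for x by (simp add: u_def)
    let ?r = "fold_weight a \<Omega> r"
    have r': "?r \<in> borel_measurable borel" "\<And>x. \<bar>?r x\<bar> \<le> B"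
      by (measurable, rule fold_weight_bound[OF r(2)])
    have lev': "emeasure lborel {x \<in> \<Omega>. ?r x > t} = emeasure lborel {x \<in> \<Omega>. r x > t}" for t
      by (rule emeasure_fold_weight[OF \<Omega>(1,2) r(1) a])
    obtain K v where K: "0 < K" and v: "maximizer s \<Omega> ?r K v"
      using maximizer_exists[OF s \<Omega>(1,2) r' posw[OF r'(1) lev']] by blast
    have "lambda1 s \<Omega> ?r = 1 / K" by (rule lambda1_eq[OF s(1) \<Omega>(1,2) _ r' K v]) simp
    moreover have "?r \<in> rearrangement_class \<Omega> \<rho>\<^sub>0"
    proof -
      have "?r \<in> borel_measurable lebesgue" by (intro measurable_completion) simp
      then have "?r \<in> borel_measurable (lebesgue_on \<Omega>)" by (rule measurable_restrict_space1)
      moreover have "emeasure lebesgue {x \<in> \<Omega>. ?r x > t} = emeasure lebesgue {x \<in> \<Omega>. \<rho>\<^sub>0 x > t}" for t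
        using emeasure_superlevel_representative[OF \<Omega>(1) r'(1), of ?r t] lev'[of t] lev[of t] by simp
      ultimately show ?thesis by (simp add: rearrangement_class_def rearrangement_def)
    qed
    ultimately have "1 / M \<le> 1 / K" using opt[of ?r] l by simp
    then have KM: "K \<le> M" using M K by (simp add: field_simps)
    show "weight_form ?r f f \<le> M * energy s f f" if f: "f \<in> W0 s \<Omega>" for f
    proof -
      have "weight_form ?r f f \<le> K * energy s f f" using v f by (simp add: maximizer_def)
      also have "\<dots> \<le> M * energy s f f" using KM energy_nonneg[of s f] by (intro mult_right_mono)
      finally show ?thesis .
    qed
  qed
  then have "AE x in lborel. x \<in> \<Omega> \<longrightarrow> steiner_fun \<Omega> \<rho> x = \<rho> x"
    by (intro steiner_fun_of_mirror_ordered[OF \<Omega>(1,2) conv r(1) _ \<rho>])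
  then have "AE x in lebesgue. x \<in> \<Omega> \<longrightarrow> steiner_fun \<Omega> \<rho> x = \<rho> x" by (rule AE_completion)
  then show ?thesis using \<Omega>(1) by (simp add: AE_restrict_space_iff)
qed

end
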